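(* Let $n>1$ be an integer, let $B$ be the unit ball of $\mathbf{C}^n$, and let $\varphi$ be holomorphic on $B$. Let $1<p<\infty$ and $0\le\sigma<\infty$ with $1+\sigma>\frac{n}{p}$. Then the following conditions are equivalent: (i) The multiplication operator $M_\varphi:B_p^\sigma(B)\to B_p^\sigma(B)$, $M_\varphi f=\varphi f$, is bounded. (ii) $\varphi\in H^\infty$, and the positive Borel measure $\mu_\varphi$ on $B$ defined by $$d\mu_\varphi(z)=|R\varphi(z)|^p(1-|z|^2)^{p+\sigma p-n-1}\,dv(z)$$ is a Carleson measure for $B_p^\sigma(B)$.
   Context: $B=\{z\in\mathbf{C}^n:|z|<1\}$, $dv$ is Lebesgue measure on $B$ normalized by $v(B)=1$, $d\lambda(z)=(1-|z|^2)^{-n-1}dv(z)$, and $H(B)$ is the space of holomorphic functions on $B$; $H^\infty$ is the space of bounded holomorphic functions on $B$. For $f\in H(B)$ the radial derivative is $Rf(z)=\sum_{j=1}^n z_j\frac{\partial f}{\partial z_j}(z)$. For $1<p<\infty$, $0\le\sigma<\infty$ with $1+\sigma>n/p$, the Besov-Sobolev space $B_p^\sigma(B)$ is the Banach space of $f\in H(B)$ with $$\|f\|_{B_p^\sigma(B)}=\left\{|f(0)|^p+\int_B|(1-|z|^2)^{1+\sigma}f'(z)|^p\,d\lambda(z)\right\}^{1/p}<\infty,$$ where $f'$ is the first order complex derivative (the complex gradient $(\partial f/\partial z_1,\dots,\partial f/\partial z_n)$); the norm is considered up to equivalence. A positive Borel measure $\mu$ on $B$ is a Carleson measure for $B_p^\sigma(B)$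 if there is a constant $C>0$ such that $\int_B|f(z)|^p\,d\mu(z)\le C\|f\|_{B_p^\sigma(B)}^p$ for all $f\in B_p^\sigma(B)$. *)

theory Defs
  imports "HOL-Analysis.Analysis"
begin

text \<open>
  The dimension \<open>n\<close> is \<open>CARD('n)\<close>, and \<open>ball 0 1 :: (complex ^ 'n) set\<close> is the unit ball \<open>B\<close>
  (the library norm on \<open>complex ^ 'n\<close> is the Hermitian norm).  A function on \<open>B\<close> is represented by
  a total function; every notion below depends only on its values on \<open>B\<close>.
\<close>

text \<open>
  Holomorphy in several variables: Frechet differentiability with a complex-linear derivative
  (a real-linear derivative is what the library notion provides).
\<close>

definition holomorphic_ball :: "(complex ^ 'n \<Rightarrow> complex) \<Rightarrow> bool" where
  "holomorphic_ball f \<longleftrightarrow>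
     (\<forall>z\<in>ball 0 1. \<exists>D. (f has_derivative D) (at z) \<and> (\<forall>c v. D (c *s v) = c * D v))"

definition Hinfty :: "(complex ^ 'n \<Rightarrow> complex) set" where
  "Hinfty = {f. holomorphic_ball f \<and> bounded (f ` ball 0 1)}"

definition partial_deriv :: "'n \<Rightarrow> (complex ^ 'n \<Rightarrow> complex) \<Rightarrow> complex ^ 'n \<Rightarrow> complex" where
  "partial_deriv j f z = deriv (\<lambda>w. f (\<chi> i. if i = j then w else z $ i)) (z $ j)"

definition complex_gradient :: "(complex ^ 'n \<Rightarrow> complex) \<Rightarrow> complex ^ 'n \<Rightarrow> complex ^ 'n" where
  "complex_gradient f z = (\<chi> j. partial_deriv j f z)"

definition radial_deriv :: "(complex ^ 'n \<Rightarrow> complex) \<Rightarrow> complex ^ 'n \<Rightarrow> complex" where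
  "radial_deriv f z = (\<Sum>j\<in>UNIV. z $ j * partial_deriv j f z)"

text \<open>The measures \<open>dv\<close> and \<open>d\<lambda>\<close>; both have \<open>B\<close> itself as underlying space.\<close>

definition ball_volume_measure :: "(complex ^ 'n) measure" where
  "ball_volume_measure = restrict_space (uniform_measure lborel (ball 0 1)) (ball 0 1)"

definition ball_invariant_measure :: "(complex ^ 'n) measure" where
  "ball_invariant_measure =
     density ball_volume_measure
       (\<lambda>z. ennreal ((1 - (norm z)\<^sup>2) powr (- real CARD('n) - 1)))"

text \<open>The \<open>p\<close>-th power of the Besov-Sobolev norm, with value \<open>\<infinity>\<close> allowed.\<close>

definition besov_energy :: "real \<Rightarrow> real \<Rightarrow> (complex ^ 'n \<Rightarrow> complex) \<Rightarrow> ennreal" where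
  "besov_energy p \<sigma> f =
     ennreal (norm (f 0) powr p) +
     (\<integral>\<^sup>+ z. ennreal (((1 - (norm z)\<^sup>2) powr (1 + \<sigma>) * norm (complex_gradient f z)) powr p)
        \<partial>ball_invariant_measure)"

definition besov_space :: "real \<Rightarrow> real \<Rightarrow> (complex ^ 'n \<Rightarrow> complex) set" where
  "besov_space p \<sigma> = {f. holomorphic_ball f \<and> besov_energy p \<sigma> f < \<infinity>}"

definition besov_norm :: "real \<Rightarrow> real \<Rightarrow> (complex ^ 'n \<Rightarrow> complex) \<Rightarrow> real" where
  "besov_norm p \<sigma> f = enn2real (besov_energy p \<sigma> f) powr (1 / p)"

definition mult_op ::
  "(complex ^ 'n \<Rightarrow> complex) \<Rightarrow> (complex ^ 'n \<Rightarrow> complex) \<Rightarrow> complex ^ 'n \<Rightarrow> complex" where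
  "mult_op \<phi> f = (\<lambda>z. \<phi> z * f z)"

definition besov_bounded_op ::
  "real \<Rightarrow> real \<Rightarrow> ((complex ^ 'n \<Rightarrow> complex) \<Rightarrow> complex ^ 'n \<Rightarrow> complex) \<Rightarrow> bool" where
  "besov_bounded_op p \<sigma> T \<longleftrightarrow>
     (\<forall>f\<in>besov_space p \<sigma>. T f \<in> besov_space p \<sigma>) \<and>
     (\<exists>C. \<forall>f\<in>besov_space p \<sigma>. besov_norm p \<sigma> (T f) \<le> C * besov_norm p \<sigma> f)"

text \<open>The integral is taken in \<open>[0, \<infinity>]\<close>, so the inequality includes its finiteness.\<close>

definition besov_carleson :: "real \<Rightarrow> real \<Rightarrow> (complex ^ 'n) measure \<Rightarrow> bool" where
  "besov_carleson p \<sigma> \<mu> \<longleftrightarrow>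
     sets \<mu> = sets (restrict_space borel (ball 0 1)) \<and>
     (\<exists>C>0. \<forall>f\<in>besov_space p \<sigma>.
        (\<integral>\<^sup>+ z. ennreal (norm (f z) powr p) \<partial>\<mu>) \<le> ennreal (C * besov_norm p \<sigma> f powr p))"

definition multiplier_measure ::
  "real \<Rightarrow> real \<Rightarrow> (complex ^ 'n \<Rightarrow> complex) \<Rightarrow> (complex ^ 'n) measure" where
  "multiplier_measure p \<sigma> \<phi> =
     density ball_volume_measure
       (\<lambda>z. ennreal (norm (radial_deriv \<phi> z) powr p *
                      (1 - (norm z)\<^sup>2) powr (p + \<sigma> * p - real CARD('n) - 1)))"

end

theory Submission
  imports Defs "HOL-Complex_Analysis.Complex_Analysis"
begin

text \<open>
  Write \<open>a = p (1 + \<sigma>) - n - 1\<close>.  Up to constants the energy of \<open>g\<close> is \<open>\<bar>g(0)\<bar>^p\<close> plus the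
  integral of \<open>\<bar>g'\<bar>^p (1 - \<bar>z\<bar>)^a\<close>, the integral of \<open>\<bar>f\<bar>^p\<close> against the multiplier measure is that
  of \<open>\<bar>f R\<phi>\<bar>^p (1 - \<bar>z\<bar>)^a\<close>, and \<open>1 + \<sigma> > n/p\<close> says exactly that \<open>a > -1\<close>.  Two facts carry the
  proof.

  The first is that the gradient may be replaced by the radial derivative
  (\<open>besov_energy_le_radial_energy\<close>, \<open>radial_energy_le_besov_energy\<close>).  Since \<open>\<bar>Rg\<bar> \<le> \<bar>g'\<bar>\<close> on the ball,
  only the bound of \<open>\<partial>\<^sub>j g\<close> by \<open>Rg\<close> has content (\<open>bergman_partial_deriv_le_radial_deriv\<close>).  As second
  derivatives commute, \<open>d/dt (t \<partial>\<^sub>j g(tz)) = \<partial>\<^sub>j(Rg)(tz)\<close>, so \<open>\<partial>\<^sub>j g(z)\<close> is the integral of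
  \<open>\<partial>\<^sub>j(Rg)(tz)\<close> over \<open>0 \<le> t \<le> 1\<close>.  Differentiating \<open>Rg\<close> costs one power of \<open>1 - \<bar>z\<bar>\<close>, by the Cauchy
  estimate on balls whose radius is comparable to the distance to the sphere
  (\<open>bergman_partial_deriv_le\<close>); integrating along the radius gains it back, by a Hardy inequality
  that is valid because \<open>a > -1\<close> (\<open>weighted_hoelder\<close> with the kernel \<open>(1 - t\<bar>z\<bar>)^(-q)\<close>, followed by
  \<open>nn_integral_dilation_le\<close>).

  The second is that point evaluations are bounded (\<open>point_evaluation_bounded\<close>), because \<open>\<bar>h(z)\<bar>^p\<close> is
  at most its average over any ball around \<open>z\<close> (\<open>submean_ball\<close>).

  If multiplication by \<open>\<phi>\<close> is bounded, with constant \<open>C\<close> for the energies, then \<open>\<phi>^k\<close>, the image of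
  the function \<open>1\<close> under the \<open>k\<close>-th iterate, has energy at most \<open>C^k\<close>.  Evaluating at \<open>z\<close> gives
  \<open>\<bar>\<phi>(z)\<bar>^(pk) \<le> D C^k\<close> for all \<open>k\<close>, hence \<open>\<bar>\<phi>(z)\<bar>^p \<le> C\<close>; and the Carleson inequality is read off
  from \<open>f R\<phi> = R(\<phi>f) - \<phi> Rf\<close>.  Conversely, if \<open>\<phi>\<close> is bounded and the Carleson inequality holds, the
  same product rule bounds the integral of \<open>\<bar>R(\<phi>f)\<bar>^p (1 - \<bar>z\<bar>)^a\<close>, and the first fact turns this into
  a bound for the energy of \<open>\<phi>f\<close>.  The Carleson hypothesis concerns \<open>R\<phi>\<close> alone and not the full
  gradient of \<open>\<phi>\<close>; this is why the first fact is indispensable.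
\<close>

section \<open>Lebesgue measure under translations, dilations and isometries\<close>

lemma nn_integral_lborel_translate:
  fixes f :: "'a::euclidean_space \<Rightarrow> ennreal"
  assumes [measurable]: "f \<in> borel_measurable borel"
  shows "(\<integral>\<^sup>+x. f (a + x) \<partial>lborel) = (\<integral>\<^sup>+x. f x \<partial>lborel)"
proof -
  have "(\<integral>\<^sup>+x. f x \<partial>lborel) = (\<integral>\<^sup>+x. f x \<partial>distr lborel borel ((+) a))"
    by (simp add: lborel_distr_plus)
  also have "\<dots> = (\<integral>\<^sup>+x. f (a + x) \<partial>lborel)"
    by (subst nn_integral_distr) auto
  finally show ?thesis by simp
qed

lemma nn_integral_lborel_scale:
  fixes f :: "'a::euclidean_space \<Rightarrow> ennreal"
  assumes [measurable]: "f \<in> borel_measurable borel" and "c > 0"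
  shows "(\<integral>\<^sup>+x. f x \<partial>lborel) = ennreal (c ^ DIM('a)) * (\<integral>\<^sup>+x. f (c *\<^sub>R x) \<partial>lborel)"
proof -
  have "(\<integral>\<^sup>+x. f x \<partial>lborel) =
      (\<integral>\<^sup>+x. f x \<partial>density (distr lborel borel (\<lambda>x. 0 + c *\<^sub>R x)) (\<lambda>_. \<bar>c\<bar>^DIM('a)))"
    using lborel_affine[of c "0::'a"] \<open>c > 0\<close> by simp
  also have "\<dots> = (\<integral>\<^sup>+x. ennreal (\<bar>c\<bar>^DIM('a)) * f (c *\<^sub>R x) \<partial>lborel)"
    by (subst nn_integral_density, simp, simp, subst nn_integral_distr) auto
  also have "\<dots> = ennreal (c ^ DIM('a)) * (\<integral>\<^sup>+x. f (c *\<^sub>R x) \<partial>lborel)"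
    using \<open>c > 0\<close> by (subst nn_integral_cmult) auto
  finally show ?thesis .
qed

lemma emeasure_lborel_ball_translate:
  fixes x :: "'a::euclidean_space"
  shows "emeasure lborel (ball x r) = emeasure lborel (ball (0::'a) r)"
proof -
  have "(\<integral>\<^sup>+y. indicator (ball x r) (x + y) \<partial>lborel) = (\<integral>\<^sup>+y. indicator (ball x r) y \<partial>lborel)"
    by (rule nn_integral_lborel_translate) (intro borel_measurable_indicator, simp)
  moreover have "indicator (ball x r) (x + y) = (indicator (ball 0 r) y :: ennreal)" for y
    by (auto simp: indicator_def dist_norm)
  ultimately show ?thesis by simp
qed

lemma emeasure_lborel_ball_scale:
  fixes x :: "'a::euclidean_space"
  assumes "r > 0"
  shows "emeasure lborel (ball x r) = ennreal (r ^ DIM('a)) * emeasure lborel (ball (0::'a) 1)"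
proof -
  have "emeasure lborel (ball (0::'a) r) = (\<integral>\<^sup>+y. indicator (ball (0::'a) r) y \<partial>lborel)"
    by simp
  also have "\<dots> = ennreal (r ^ DIM('a)) * (\<integral>\<^sup>+y. indicator (ball (0::'a) r) (r *\<^sub>R y) \<partial>lborel)"
    by (intro nn_integral_lborel_scale borel_measurable_indicator assms) simp
  also have "(\<integral>\<^sup>+y. indicator (ball (0::'a) r) (r *\<^sub>R y) \<partial>lborel) = (\<integral>\<^sup>+y. indicator (ball (0::'a) 1) y \<partial>lborel)"
    using assms by (intro nn_integral_cong) (auto simp: indicator_def)
  finally show ?thesis by (simp add: emeasure_lborel_ball_translate[of x])
qed

text \<open>
  The image of Lebesgue measure under an isometry is again invariant under translations, and such a
  measure is determined up to a factor: computing the integral of \<open>1\<^sub>A(x) 1\<^sub>B(x + y)\<close> in both orders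
  compares the two measures on \<open>B\<close> through their values on a ball \<open>A\<close>.  The factor is 1 because the
  isometry preserves \<open>A\<close>.
\<close>

lemma distr_lborel_orthogonal_transformation:
  fixes T :: "'a::euclidean_space \<Rightarrow> 'a"
  assumes T: "orthogonal_transformation T"
  shows "distr lborel borel T = lborel"
proof (rule measure_eqI)
  fix B assume "B \<in> sets (distr lborel borel T)"
  then have B [measurable]: "B \<in> sets borel" by simp
  define A where "A = ball (0::'a) 1"
  define a b :: "'a \<Rightarrow> ennreal" where "a = indicator A" and "b = indicator B"
  have [measurable]: "A \<in> sets borel" by (simp add: A_def)
  have [measurable]: "a \<in> borel_measurable borel" "b \<in> borel_measurable borel"
    unfolding a_def b_def by auto
  have lin: "linear T" by (rule orthogonal_transformation_linear[OF T])
  have [measurable]: "T \<in> borel_measurable borel"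
    using lin by (intro borel_measurable_continuous_onI linear_continuous_on linear_conv_bounded_linear[THEN iffD1])
  have surj: "surj T" by (rule orthogonal_transformation_surj[OF T])
  have norm: "norm (T x) = norm x" for x by (rule orthogonal_transformation_norm[OF T])
  \<comment> \<open>Translation invariance of the image measure: a translation by y of the image is the image of
     a translation by s, where T s = y.\<close>
  have shift: "(\<integral>\<^sup>+x. a (T x) * b (T x + y) \<partial>lborel)
      = (\<integral>\<^sup>+x. a (T x - y) * b (T x) \<partial>lborel)" (is "?l = ?r") for y
  proof -
    obtain s where s: "T s = y" using surj by (metis surjD)
    have "?r = (\<integral>\<^sup>+x. a (T (s + x) - y) * b (T (s + x)) \<partial>lborel)"
      by (rule nn_integral_lborel_translate[symmetric]) measurable
    also have "\<dots> = ?l"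
      by (simp add: linear_add[OF lin] s add.commute)
    finally show ?thesis by simp
  qed
  have vol: "emeasure lborel A \<noteq> 0" "emeasure lborel A \<noteq> \<infinity>"
    using emeasure_lborel_ball_finite[of "0::'a" 1] content_ball_pos[of 1 "0::'a"]
    unfolding A_def measure_def by auto
  have "emeasure lborel B * emeasure lborel A
      = (\<integral>\<^sup>+x. (\<integral>\<^sup>+y. a x * b y \<partial>lborel) \<partial>lborel)"
    by (simp add: nn_integral_cmult nn_integral_multc mult.commute) (simp add: a_def b_def mult.commute)
  also have "\<dots> = (\<integral>\<^sup>+x. (\<integral>\<^sup>+y. a (T x) * b (T x + y) \<partial>lborel) \<partial>lborel)"
  proof (rule nn_integral_cong)
    fix x :: 'a
    have "(\<integral>\<^sup>+y. a x * b y \<partial>lborel)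
        = (\<integral>\<^sup>+y. a x * (b (T x + y) :: ennreal) \<partial>lborel)"
      by (rule nn_integral_lborel_translate[symmetric]) measurable
    then show "(\<integral>\<^sup>+y. a x * b y \<partial>lborel)
        = (\<integral>\<^sup>+y. a (T x) * (b (T x + y) :: ennreal) \<partial>lborel)"
      by (simp add: norm a_def A_def indicator_def)
  qed
  also have "\<dots> = (\<integral>\<^sup>+y. (\<integral>\<^sup>+x. a (T x) * b (T x + y) \<partial>lborel) \<partial>lborel)"
    by (rule lborel_pair.Fubini') measurable
  also have "\<dots> = (\<integral>\<^sup>+y. (\<integral>\<^sup>+x. a (T x - y) * b (T x) \<partial>lborel) \<partial>lborel)"
    by (simp add: shift)
  also have "\<dots> = (\<integral>\<^sup>+x. (\<integral>\<^sup>+y. a (T x - y) * b (T x) \<partial>lborel) \<partial>lborel)"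
    by (rule lborel_pair.Fubini') measurable
  also have "\<dots> = (\<integral>\<^sup>+x. emeasure lborel A * b (T x) \<partial>lborel)"
  proof (rule nn_integral_cong)
    fix x
    have "(\<integral>\<^sup>+y. a (T x - y) \<partial>lborel) = (\<integral>\<^sup>+y. indicator (ball (T x) 1) y \<partial>lborel)"
      by (intro nn_integral_cong) (auto simp: a_def A_def indicator_def dist_norm norm_minus_commute)
    also have "\<dots> = emeasure lborel A"
      by (simp add: emeasure_lborel_ball_translate[of "T x"] A_def)
    finally show "(\<integral>\<^sup>+y. a (T x - y) * (b (T x) :: ennreal) \<partial>lborel)
        = emeasure lborel A * b (T x)"
      by (subst nn_integral_multc) simp_all
  qed
  also have "\<dots> = emeasure lborel A * emeasure (distr lborel borel T) B"
  proof -
    have "emeasure (distr lborel borel T) B = (\<integral>\<^sup>+x. b x \<partial>distr lborel borel T)"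
      by (simp add: b_def)
    also have "\<dots> = (\<integral>\<^sup>+x. b (T x) \<partial>lborel)"
      by (rule nn_integral_distr) auto
    finally show ?thesis by (subst nn_integral_cmult) auto
  qed
  finally have "emeasure lborel A * emeasure (distr lborel borel T) B = emeasure lborel A * emeasure lborel B"
    by (simp add: mult.commute)
  then show "emeasure (distr lborel borel T) B = emeasure lborel B"
    using vol by (simp add: ennreal_mult_cancel_left)
qed simp

section \<open>Holomorphic functions on the ball\<close>

lemma norm_vector_scalar_mult:
  fixes v :: "complex ^ 'n"
  shows "norm (c *s v) = norm c * norm v"
  by (simp add: norm_vec_def norm_mult L2_set_right_distrib)

lemma norm_axis_complex: "norm (axis j c :: complex ^ 'n) = norm c"
  by (simp add: norm_vec_def L2_set_def axis_def if_distrib[of norm] if_distrib[of "\<lambda>x. x ^ 2"] sum.delta cong: if_cong)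

lemma bounded_linear_vector_scalar_mult_left: "bounded_linear (\<lambda>c. c *s (v :: complex ^ 'n))"
  unfolding linear_conv_bounded_linear[symmetric]
  by (rule linearI) (simp_all add: vec_eq_iff algebra_simps)

lemma has_derivative_vector_scalar_mult_left:
  "((\<lambda>c. z + c *s (v :: complex ^ 'n)) has_derivative (\<lambda>h. h *s v)) (at c0)"
  using has_derivative_add[OF has_derivative_const
      bounded_linear.has_derivative[OF bounded_linear_vector_scalar_mult_left has_derivative_ident]]
  by simp

lemma continuous_on_vector_scalar_mult_left [continuous_intros]:
  "continuous_on S f \<Longrightarrow> continuous_on S (\<lambda>x. f x *s (v :: complex ^ 'n))"
  by (rule bounded_linear.continuous_on[OF bounded_linear_vector_scalar_mult_left])

lemma has_field_derivative_along_complex_line: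
  fixes f :: "complex ^ 'n \<Rightarrow> complex"
  assumes "(f has_derivative D) (at (z + c0 *s v))" and "\<And>c v. D (c *s v) = c * D v"
  shows "((\<lambda>c. f (z + c *s v)) has_field_derivative D v) (at c0)"
  using has_derivative_compose[OF has_derivative_vector_scalar_mult_left assms(1)] assms(2)
  by (simp add: has_field_derivative_def mult_commute_abs)

text \<open>
  Identifies the partial derivatives, defined through one-variable derivatives, with the values
  of any complex-linear Frechet derivative on the coordinate axes.
\<close>

lemma partial_deriv_eq:
  fixes f :: "complex ^ 'n \<Rightarrow> complex"
  assumes "(f has_derivative D) (at z)" and "\<And>c v. D (c *s v) = c * D v"
  shows "partial_deriv j f z = D (axis j 1)"
proof -
  have eq: "(\<chi> i. if i = j then w else z $ i) = (z - (z $ j) *s axis j 1) + w *s axis j 1" for w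
    by (simp add: vec_eq_iff axis_def)
  have "((\<lambda>w. f ((z - (z $ j) *s axis j 1) + w *s axis j 1)) has_field_derivative D (axis j 1)) (at (z $ j))"
    by (rule has_field_derivative_along_complex_line) (use assms in auto)
  then show ?thesis
    unfolding partial_deriv_def eq by (rule DERIV_imp_deriv)
qed

lemma holomorphic_ball_has_derivative:
  fixes f :: "complex ^ 'n \<Rightarrow> complex"
  assumes "holomorphic_ball f" "z \<in> ball 0 1"
  shows "(f has_derivative (\<lambda>v. \<Sum>j\<in>UNIV. v $ j * partial_deriv j f z)) (at z)"
proof -
  obtain D where D: "(f has_derivative D) (at z)" "\<And>c v. D (c *s v) = c * D v"
    using assms unfolding holomorphic_ball_def by blast
  have "D v = (\<Sum>j\<in>UNIV. v $ j * partial_deriv j f z)" for v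
  proof -
    have "D v = D (\<Sum>j\<in>UNIV. v $ j *s axis j 1)"
      by (simp only: basis_expansion)
    also have "\<dots> = (\<Sum>j\<in>UNIV. D (v $ j *s axis j 1))"
      by (rule linear_sum) (rule has_derivative_linear[OF D(1)])
    also have "\<dots> = (\<Sum>j\<in>UNIV. v $ j * partial_deriv j f z)"
      by (simp add: D(2) partial_deriv_eq[OF D])
    finally show ?thesis .
  qed
  then have "D = (\<lambda>v. \<Sum>j\<in>UNIV. v $ j * partial_deriv j f z)" by blast
  with D show ?thesis by simp
qed

lemma gradient_form_complex_linear:
  "(\<Sum>j\<in>UNIV. (c *s v) $ j * a j) = c * (\<Sum>j\<in>UNIV. v $ j * (a j :: complex))"
  by (simp add: sum_distrib_left mult.assoc)

lemma gradient_form_axis: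
  "(\<Sum>j\<in>UNIV. axis k c $ j * a j) = c * (a k :: complex)"
  by (simp add: axis_def if_distrib[of "\<lambda>x. x * _"] sum.delta cong: if_cong)

lemma holomorphic_ball_continuous_on:
  assumes "holomorphic_ball f"
  shows "continuous_on (ball 0 1) f"
  using holomorphic_ball_has_derivative[OF assms]
  by (intro continuous_at_imp_continuous_on ballI) (rule has_derivative_continuous)

lemma holomorphic_ballI:
  assumes "\<And>z. z \<in> ball 0 1 \<Longrightarrow> (f has_derivative D z) (at z)"
    and "\<And>z c v. z \<in> ball 0 1 \<Longrightarrow> D z (c *s v) = c * D z v"
  shows "holomorphic_ball f"
  unfolding holomorphic_ball_def using assms by blast

lemma holomorphic_ball_const [simp]: "holomorphic_ball (\<lambda>_. c)"
  by (rule holomorphic_ballI[where D="\<lambda>_ _. 0"]) auto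

lemma has_derivative_vec_component: "((\<lambda>z. (z :: complex ^ 'n) $ j) has_derivative (\<lambda>v. v $ j)) F"
  by (rule bounded_linear.has_derivative[OF bounded_linear_vec_nth has_derivative_ident])

lemma holomorphic_ball_component [simp]: "holomorphic_ball (\<lambda>z. z $ j)"
  by (rule holomorphic_ballI[where D="\<lambda>_ v. v $ j"]) (auto intro: has_derivative_vec_component)

lemma partial_deriv_component: "partial_deriv j (\<lambda>z. z $ k) z = (if j = k then 1 else 0)"
  by (subst partial_deriv_eq[where D="\<lambda>v. v $ k"]) (auto intro: has_derivative_vec_component simp: axis_def)

lemma has_derivative_mult_gradient_form:
  assumes "holomorphic_ball f" "holomorphic_ball g" "z \<in> ball 0 1"
  shows "((\<lambda>z. f z * g z) has_derivative
    (\<lambda>v. \<Sum>j\<in>UNIV. v $ j * (f z * partial_deriv j g z + partial_deriv j f z * g z))) (at z)"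
  using has_derivative_mult[OF holomorphic_ball_has_derivative[OF assms(1,3)] holomorphic_ball_has_derivative[OF assms(2,3)]]
  by (simp add: sum_distrib_left sum_distrib_right sum.distrib algebra_simps)

lemma holomorphic_ball_mult:
  assumes "holomorphic_ball f" "holomorphic_ball g"
  shows "holomorphic_ball (\<lambda>z. f z * g z)"
  by (rule holomorphic_ballI, rule has_derivative_mult_gradient_form[OF assms]) (auto simp only: gradient_form_complex_linear)

lemma partial_deriv_mult:
  assumes "holomorphic_ball f" "holomorphic_ball g" "z \<in> ball 0 1"
  shows "partial_deriv j (\<lambda>z. f z * g z) z = f z * partial_deriv j g z + partial_deriv j f z * g z"
  by (subst partial_deriv_eq[OF has_derivative_mult_gradient_form[OF assms]])
    (simp_all only: gradient_form_complex_linear gradient_form_axis mult_1)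

lemma has_derivative_sum_gradient_form:
  assumes "\<And>i. i \<in> I \<Longrightarrow> holomorphic_ball (f i)" "z \<in> ball 0 1"
  shows "((\<lambda>z. \<Sum>i\<in>I. f i z) has_derivative
    (\<lambda>v. \<Sum>j\<in>UNIV. v $ j * (\<Sum>i\<in>I. partial_deriv j (f i) z))) (at z)"
proof -
  have "((\<lambda>z. \<Sum>i\<in>I. f i z) has_derivative
      (\<lambda>v. \<Sum>i\<in>I. \<Sum>j\<in>UNIV. v $ j * partial_deriv j (f i) z)) (at z)"
    by (intro has_derivative_sum holomorphic_ball_has_derivative assms)
  then show ?thesis
    by (subst (asm) sum.swap) (simp add: sum_distrib_left)
qed

lemma holomorphic_ball_sum:
  assumes "\<And>i. i \<in> I \<Longrightarrow> holomorphic_ball (f i)"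
  shows "holomorphic_ball (\<lambda>z. \<Sum>i\<in>I. f i z)"
  by (rule holomorphic_ballI, rule has_derivative_sum_gradient_form[OF assms]) (auto simp only: gradient_form_complex_linear)

lemma partial_deriv_sum:
  assumes "\<And>i. i \<in> I \<Longrightarrow> holomorphic_ball (f i)" "z \<in> ball 0 1"
  shows "partial_deriv j (\<lambda>z. \<Sum>i\<in>I. f i z) z = (\<Sum>i\<in>I. partial_deriv j (f i) z)"
  by (subst partial_deriv_eq[OF has_derivative_sum_gradient_form[OF assms]])
    (simp_all only: gradient_form_complex_linear gradient_form_axis mult_1)

lemma radial_deriv_mult:
  assumes "holomorphic_ball f" "holomorphic_ball g" "z \<in> ball 0 1"
  shows "radial_deriv (\<lambda>z. f z * g z) z = f z * radial_deriv g z + radial_deriv f z * g z"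
  unfolding radial_deriv_def
  by (simp add: partial_deriv_mult[OF assms] sum.distrib sum_distrib_left sum_distrib_right algebra_simps)

section \<open>Cauchy integrals over circles in complex lines\<close>

text \<open>
  The circle is parametrised over the unit interval, so that Cauchy's formulas become averages
  without factors of \<open>2\<pi>\<i>\<close>.
\<close>

definition unit_circle :: "real \<Rightarrow> complex" where
  "unit_circle t = exp (2 * of_real pi * \<i> * of_real t)"

lemma norm_unit_circle [simp]: "norm (unit_circle t) = 1"
  by (simp add: unit_circle_def)

lemma unit_circle_nonzero [simp]: "unit_circle t \<noteq> 0"
  by (simp add: unit_circle_def)

lemma continuous_on_unit_circle [continuous_intros]:
  "continuous_on S g \<Longrightarrow> continuous_on S (\<lambda>x. unit_circle (g x))"
  unfolding unit_circle_def by (intro continuous_intros)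

lemma cauchy_circle_integrals:
  assumes "F holomorphic_on cball 0 1"
  shows "((\<lambda>t. F (unit_circle t)) has_integral F 0) {0..1}"
    and "((\<lambda>t. F (unit_circle t) / unit_circle t) has_integral deriv F 0) {0..1}"
proof -
  have cont: "continuous_on (cball 0 1) F" and hol: "F holomorphic_on ball 0 1"
    using assms by (auto intro: holomorphic_on_imp_continuous_on holomorphic_on_subset)
  have *: "((\<lambda>t. F (unit_circle t) / unit_circle t ^ k) has_integral (deriv ^^ k) F 0 / fact k) {0..1}" for k
  proof -
    have "((\<lambda>u. F u / (u - 0) ^ Suc k) has_contour_integral (2 * pi * \<i>) / fact k * (deriv ^^ k) F 0) (circlepath 0 1)"
      by (rule Cauchy_has_contour_integral_higher_derivative_circlepath[OF cont hol]) auto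
    then have "((\<lambda>t. F (unit_circle t) / unit_circle t ^ Suc k * (2 * pi * \<i> * unit_circle t)) has_integral
        (2 * pi * \<i>) / fact k * (deriv ^^ k) F 0) {0..1}"
      unfolding has_contour_integral_def
    proof (rule has_integral_eq[rotated])
      fix t :: real assume t: "t \<in> {0..1}"
      have "circlepath 0 1 t = unit_circle t" by (simp add: circlepath unit_circle_def)
      with t show "F (circlepath 0 1 t) / (circlepath 0 1 t - 0) ^ Suc k *
            vector_derivative (circlepath 0 1) (at t within {0..1}) =
          F (unit_circle t) / unit_circle t ^ Suc k * (2 * pi * \<i> * unit_circle t)"
        by (simp add: vector_derivative_circlepath01 unit_circle_def)
    qed
    from has_integral_mult_right[OF this, of "1 / (2 * pi * \<i>)"]
    show ?thesis by (simp add: field_simps)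
  qed
  show "((\<lambda>t. F (unit_circle t)) has_integral F 0) {0..1}" using *[of 0] by simp
  show "((\<lambda>t. F (unit_circle t) / unit_circle t) has_integral deriv F 0) {0..1}" using *[of 1] by simp
qed

lemma norm_disc_translate:
  fixes z v :: "complex ^ 'n"
  assumes "norm z + norm v < 1" "norm c \<le> 1"
  shows "norm (z + c *s v) < 1"
proof -
  have "norm (z + c *s v) \<le> norm z + norm c * norm v"
    by (metis norm_triangle_ineq norm_vector_scalar_mult)
  also have "\<dots> \<le> norm z + norm v"
    using assms(2) by (simp add: mult_left_le_one_le)
  finally show ?thesis using assms(1) by simp
qed

text \<open>
  Cauchy's formulas on the disc \<open>c \<mapsto> z + c v\<close> in a complex line.  Letting the radius be absorbed in
  \<open>v\<close> makes it possible to average over \<open>v\<close> later.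
\<close>

lemma holomorphic_ball_circle_integrals:
  assumes f: "holomorphic_ball f" and zv: "norm z + norm v < 1"
  shows "((\<lambda>t. f (z + unit_circle t *s v)) has_integral f z) {0..1}"
    and "((\<lambda>t. f (z + unit_circle t *s v) / unit_circle t) has_integral (\<Sum>j\<in>UNIV. v $ j * partial_deriv j f z)) {0..1}"
proof -
  define F where "F = (\<lambda>c. f (z + c *s v))"
  have der: "(F has_field_derivative (\<Sum>j\<in>UNIV. v $ j * partial_deriv j f (z + c *s v))) (at c)"
    if "norm c \<le> 1" for c
    unfolding F_def using that norm_disc_translate[OF zv that]
    by (intro has_field_derivative_along_complex_line holomorphic_ball_has_derivative f)
      (auto simp: gradient_form_complex_linear simp del: vector_smult_component)
  then have "F holomorphic_on cball 0 1"
    by (intro holomorphic_onI) (auto simp: field_differentiable_def intro: DERIV_subset)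
  note * = cauchy_circle_integrals[OF this]
  have "deriv F 0 = (\<Sum>j\<in>UNIV. v $ j * partial_deriv j f z)"
    using DERIV_imp_deriv[OF der[of 0]] by simp
  with * show "((\<lambda>t. f (z + unit_circle t *s v)) has_integral f z) {0..1}"
    and "((\<lambda>t. f (z + unit_circle t *s v) / unit_circle t) has_integral (\<Sum>j\<in>UNIV. v $ j * partial_deriv j f z)) {0..1}"
    by (auto simp: F_def)
qed

lemma partial_deriv_circle_integral:
  assumes f: "holomorphic_ball f" and "r > 0" "norm z < 1 - r"
  shows "partial_deriv j f z = integral {0..1} (\<lambda>t. f (z + unit_circle t *s axis j (of_real r)) / unit_circle t) / of_real r"
proof -
  have "((\<lambda>t. f (z + unit_circle t *s axis j (of_real r)) / unit_circle t) has_integral of_real r * partial_deriv j f z) {0..1}"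
    using holomorphic_ball_circle_integrals(2)[OF f, of z "axis j (of_real r)"] assms
    by (simp add: gradient_form_axis norm_axis_complex)
  then show ?thesis using \<open>r > 0\<close> by (simp add: integral_unique)
qed

lemma continuous_on_circle_translate:
  assumes g: "continuous_on (ball 0 1) g" and "r > 0"
  shows "continuous_on (ball 0 (1 - r) \<times> {0..1})
     (\<lambda>(z, t). g (z + unit_circle t *s axis j (of_real r)) / unit_circle t :: complex)"
  unfolding split_beta
proof (intro continuous_intros continuous_on_compose2[OF g])
  show "(\<lambda>x. fst x + unit_circle (snd x) *s axis j (of_real r)) ` (ball 0 (1 - r) \<times> {0..1}) \<subseteq> ball 0 1"
    using \<open>r > 0\<close> norm_disc_translate[of _ "axis j (of_real r)"] by (fastforce simp: norm_axis_complex)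
qed auto

lemma ball_obtain_radius:
  assumes "z \<in> ball (0 :: complex ^ 'n) 1"
  obtains r where "r > 0" "z \<in> ball 0 (1 - r)"
  using assms by (intro that[of "(1 - norm z) / 2"]) (auto simp: field_simps)

text \<open>
  Holomorphy is defined by mere differentiability, so continuity of the derivative has to come from
  Cauchy's formula, whose right-hand side involves only values of \<open>f\<close>.
\<close>

lemma partial_deriv_continuous_on:
  assumes f: "holomorphic_ball f"
  shows "continuous_on (ball 0 1) (partial_deriv j f)"
proof (intro continuous_at_imp_continuous_on ballI)
  fix z :: "complex ^ 'a" assume "z \<in> ball 0 1"
  then obtain r where r: "r > 0" "z \<in> ball 0 (1 - r)" by (rule ball_obtain_radius)
  have "continuous_on (ball 0 (1 - r))
     (\<lambda>z. integral (cbox 0 1) (\<lambda>t. f (z + unit_circle t *s axis j (of_real r)) / unit_circle t) / of_real r)"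
    using continuous_on_circle_translate[OF holomorphic_ball_continuous_on[OF f] r(1)] \<open>r > 0\<close>
    by (intro continuous_intros integral_continuous_on_param) auto
  then have "continuous_on (ball 0 (1 - r)) (partial_deriv j f)"
    by (rule continuous_on_eq) (use partial_deriv_circle_integral[OF f r(1)] in auto)
  then show "isCont (partial_deriv j f) z"
    using r(2) by (auto simp: continuous_on_eq_continuous_at)
qed

text \<open>
  Now that the gradient is known to be continuous, Cauchy's formula for \<open>\<partial>\<^sub>j f\<close> may be differentiated
  under the integral sign.
\<close>

lemma partial_deriv_has_derivative:
  fixes f :: "complex ^ 'n \<Rightarrow> complex"
  assumes f: "holomorphic_ball f" and "r > 0" "norm z < 1 - r"
  shows "(partial_deriv j f has_derivative
     (\<lambda>v. \<Sum>k\<in>UNIV. v $ k * (integral {0..1} (\<lambda>t. partial_deriv k f (z + unit_circle t *s axis j (of_real r)) / unit_circle t) / of_real r))) (at z)"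
proof -
  define w where "w x t = x + unit_circle t *s axis j (of_real r)" for x t
  define U where "U = ball (0 :: complex ^ 'n) (1 - r)"
  have w: "w x t \<in> ball 0 1" if "x \<in> U" for x t
    using that \<open>r > 0\<close> norm_disc_translate[of x "axis j (of_real r)"] by (auto simp: w_def U_def norm_axis_complex)
  define L where "L x t v = (\<Sum>k\<in>UNIV. v $ k * partial_deriv k f (w x t)) / unit_circle t" for x t v
  have bl: "bounded_linear (L x t)" for x t
    unfolding L_def linear_conv_bounded_linear[symmetric]
    by (rule linearI) (simp_all add: algebra_simps sum.distrib scaleR_sum_right[symmetric] divide_inverse)
  define fx where "fx x t = Blinfun (L x t)" for x t
  have fx: "blinfun_apply (fx x t) = L x t" for x t
    unfolding fx_def by (rule bounded_linear_Blinfun_apply[OF bl])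
  have contk: "continuous_on (U \<times> {0..1}) (\<lambda>(x, t). partial_deriv k f (w x t) / unit_circle t)" for k
    unfolding w_def U_def
    by (rule continuous_on_circle_translate[OF partial_deriv_continuous_on[OF f] \<open>r > 0\<close>])
  have L_alt: "L x t v = (\<Sum>k\<in>UNIV. v $ k * (partial_deriv k f (w x t) / unit_circle t))" for x t v
    by (simp add: L_def sum_divide_distrib)
  have cont: "continuous_on (U \<times> cbox 0 1) (\<lambda>(x, t). fx x t)"
    unfolding split_beta
    by (rule continuous_on_blinfun_componentwise, unfold fx L_alt,
        intro continuous_on_sum continuous_on_mult continuous_on_const)
      (use contk in \<open>simp add: split_beta\<close>)
  have zU: "z \<in> U" using assms by (simp add: U_def)
  have int: "(\<lambda>t. g (w x t) / unit_circle t) integrable_on {0..1}"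
    if "x \<in> U" "continuous_on (ball 0 1) g" for x and g :: "complex ^ 'n \<Rightarrow> complex"
  proof -
    have "continuous_on {0..1} (\<lambda>t. (\<lambda>(z, t). g (z + unit_circle t *s axis j (of_real r)) / unit_circle t) (x, t))"
      by (rule continuous_on_compose2[OF continuous_on_circle_translate[OF that(2) \<open>r > 0\<close>]])
        (use that(1) in \<open>auto simp: U_def intro!: continuous_intros\<close>)
    then have "continuous_on {0..1} (\<lambda>t. g (w x t) / unit_circle t)"
      by (simp add: w_def)
    then show ?thesis by (rule integrable_continuous_interval)
  qed
  have "((\<lambda>x. integral (cbox 0 1) (\<lambda>t. f (w x t) / unit_circle t)) has_derivative
      integral (cbox 0 1) (fx z)) (at z within U)"
  proof (rule leibniz_rule[OF _ _ cont zU])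
    fix x t assume x: "x \<in> U"
    have shift: "((\<lambda>x. w x t) has_derivative (\<lambda>v. v)) (at x within U)"
      unfolding w_def by (intro derivative_eq_intros | simp)+
    have "((\<lambda>x. f (w x t)) has_derivative (\<lambda>v. \<Sum>k\<in>UNIV. v $ k * partial_deriv k f (w x t))) (at x within U)"
      by (rule has_derivative_compose[OF shift holomorphic_ball_has_derivative[OF f w[OF x]]])
    then show "((\<lambda>x. f (w x t) / unit_circle t) has_derivative blinfun_apply (fx x t)) (at x within U)"
      unfolding fx L_def by (rule bounded_linear.has_derivative[OF bounded_linear_divide])
  qed (use int holomorphic_ball_continuous_on[OF f] in \<open>auto simp: U_def\<close>)
  then have der: "((\<lambda>x. integral {0..1} (\<lambda>t. f (w x t) / unit_circle t) / of_real r) has_derivative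
      (\<lambda>v. integral {0..1} (fx z) v / of_real r)) (at z)"
    using bounded_linear.has_derivative[OF bounded_linear_divide, of _ _ "at z"] zU at_within_open[of z U] by (simp add: U_def)
  have val: "blinfun_apply (integral {0..1} (fx z)) v / of_real r =
      (\<Sum>k\<in>UNIV. v $ k * (integral {0..1} (\<lambda>t. partial_deriv k f (w z t) / unit_circle t) / of_real r))" for v
  proof -
    have "continuous_on {0..1} (\<lambda>t. (\<lambda>(x, t). fx x t) (z, t))"
      by (rule continuous_on_compose2[OF cont]) (use zU in \<open>auto intro!: continuous_intros\<close>)
    then have "fx z integrable_on {0..1}"
      by (intro integrable_continuous_interval) simp
    then have "blinfun_apply (integral {0..1} (fx z)) v = integral {0..1} (\<lambda>t. L z t v)"
      by (subst blinfun_apply_integral) (auto simp: fx)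
    also have "\<dots> = (\<Sum>k\<in>UNIV. v $ k * integral {0..1} (\<lambda>t. partial_deriv k f (w z t) / unit_circle t))"
      unfolding L_alt using int[OF zU partial_deriv_continuous_on[OF f]]
      by (subst integral_sum) (simp_all only: integrable_on_mult_right finite integral_mult_right)
    finally show ?thesis by (simp add: sum_divide_distrib)
  qed
  have "(partial_deriv j f has_derivative (\<lambda>v. integral {0..1} (fx z) v / of_real r)) (at z)"
    by (rule has_derivative_transform_within_open[OF der, of U])
      (use zU partial_deriv_circle_integral[OF f \<open>r > 0\<close>] in \<open>auto simp: U_def w_def\<close>)
  then show ?thesis unfolding val w_def .
qed

lemma holomorphic_ball_partial_deriv:
  assumes f: "holomorphic_ball f"
  shows "holomorphic_ball (partial_deriv j f)"
  unfolding holomorphic_ball_def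
proof
  fix z :: "complex ^ 'a" assume "z \<in> ball 0 1"
  then obtain r where r: "r > 0" "z \<in> ball 0 (1 - r)" by (rule ball_obtain_radius)
  show "\<exists>D. (partial_deriv j f has_derivative D) (at z) \<and> (\<forall>c v. D (c *s v) = c * D v)"
    using partial_deriv_has_derivative[OF f r(1), of z j] r(2) gradient_form_complex_linear by fastforce
qed

text \<open>
  Both sides are the Cauchy integral of \<open>\<partial>\<^sub>k f\<close> in direction \<open>j\<close>: the left one by differentiation under
  the integral sign, the right one by Cauchy's formula for the holomorphic function \<open>\<partial>\<^sub>k f\<close>.
\<close>

lemma partial_deriv_commute:
  assumes f: "holomorphic_ball f" and "z \<in> ball 0 1"
  shows "partial_deriv k (partial_deriv j f) z = partial_deriv j (partial_deriv k f) z"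
proof -
  obtain r where r: "r > 0" "norm z < 1 - r" using ball_obtain_radius[OF assms(2)] by auto
  show ?thesis
    by (subst partial_deriv_eq[OF partial_deriv_has_derivative[OF f r]])
      (simp_all only: gradient_form_complex_linear gradient_form_axis mult_1
        partial_deriv_circle_integral[OF holomorphic_ball_partial_deriv[OF f] r])
qed

lemma holomorphic_ball_radial_deriv:
  assumes "holomorphic_ball f"
  shows "holomorphic_ball (radial_deriv f)"
  unfolding radial_deriv_def[abs_def]
  by (intro holomorphic_ball_sum holomorphic_ball_mult holomorphic_ball_partial_deriv assms) simp

lemma partial_deriv_radial_deriv:
  assumes f: "holomorphic_ball f" and z: "z \<in> ball 0 1"
  shows "partial_deriv j (radial_deriv f) z = partial_deriv j f z + (\<Sum>k\<in>UNIV. z $ k * partial_deriv k (partial_deriv j f) z)"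
proof -
  have "partial_deriv j (radial_deriv f) z = (\<Sum>k\<in>UNIV. partial_deriv j (\<lambda>z. z $ k * partial_deriv k f z) z)"
    unfolding radial_deriv_def[abs_def]
    by (intro partial_deriv_sum holomorphic_ball_mult holomorphic_ball_partial_deriv f z) simp
  also have "\<dots> = (\<Sum>k\<in>UNIV. z $ k * partial_deriv k (partial_deriv j f) z + (if j = k then 1 else 0) * partial_deriv k f z)"
    by (intro sum.cong refl) (simp add: partial_deriv_mult[OF _ holomorphic_ball_partial_deriv[OF f] z] partial_deriv_component partial_deriv_commute[OF f z, of j])
  also have "\<dots> = partial_deriv j f z + (\<Sum>k\<in>UNIV. z $ k * partial_deriv k (partial_deriv j f) z)"
    by (simp add: sum.distrib if_distrib[of "\<lambda>x. x * _"] sum.delta cong: if_cong)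
  finally show ?thesis .
qed

section \<open>Mean value inequalities\<close>

text \<open>
  Convexity of \<open>x^p\<close>: the left-hand side is its tangent at \<open>m\<close>.
\<close>

lemma powr_tangent_bound:
  fixes x m p :: real
  assumes "p > 1" "x \<ge> 0" "m \<ge> 0"
  shows "p * x * m powr (p - 1) - (p - 1) * m powr p \<le> x powr p"
proof -
  have "x * m powr (p - 1) \<le> x powr p / p + (m powr (p - 1)) powr (p / (p - 1)) / (p / (p - 1))"
    by (rule Youngs_inequality) (use assms in \<open>auto simp: field_simps\<close>)
  also have "(m powr (p - 1)) powr (p / (p - 1)) = m powr p"
    using assms by (simp add: powr_powr)
  finally have "p * (x * m powr (p - 1)) \<le> p * (x powr p / p + m powr p / (p / (p - 1)))"
    using assms by (intro mult_left_mono) auto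
  also have "\<dots> = x powr p + (p - 1) * m powr p"
    using assms by (simp add: field_simps)
  finally show ?thesis by (simp add: algebra_simps)
qed

text \<open>
  Hoelder's inequality for \<open>G = (G / k) k\<close>, as a Jensen inequality for the measure \<open>k dt\<close>: the
  tangent bound at the mean \<open>m\<close> of \<open>G / k\<close> is integrated.  An upper bound \<open>K\<close> for the total mass suffices.
\<close>

lemma weighted_hoelder:
  fixes G k :: "real \<Rightarrow> real"
  assumes p: "p > 1" and G: "continuous_on {a..b} G" "\<And>t. t \<in> {a..b} \<Longrightarrow> G t \<ge> 0"
    and k: "continuous_on {a..b} k" "\<And>t. t \<in> {a..b} \<Longrightarrow> k t > 0"
    and K: "K > 0" "integral {a..b} k \<le> K"
  shows "integral {a..b} G powr p \<le> K powr (p - 1) * integral {a..b} (\<lambda>t. G t powr p * k t powr (1 - p))"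
proof -
  have k': "k t \<ge> 0" "k t \<noteq> 0" if "t \<in> {a..b}" for t
    using k(2)[OF that] by auto
  define M where "M = integral {a..b} G"
  define m where "m = M / K"
  have M: "M \<ge> 0" unfolding M_def by (intro integral_nonneg integrable_continuous_interval G)
  have m: "m \<ge> 0" using M K by (simp add: m_def)
  define I where "I = integral {a..b} (\<lambda>t. G t powr p * k t powr (1 - p))"
  have cont: "continuous_on {a..b} (\<lambda>t. G t powr p * k t powr (1 - p))"
    by (intro continuous_on_mult continuous_on_powr' continuous_on_const G(1) k(1))
      (use G(2) k' p in auto)
  have pt: "p * m powr (p - 1) * G t - (p - 1) * m powr p * k t \<le> G t powr p * k t powr (1 - p)"
    if "t \<in> {a..b}" for t
  proof -
    have "(p * (G t / k t) * m powr (p - 1) - (p - 1) * m powr p) * k t \<le> (G t / k t) powr p * k t"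
      using G(2)[OF that] k'[OF that] p m by (intro mult_right_mono powr_tangent_bound) auto
    also have "(G t / k t) powr p * k t = G t powr p * k t powr (1 - p)"
      using G(2)[OF that] k'[OF that] p by (simp add: powr_divide powr_diff)
    also have "(p * (G t / k t) * m powr (p - 1) - (p - 1) * m powr p) * k t
        = p * m powr (p - 1) * G t - (p - 1) * m powr p * k t"
      using k'[OF that] by (simp add: left_diff_distrib)
    finally show ?thesis .
  qed
  have "integral {a..b} (\<lambda>t. p * m powr (p - 1) * G t - (p - 1) * m powr p * k t) \<le> I"
    unfolding I_def
    by (intro integral_le integrable_continuous_interval cont pt continuous_intros G k)
  also have "integral {a..b} (\<lambda>t. p * m powr (p - 1) * G t - (p - 1) * m powr p * k t)
      = p * m powr (p - 1) * M - (p - 1) * m powr p * integral {a..b} k"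
    unfolding M_def
    by (subst integral_diff)
      (simp_all only: integrable_on_mult_right integrable_continuous_interval G k integral_mult_right)
  finally have "p * m powr (p - 1) * M - (p - 1) * m powr p * integral {a..b} k \<le> I" .
  moreover have "(p - 1) * m powr p * integral {a..b} k \<le> (p - 1) * m powr p * K"
    using p K by (intro mult_left_mono) auto
  moreover have mK: "m powr p * K = m powr (p - 1) * M"
  proof (cases "m = 0")
    case False
    then have "m powr p = m powr (p - 1) * m" using m by (simp add: powr_diff)
    then show ?thesis using K by (simp add: m_def)
  qed simp
  moreover have "(p - 1) * m powr p * K = (p - 1) * (m powr (p - 1) * M)"
    by (simp only: mult.assoc mK)
  moreover have "p * m powr (p - 1) * M = (p - 1) * (m powr (p - 1) * M) + m powr (p - 1) * M"
    by (simp add: algebra_simps)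
  ultimately have "m powr (p - 1) * M \<le> I" by linarith
  then have "K powr (p - 1) * (m powr (p - 1) * M) \<le> K powr (p - 1) * I"
    by (intro mult_left_mono) auto
  also have "K powr (p - 1) * (m powr (p - 1) * M) = M powr p"
  proof (cases "M = 0")
    case False
    then show ?thesis using M K by (simp add: m_def powr_divide powr_diff)
  qed (use p in simp)
  finally show ?thesis by (simp add: M_def I_def)
qed

text \<open>
  Hoelder's inequality with the constant kernel on an interval of length 1, for the values \<open>F\<close> of a function
  on a circle with mean \<open>I\<close>.
\<close>

lemma norm_integral_powr_le:
  fixes F :: "real \<Rightarrow> complex"
  assumes p: "p > 1" and F: "continuous_on {0..1} F" "(F has_integral I) {0..1}"
  shows "ennreal (norm I powr p) \<le> (\<integral>\<^sup>+t. ennreal (norm (F t) powr p) * indicator {0..1} t \<partial>lborel)"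
proof -
  have "norm I \<le> integral {0..1} (\<lambda>t. norm (F t))"
    using F integral_norm_bound_integral[of F "{0..1}" "\<lambda>t. norm (F t)"]
    by (auto simp: integral_unique intro!: integrable_continuous_interval continuous_intros)
  then have "norm I powr p \<le> integral {0..1} (\<lambda>t. norm (F t)) powr p"
    using p by (intro powr_mono2) auto
  also have "\<dots> \<le> integral {0..1} (\<lambda>t. norm (F t) powr p)"
    using weighted_hoelder[OF p, of 0 1 "\<lambda>t. norm (F t)" "\<lambda>_. 1" 1] F
    by (auto intro!: continuous_intros)
  finally have "ennreal (norm I powr p) \<le> ennreal (integral {0..1} (\<lambda>t. norm (F t) powr p))"
    by (rule ennreal_leI)
  also have "\<dots> = (\<integral>\<^sup>+t. ennreal (norm (F t) powr p) * indicator {0..1} t \<partial>lborel)"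
    using F p
    by (intro nn_integral_has_integral_lebesgue'[symmetric] integrable_integral integrable_continuous_interval
        continuous_on_powr' continuous_intros) auto
  finally show ?thesis .
qed

lemma borel_measurable_norm_powr_times_weight:
  fixes f :: "complex ^ 'n \<Rightarrow> 'b :: euclidean_space" and w :: "complex ^ 'n \<Rightarrow> real"
  assumes "continuous_on (ball 0 1) f" and [measurable]: "w \<in> borel_measurable borel"
  shows "(\<lambda>z. ennreal (norm (f z) powr p * w z) * indicator (ball 0 1) z) \<in> borel_measurable borel"
proof -
  define g where "g z = indicator (ball 0 1) z *\<^sub>R f z" for z
  have [measurable]: "g \<in> borel_measurable borel"
    unfolding g_def by (rule borel_measurable_continuous_on_indicator) (use assms in auto)
  have [measurable]: "ball (0 :: complex ^ 'n) 1 \<in> sets borel" by simp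
  have "(\<lambda>z. ennreal (norm (g z) powr p * w z) * indicator (ball 0 1) z) \<in> borel_measurable borel"
    by measurable
  moreover have "(\<lambda>z. ennreal (norm (g z) powr p * w z) * indicator (ball 0 1) z)
    = (\<lambda>z. ennreal (norm (f z) powr p * w z) * indicator (ball 0 1) z)"
    by (auto simp: fun_eq_iff indicator_def g_def)
  ultimately show ?thesis by simp
qed

lemma borel_measurable_norm_powr_ball:
  fixes f :: "complex ^ 'n \<Rightarrow> 'b :: euclidean_space"
  assumes "continuous_on (ball 0 1) f"
  shows "(\<lambda>z. ennreal (norm (f z) powr p * (1 - norm z) powr a) * indicator (ball 0 1) z) \<in> borel_measurable borel"
  by (rule borel_measurable_norm_powr_times_weight[OF assms]) measurable

lemma borel_measurable_norm_powr_sq_ball: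
  fixes f :: "complex ^ 'n \<Rightarrow> 'b :: euclidean_space"
  assumes "continuous_on (ball 0 1) f"
  shows "(\<lambda>z. ennreal (norm (f z) powr p * (1 - (norm z)\<^sup>2) powr a) * indicator (ball 0 1) z) \<in> borel_measurable borel"
  by (rule borel_measurable_norm_powr_times_weight[OF assms]) measurable

lemma orthogonal_transformation_unit_circle:
  "orthogonal_transformation (\<lambda>w :: complex ^ 'n. unit_circle t *s w)"
proof -
  have "linear (\<lambda>w :: complex ^ 'n. unit_circle t *s w)"
    by (rule linearI) (simp_all add: vec_eq_iff algebra_simps)
  then show ?thesis by (simp add: orthogonal_transformation norm_vector_scalar_mult)
qed

lemma nn_integral_lborel_unit_circle:
  fixes G :: "complex ^ 'n \<Rightarrow> ennreal"
  assumes [measurable]: "G \<in> borel_measurable borel"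
  shows "(\<integral>\<^sup>+w. G (unit_circle t *s w) \<partial>lborel) = (\<integral>\<^sup>+w. G w \<partial>lborel)"
proof -
  let ?T = "\<lambda>w :: complex ^ 'n. unit_circle t *s w"
  have "(\<integral>\<^sup>+w. G w \<partial>lborel) = (\<integral>\<^sup>+w. G w \<partial>distr lborel borel ?T)"
    by (simp add: distr_lborel_orthogonal_transformation orthogonal_transformation_unit_circle)
  also have "\<dots> = (\<integral>\<^sup>+w. G (?T w) \<partial>lborel)"
    using orthogonal_transformation_linear[OF orthogonal_transformation_unit_circle]
    by (intro nn_integral_distr) (auto intro!: borel_measurable_continuous_onI linear_continuous_on
        simp: linear_conv_bounded_linear)
  finally show ?thesis by simp
qed

lemma continuous_on_circle:
  fixes h :: "complex ^ 'n \<Rightarrow> complex"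
  assumes "holomorphic_ball h" "norm z + norm v < 1"
  shows "continuous_on {0..1} (\<lambda>t. h (z + unit_circle t *s v))"
  using norm_disc_translate[OF assms(2)]
  by (intro continuous_intros continuous_on_compose2[OF holomorphic_ball_continuous_on[OF assms(1)]]) auto

text \<open>
  For every \<open>w\<close> with \<open>\<bar>w\<bar> < r\<close>, the value \<open>\<bar>h(z)\<bar>^p\<close> is at most the average of \<open>\<bar>h\<bar>^p\<close> over the circle
  through \<open>z + w\<close> with centre \<open>z\<close> in the complex line of direction \<open>w\<close>.  Integrating over \<open>w\<close> and exchanging the order of
  integration leaves an average over rotations of the ball, each of which preserves Lebesgue measure.
\<close>

lemma submean_ball:
  fixes h :: "complex ^ 'n \<Rightarrow> complex"
  assumes h: "holomorphic_ball h" and p: "p > 1" and z: "norm z + r \<le> 1"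
  shows "ennreal (norm (h z) powr p) * emeasure lborel (ball (0 :: complex ^ 'n) r)
    \<le> (\<integral>\<^sup>+w. ennreal (norm (h w) powr p) * indicator (ball z r) w \<partial>lborel)"
proof -
  define H where "H w = ennreal (norm (h w) powr p * (1 - norm w) powr 0) * indicator (ball 0 1) w" for w
  have [measurable]: "H \<in> borel_measurable borel"
    unfolding H_def by (rule borel_measurable_norm_powr_ball[OF holomorphic_ball_continuous_on[OF h]])
  have [measurable]: "ball z r \<in> sets borel" "ball (0 :: complex ^ 'n) r \<in> sets borel" by simp_all
  define G where "G w = H (z + w) * indicator (ball 0 r) w" for w
  have [measurable]: "G \<in> borel_measurable borel"
    unfolding G_def by measurable
  have in_ball: "norm (z + w) < 1" if "norm w < r" for w
    using norm_triangle_ineq[of z w] that z by linarith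
  have Hw: "H (z + w) = ennreal (norm (h (z + w)) powr p)" if "norm w < r" for w
    using in_ball[OF that] by (simp add: H_def)
  \<comment> \<open>Joint measurability, needed for exchanging the order of integration.\<close>
  have rot: "(\<lambda>(w :: complex ^ 'n, t). unit_circle t *s w) \<in> borel_measurable (lborel \<Otimes>\<^sub>M lborel)"
  proof -
    have "continuous_on UNIV (\<lambda>x :: (complex ^ 'n) \<times> real. unit_circle (snd x) *s fst x)"
      unfolding vector_scalar_mult_def
      by (intro continuous_intros)
    then have "(\<lambda>x :: (complex ^ 'n) \<times> real. unit_circle (snd x) *s fst x) \<in> borel_measurable borel"
      by (rule borel_measurable_continuous_onI)
    then show ?thesis by (simp add: lborel_prod split_beta)
  qed
  have GT [measurable]: "(\<lambda>(w, t). G (unit_circle t *s w)) \<in> borel_measurable (lborel \<Otimes>\<^sub>M lborel)"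
    using measurable_compose[OF rot, of G borel] by (simp add: split_beta)
  have "ennreal (norm (h z) powr p) * emeasure lborel (ball (0 :: complex ^ 'n) r)
      = (\<integral>\<^sup>+w. ennreal (norm (h z) powr p) * indicator (ball (0 :: complex ^ 'n) r) w \<partial>lborel)"
    by (subst nn_integral_cmult) auto
  also have "\<dots> \<le> (\<integral>\<^sup>+w. (\<integral>\<^sup>+t. G (unit_circle t *s w) * indicator {0..1} t \<partial>lborel) \<partial>lborel)"
  proof (rule nn_integral_mono)
    fix w :: "complex ^ 'n"
    show "ennreal (norm (h z) powr p) * indicator (ball 0 r) w \<le> (\<integral>\<^sup>+t. G (unit_circle t *s w) * indicator {0..1} t \<partial>lborel)"
    proof (cases "norm w < r")
      case True
      have zw: "norm z + norm w < 1" using True z by linarith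
      have "ennreal (norm (h z) powr p) \<le> (\<integral>\<^sup>+t. ennreal (norm (h (z + unit_circle t *s w)) powr p) * indicator {0..1} t \<partial>lborel)"
        by (rule norm_integral_powr_le[OF p continuous_on_circle[OF h zw] holomorphic_ball_circle_integrals(1)[OF h zw]])
      also have "\<dots> = (\<integral>\<^sup>+t. G (unit_circle t *s w) * indicator {0..1} t \<partial>lborel)"
        using True by (intro nn_integral_cong) (simp add: G_def Hw norm_vector_scalar_mult)
      finally show ?thesis using True by simp
    qed simp
  qed
  also have "\<dots> = (\<integral>\<^sup>+t. (\<integral>\<^sup>+w. G (unit_circle t *s w) * indicator {0..1} t \<partial>lborel) \<partial>lborel)"
    by (rule lborel_pair.Fubini'[symmetric]) (use GT in \<open>simp add: split_beta\<close>)
  also have "\<dots> = (\<integral>\<^sup>+t. (\<integral>\<^sup>+w. G w \<partial>lborel) * indicator {0..1 :: real} t \<partial>lborel)"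
  proof (rule nn_integral_cong)
    fix t :: real
    have [measurable]: "(\<lambda>w. G (unit_circle t *s w)) \<in> borel_measurable lborel"
      using orthogonal_transformation_linear[OF orthogonal_transformation_unit_circle]
      by (intro measurable_compose[where f="\<lambda>w. unit_circle t *s w" and g=G and N=borel])
        (auto intro!: borel_measurable_continuous_onI linear_continuous_on simp: linear_conv_bounded_linear)
    show "(\<integral>\<^sup>+w. G (unit_circle t *s w) * indicator {0..1} t \<partial>lborel) = (\<integral>\<^sup>+w. G w \<partial>lborel) * indicator {0..1 :: real} t"
      by (subst nn_integral_multc) (simp_all add: nn_integral_lborel_unit_circle)
  qed
  also have "\<dots> = (\<integral>\<^sup>+w. G w \<partial>lborel)"
    by (subst nn_integral_cmult) auto
  also have "\<dots> = (\<integral>\<^sup>+w. ennreal (norm (h (z + w)) powr p) * indicator (ball z r) (z + w) \<partial>lborel)"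
    by (intro nn_integral_cong) (auto simp: G_def Hw indicator_def dist_norm)
  also have "\<dots> = (\<integral>\<^sup>+w. H (z + w) * indicator (ball z r) (z + w) \<partial>lborel)"
    by (intro nn_integral_cong) (auto simp: Hw indicator_def dist_norm)
  also have "\<dots> = (\<integral>\<^sup>+w. H w * indicator (ball z r) w \<partial>lborel)"
    by (rule nn_integral_lborel_translate) measurable
  also have "\<dots> = (\<integral>\<^sup>+w. ennreal (norm (h w) powr p) * indicator (ball z r) w \<partial>lborel)"
  proof (rule nn_integral_cong)
    fix w
    show "H w * indicator (ball z r) w = ennreal (norm (h w) powr p) * indicator (ball z r) w"
      using Hw[of "w - z"] by (cases "w \<in> ball z r") (auto simp: dist_norm norm_minus_commute)
  qed
  finally show ?thesis .
qed

text \<open>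
  Cauchy's formula bounds the derivative by values of \<open>h\<close> on a circle of radius \<open>r\<close>; each of these is bounded
  by the average over a ball of radius \<open>r\<close>, which stays inside the ball of radius \<open>2 r\<close>.
\<close>

lemma cauchy_estimate_ball:
  fixes h :: "complex ^ 'n \<Rightarrow> complex"
  assumes h: "holomorphic_ball h" and p: "p > 1" and r: "r > 0" and z: "norm z + 2 * r \<le> 1"
  shows "ennreal ((r * norm (partial_deriv j h z)) powr p) * emeasure lborel (ball (0 :: complex ^ 'n) r)
    \<le> (\<integral>\<^sup>+w. ennreal (norm (h w) powr p) * indicator (ball z (2 * r)) w \<partial>lborel)" (is "_ * ?V \<le> ?R")
proof -
  let ?v = "axis j (of_real r) :: complex ^ 'n"
  have nv: "norm ?v = r" using r by (simp add: norm_axis_complex)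
  have zv: "norm z + norm ?v < 1" using r z nv by simp
  have "((\<lambda>t. h (z + unit_circle t *s ?v) / unit_circle t) has_integral of_real r * partial_deriv j h z) {0..1}"
    using holomorphic_ball_circle_integrals(2)[OF h zv] by (simp add: gradient_form_axis)
  moreover have "continuous_on {0..1} (\<lambda>t. h (z + unit_circle t *s ?v) / unit_circle t)"
    by (intro continuous_intros continuous_on_circle[OF h zv]) auto
  ultimately have "ennreal ((r * norm (partial_deriv j h z)) powr p)
      \<le> (\<integral>\<^sup>+t. ennreal (norm (h (z + unit_circle t *s ?v)) powr p) * indicator {0..1} t \<partial>lborel)"
    using norm_integral_powr_le[OF p, of "\<lambda>t. h (z + unit_circle t *s ?v) / unit_circle t" "of_real r * partial_deriv j h z"] r
    by (simp add: norm_mult norm_divide)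
  then have "ennreal ((r * norm (partial_deriv j h z)) powr p) * ?V
      \<le> (\<integral>\<^sup>+t. ennreal (norm (h (z + unit_circle t *s ?v)) powr p) * indicator {0..1} t \<partial>lborel) * ?V"
    by (rule mult_right_mono) simp
  also have "\<dots> = (\<integral>\<^sup>+t. ennreal (norm (h (z + unit_circle t *s ?v)) powr p) * indicator {0..1} t * ?V \<partial>lborel)"
  proof (rule nn_integral_multc[symmetric])
    have "(\<lambda>t. indicator {0..1} t *\<^sub>R h (z + unit_circle t *s ?v)) \<in> borel_measurable borel"
      by (rule borel_measurable_continuous_on_indicator[OF _ continuous_on_circle[OF h zv]]) simp
    then have "(\<lambda>t. ennreal (norm (indicator {0..1} t *\<^sub>R h (z + unit_circle t *s ?v)) powr p) * indicator {0..1} t)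
        \<in> borel_measurable borel"
      by measurable
    also have "(\<lambda>t. ennreal (norm (indicator {0..1} t *\<^sub>R h (z + unit_circle t *s ?v)) powr p) * indicator {0..1} t)
        = (\<lambda>t. ennreal (norm (h (z + unit_circle t *s ?v)) powr p) * indicator {0..1} t)"
      by (auto simp: indicator_def fun_eq_iff)
    finally show "(\<lambda>t. ennreal (norm (h (z + unit_circle t *s ?v)) powr p) * indicator {0..1} t) \<in> borel_measurable lborel"
      by simp
  qed
  also have "\<dots> \<le> (\<integral>\<^sup>+t. ?R * indicator {0..1 :: real} t \<partial>lborel)"
  proof (rule nn_integral_mono)
    fix t :: real
    let ?u = "z + unit_circle t *s ?v"
    have nu: "norm (unit_circle t *s ?v) = r" by (simp add: norm_vector_scalar_mult nv)
    have "norm ?u + r \<le> 1" using norm_triangle_ineq[of z "unit_circle t *s ?v"] nu z by linarith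
    then have "ennreal (norm (h ?u) powr p) * ?V
        \<le> (\<integral>\<^sup>+w. ennreal (norm (h w) powr p) * indicator (ball ?u r) w \<partial>lborel)"
      by (rule submean_ball[OF h p])
    also have "\<dots> \<le> ?R"
    proof (intro nn_integral_mono mult_left_mono)
      fix w
      have "ball ?u r \<subseteq> ball z (2 * r)"
        by (rule ball_subset_ball_iff[THEN iffD2]) (use nu in \<open>simp add: dist_norm\<close>)
      then show "indicator (ball ?u r) w \<le> (indicator (ball z (2 * r)) w :: ennreal)"
        by (auto simp: indicator_def)
    qed simp
    finally show "ennreal (norm (h ?u) powr p) * indicator {0..1} t * ?V \<le> ?R * indicator {0..1} t"
      by (auto simp: indicator_def)
  qed
  also have "\<dots> = ?R" by (subst nn_integral_cmult) auto
  finally show ?thesis .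
qed

section \<open>Weighted Bergman integrals\<close>

text \<open>
  The \<open>p\<close>-th power of the norm of the weighted Bergman space.  The weight is \<open>(1 - \<bar>z\<bar>)^a\<close> rather than
  \<open>(1 - \<bar>z\<bar>\<^sup>2)^a\<close> because \<open>1 - \<bar>z\<bar>\<close> is the distance to the sphere, which is what the local estimates and the
  dilations see; the two differ by a factor of at most \<open>2^\<bar>a\<bar>\<close>.
\<close>

definition bergman_integral :: "real \<Rightarrow> real \<Rightarrow> (complex ^ 'n \<Rightarrow> complex) \<Rightarrow> ennreal" where
  "bergman_integral p a f =
     (\<integral>\<^sup>+z. ennreal (norm (f z) powr p * (1 - norm z) powr a) * indicator (ball 0 1) z \<partial>lborel)"

lemma powr_comparable:
  fixes d e a :: real
  assumes "d > 0" "e > 0" "d \<le> 2 * e" "e \<le> 2 * d"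
  shows "d powr a \<le> 2 powr \<bar>a\<bar> * e powr a"
proof (cases "a \<ge> 0")
  case True
  have "d powr a \<le> (2 * e) powr a" using assms True by (intro powr_mono2) auto
  then show ?thesis using assms True by (simp add: powr_mult)
next
  case False
  have "d powr a \<le> (e / 2) powr a" using assms False by (intro powr_mono2') auto
  also have "\<dots> = 2 powr \<bar>a\<bar> * e powr a" using assms False by (simp add: powr_divide powr_minus_divide)
  finally show ?thesis .
qed

lemma sum_two_powr_le:
  fixes x y p :: real
  assumes "p > 1" "x \<ge> 0" "y \<ge> 0"
  shows "(x + y) powr p \<le> 2 powr p * (x powr p + y powr p)"
proof -
  have "(x + y) powr p \<le> (2 * max x y) powr p"
    using assms by (intro powr_mono2) auto
  also have "\<dots> = 2 powr p * max x y powr p" using assms by (simp add: powr_mult)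
  also have "\<dots> \<le> 2 powr p * (x powr p + y powr p)"
    by (intro mult_left_mono) (auto simp: max_def)
  finally show ?thesis .
qed

lemma bergman_integral_cmult_le:
  assumes "C \<ge> 0" "continuous_on (ball 0 1) (g :: complex ^ 'n \<Rightarrow> complex)"
    and "\<And>z. norm z < 1 \<Longrightarrow> norm (f z) \<le> C * norm (g z)" and "p > 0"
  shows "bergman_integral p a f \<le> ennreal (C powr p) * bergman_integral p a (g :: complex ^ 'n \<Rightarrow> complex)"
proof -
  have "bergman_integral p a f \<le> (\<integral>\<^sup>+z. ennreal (C powr p) * (ennreal (norm (g z) powr p * (1 - norm z) powr a) * indicator (ball 0 1) z) \<partial>lborel)"
    unfolding bergman_integral_def
  proof (rule nn_integral_mono)
    fix z :: "complex ^ 'n"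
    show "ennreal (norm (f z) powr p * (1 - norm z) powr a) * indicator (ball 0 1) z
        \<le> ennreal (C powr p) * (ennreal (norm (g z) powr p * (1 - norm z) powr a) * indicator (ball 0 1) z)"
    proof (cases "norm z < 1")
      case True
      have "norm (f z) powr p \<le> (C * norm (g z)) powr p"
        using assms True by (intro powr_mono2) auto
      then have "norm (f z) powr p * (1 - norm z) powr a \<le> C powr p * (norm (g z) powr p * (1 - norm z) powr a)"
        using assms(1) by (simp add: powr_mult mult.assoc[symmetric] mult_right_mono)
      then show ?thesis using True by (simp add: ennreal_mult[symmetric] ennreal_leI)
    qed simp
  qed
  also have "\<dots> = ennreal (C powr p) * bergman_integral p a g"
    unfolding bergman_integral_def by (rule nn_integral_cmult) (use borel_measurable_norm_powr_ball[OF assms(2)] in simp)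
  finally show ?thesis .
qed

lemma bergman_integral_add_le:
  fixes f g h :: "complex ^ 'n \<Rightarrow> complex"
  assumes g: "continuous_on (ball 0 1) g" and h: "continuous_on (ball 0 1) h"
    and le: "\<And>z. norm z < 1 \<Longrightarrow> norm (f z) \<le> norm (g z) + norm (h z)" and p: "p > 1"
  shows "bergman_integral p a f \<le> ennreal (2 powr p) * (bergman_integral p a g + bergman_integral p a h)"
proof -
  define I where "I u z = ennreal (norm (u z) powr p * (1 - norm z) powr a) * indicator (ball 0 1) z" for u :: "complex ^ 'n \<Rightarrow> complex" and z
  have [measurable]: "I g \<in> borel_measurable borel" "I h \<in> borel_measurable borel"
    unfolding I_def by (rule borel_measurable_norm_powr_ball; fact)+
  have "bergman_integral p a f \<le> (\<integral>\<^sup>+z. ennreal (2 powr p) * (I g z + I h z) \<partial>lborel)"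
    unfolding bergman_integral_def
  proof (rule nn_integral_mono)
    fix z :: "complex ^ 'n"
    show "ennreal (norm (f z) powr p * (1 - norm z) powr a) * indicator (ball 0 1) z \<le> ennreal (2 powr p) * (I g z + I h z)"
    proof (cases "norm z < 1")
      case True
      have "norm (f z) powr p \<le> (norm (g z) + norm (h z)) powr p"
        using le[OF True] p by (intro powr_mono2) auto
      also have "\<dots> \<le> 2 powr p * (norm (g z) powr p + norm (h z) powr p)"
        by (rule sum_two_powr_le[OF p]) auto
      finally have "norm (f z) powr p * (1 - norm z) powr a \<le> 2 powr p * (norm (g z) powr p + norm (h z) powr p) * (1 - norm z) powr a"
        by (rule mult_right_mono) simp
      then have "ennreal (norm (f z) powr p * (1 - norm z) powr a) \<le> ennreal (2 powr p * (norm (g z) powr p * (1 - norm z) powr a + norm (h z) powr p * (1 - norm z) powr a))"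
        by (intro ennreal_leI) (simp add: algebra_simps)
      then show ?thesis using True by (simp add: I_def ennreal_mult)
    qed simp
  qed
  also have "\<dots> = ennreal (2 powr p) * (bergman_integral p a g + bergman_integral p a h)"
    by (simp add: nn_integral_cmult nn_integral_add bergman_integral_def I_def[symmetric, abs_def])
  finally show ?thesis .
qed

lemma unit_ball_measure_pos: "measure lborel (ball (0 :: complex ^ 'n) 1) > 0"
  using content_ball_pos[of 1 "0 :: complex ^ 'n"] by (simp add: measure_def)

text \<open>
  On the ball around \<open>w\<close> with half the distance to the sphere as radius, the weight is comparable to its
  value at \<open>w\<close>.  Hence an unweighted estimate over this ball implies a weighted one, where the volume of the
  ball accounts for the additional exponent \<open>2 n\<close>.
\<close>

lemma weighted_local_estimate:
  fixes h :: "complex ^ 'n \<Rightarrow> complex" and p a :: real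
  defines "N \<equiv> DIM(complex ^ 'n)" and "v \<equiv> measure lborel (ball (0 :: complex ^ 'n) 1)"
  assumes h: "continuous_on (ball 0 1) h" and w: "norm w < 1" and U: "U \<ge> 0"
    and est: "ennreal U * emeasure lborel (ball (0 :: complex ^ 'n) ((1 - norm w) / 4))
      \<le> (\<integral>\<^sup>+\<zeta>. ennreal (norm (h \<zeta>) powr p) * indicator (ball w ((1 - norm w) / 2)) \<zeta> \<partial>lborel)"
  shows "ennreal (U * (1 - norm w) powr (a + N)) \<le> ennreal (2 powr \<bar>a\<bar> * 4 ^ N / v) *
    (\<integral>\<^sup>+\<zeta>. ennreal (norm (h \<zeta>) powr p * (1 - norm \<zeta>) powr a) * indicator (ball 0 1) \<zeta>
       * indicator (ball w ((1 - norm w) / 2)) \<zeta> \<partial>lborel)"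
proof -
  define d where "d = 1 - norm w"
  have d: "d > 0" using w by (simp add: d_def)
  have v: "v > 0" unfolding v_def using content_ball_pos[of 1 "0 :: complex ^ 'n"]
    by (simp add: measure_def)
  have V: "emeasure lborel (ball (0 :: complex ^ 'n) 1) = ennreal v"
    unfolding v_def using emeasure_lborel_ball_finite[of "0 :: complex ^ 'n" 1]
    by (intro emeasure_eq_ennreal_measure) auto
  have near: "d \<le> 2 * (1 - norm \<zeta>)" "1 - norm \<zeta> \<le> 2 * d" "1 - norm \<zeta> > 0" if "\<zeta> \<in> ball w (d / 2)" for \<zeta>
    using that norm_triangle_ineq2[of \<zeta> w] norm_triangle_ineq2[of w \<zeta>] d
    by (auto simp: dist_norm norm_minus_commute d_def field_simps)
  have [measurable]: "ball w (d / 2) \<in> sets borel" "ball (0 :: complex ^ 'n) 1 \<in> sets borel" by simp_all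
  define H where "H b \<zeta> = ennreal (norm (h \<zeta>) powr p * (1 - norm \<zeta>) powr b) * indicator (ball 0 1) \<zeta>" for b \<zeta>
  have [measurable]: "H b \<in> borel_measurable borel" for b
    unfolding H_def by (rule borel_measurable_norm_powr_ball[OF h])
  have H0: "ennreal (norm (h \<zeta>) powr p) * indicator (ball w (d / 2)) \<zeta> = H 0 \<zeta> * indicator (ball w (d / 2)) \<zeta>" for \<zeta>
    using near[of \<zeta>] by (cases "\<zeta> \<in> ball w (d / 2)") (auto simp: H_def)
  have vol: "emeasure lborel (ball (0 :: complex ^ 'n) (d / 4)) = ennreal ((d / 4) ^ N * v)"
    using emeasure_lborel_ball_scale[of "d / 4" "0 :: complex ^ 'n"] d v by (simp add: V N_def ennreal_mult)
  have "U * d powr (a + N) = (4 ^ N / v * d powr a) * (U * ((d / 4) ^ N * v))"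
    using d v by (simp add: powr_add powr_realpow power_divide)
  then have "ennreal (U * d powr (a + N)) = ennreal (4 ^ N / v * d powr a) * (ennreal U * emeasure lborel (ball (0 :: complex ^ 'n) (d / 4)))"
    using d v U by (simp add: vol ennreal_mult[symmetric])
  also have "\<dots> \<le> ennreal (4 ^ N / v * d powr a) * (\<integral>\<^sup>+\<zeta>. H 0 \<zeta> * indicator (ball w (d / 2)) \<zeta> \<partial>lborel)"
    using est by (intro mult_left_mono) (auto simp: H0 d_def[symmetric])
  also have "\<dots> = (\<integral>\<^sup>+\<zeta>. ennreal (4 ^ N / v * d powr a) * (H 0 \<zeta> * indicator (ball w (d / 2)) \<zeta>) \<partial>lborel)"
    by (rule nn_integral_cmult[symmetric]) measurable
  also have "\<dots> \<le> (\<integral>\<^sup>+\<zeta>. ennreal (2 powr \<bar>a\<bar> * 4 ^ N / v) * (H a \<zeta> * indicator (ball w (d / 2)) \<zeta>) \<partial>lborel)"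
  proof (rule nn_integral_mono)
    fix \<zeta>
    show "ennreal (4 ^ N / v * d powr a) * (H 0 \<zeta> * indicator (ball w (d / 2)) \<zeta>)
        \<le> ennreal (2 powr \<bar>a\<bar> * 4 ^ N / v) * (H a \<zeta> * indicator (ball w (d / 2)) \<zeta>)"
    proof (cases "\<zeta> \<in> ball w (d / 2)")
      case True
      note n = near[OF True]
      have "d powr a \<le> 2 powr \<bar>a\<bar> * (1 - norm \<zeta>) powr a"
        using n d by (intro powr_comparable)
      then have "4 ^ N / v * norm (h \<zeta>) powr p * d powr a \<le> 4 ^ N / v * norm (h \<zeta>) powr p * (2 powr \<bar>a\<bar> * (1 - norm \<zeta>) powr a)"
        using v by (intro mult_left_mono) auto
      then have "4 ^ N / v * d powr a * norm (h \<zeta>) powr p \<le> 2 powr \<bar>a\<bar> * 4 ^ N / v * (norm (h \<zeta>) powr p * (1 - norm \<zeta>) powr a)"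
        by (simp add: mult_ac)
      then show ?thesis
        using True n v by (simp add: H_def ennreal_mult[symmetric] ennreal_leI)
    qed simp
  qed
  also have "\<dots> = ennreal (2 powr \<bar>a\<bar> * 4 ^ N / v) * (\<integral>\<^sup>+\<zeta>. H a \<zeta> * indicator (ball w (d / 2)) \<zeta> \<partial>lborel)"
    by (rule nn_integral_cmult) measurable
  finally show ?thesis unfolding H_def d_def .
qed

lemma bergman_local_const_pos:
  fixes a :: real
  shows "2 powr \<bar>a\<bar> * 4 ^ DIM(complex ^ 'n) / measure lborel (ball (0 :: complex ^ 'n) 1) > 0"
  using content_ball_pos[of 1 "0 :: complex ^ 'n"] by (simp add: measure_def)

lemma bergman_point_bound:
  fixes p a :: real
  assumes p: "p > 1"
  shows "\<exists>C>0. \<forall>h w. holomorphic_ball h \<longrightarrow> norm w < 1 \<longrightarrow>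
    ennreal (norm (h w) powr p * (1 - norm w) powr (a + DIM(complex ^ 'n)))
      \<le> ennreal C * bergman_integral p a (h :: complex ^ 'n \<Rightarrow> complex)"
proof (intro exI conjI allI impI)
  let ?C = "2 powr \<bar>a\<bar> * 4 ^ DIM(complex ^ 'n) / measure lborel (ball (0 :: complex ^ 'n) 1)"
  show "?C > 0" by (rule bergman_local_const_pos)
  fix h :: "complex ^ 'n \<Rightarrow> complex" and w :: "complex ^ 'n" assume h: "holomorphic_ball h" and w: "norm w < 1"
  let ?d = "1 - norm w"
  have "ennreal (norm (h w) powr p) * emeasure lborel (ball (0 :: complex ^ 'n) (?d / 4))
      \<le> (\<integral>\<^sup>+\<zeta>. ennreal (norm (h \<zeta>) powr p) * indicator (ball w (?d / 4)) \<zeta> \<partial>lborel)"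
    by (rule submean_ball[OF h p]) (use w in \<open>simp add: field_simps\<close>)
  also have "\<dots> \<le> (\<integral>\<^sup>+\<zeta>. ennreal (norm (h \<zeta>) powr p) * indicator (ball w (?d / 2)) \<zeta> \<partial>lborel)"
    using w by (intro nn_integral_mono mult_left_mono) (auto simp: indicator_def)
  finally have "ennreal (norm (h w) powr p * ?d powr (a + DIM(complex ^ 'n))) \<le> ennreal ?C *
    (\<integral>\<^sup>+\<zeta>. ennreal (norm (h \<zeta>) powr p * (1 - norm \<zeta>) powr a) * indicator (ball 0 1) \<zeta>
       * indicator (ball w (?d / 2)) \<zeta> \<partial>lborel)"
    by (intro weighted_local_estimate holomorphic_ball_continuous_on h w) auto
  also have "\<dots> \<le> ennreal ?C * bergman_integral p a h"
    unfolding bergman_integral_def by (intro mult_left_mono nn_integral_mono) (auto simp: indicator_def)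
  finally show "ennreal (norm (h w) powr p * ?d powr (a + DIM(complex ^ 'n))) \<le> ennreal ?C * bergman_integral p a h" .
qed

lemma bergman_partial_deriv_local:
  fixes h :: "complex ^ 'n \<Rightarrow> complex" and p a :: real
  assumes p: "p > 1" and h: "holomorphic_ball h" and w: "norm w < 1"
  shows "ennreal (norm (partial_deriv j h w) powr p * (1 - norm w) powr (p + a + DIM(complex ^ 'n))) \<le>
    ennreal (4 powr p * (2 powr \<bar>a\<bar> * 4 ^ DIM(complex ^ 'n) / measure lborel (ball (0 :: complex ^ 'n) 1))) *
    (\<integral>\<^sup>+\<zeta>. ennreal (norm (h \<zeta>) powr p * (1 - norm \<zeta>) powr a) * indicator (ball 0 1) \<zeta>
       * indicator (ball w ((1 - norm w) / 2)) \<zeta> \<partial>lborel)"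
    (is "_ \<le> ennreal (_ * ?C) * ?I")
proof -
  let ?d = "1 - norm w"
  have C: "?C > 0" by (rule bergman_local_const_pos)
  let ?U = "(?d / 4 * norm (partial_deriv j h w)) powr p"
  have r: "2 * (?d / 4) = ?d / 2" by simp
  have "ennreal ?U * emeasure lborel (ball (0 :: complex ^ 'n) (?d / 4))
      \<le> (\<integral>\<^sup>+\<zeta>. ennreal (norm (h \<zeta>) powr p) * indicator (ball w (2 * (?d / 4))) \<zeta> \<partial>lborel)"
    by (rule cauchy_estimate_ball[OF h p]) (use w in \<open>simp_all add: field_simps\<close>)
  from this[unfolded r] have "ennreal (?U * ?d powr (a + DIM(complex ^ 'n))) \<le> ennreal ?C * ?I"
    by (intro weighted_local_estimate holomorphic_ball_continuous_on h w) auto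
  then have "ennreal (4 powr p) * ennreal (?U * ?d powr (a + DIM(complex ^ 'n))) \<le> ennreal (4 powr p) * (ennreal ?C * ?I)"
    by (rule mult_left_mono) simp
  also have "ennreal (4 powr p) * ennreal (?U * ?d powr (a + DIM(complex ^ 'n)))
      = ennreal (norm (partial_deriv j h w) powr p * ?d powr (p + a + DIM(complex ^ 'n)))"
    using w by (simp add: ennreal_mult[symmetric] powr_mult powr_divide powr_add mult_ac)
  also have "ennreal (4 powr p) * (ennreal ?C * ?I) = ennreal (4 powr p * ?C) * ?I"
    using C by (subst ennreal_mult) (simp_all only: mult.assoc less_imp_le powr_ge_zero)
  finally show ?thesis .
qed

lemma bergman_partial_deriv_point_bound:
  fixes p a :: real
  assumes p: "p > 1"
  shows "\<exists>C>0. \<forall>h w. holomorphic_ball h \<longrightarrow> norm w < 1 \<longrightarrow>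
    ennreal (norm (partial_deriv j h w) powr p * (1 - norm w) powr (p + a + DIM(complex ^ 'n)))
      \<le> ennreal C * bergman_integral p a (h :: complex ^ 'n \<Rightarrow> complex)"
proof (intro exI conjI allI impI)
  let ?C = "4 powr p * (2 powr \<bar>a\<bar> * 4 ^ DIM(complex ^ 'n) / measure lborel (ball (0 :: complex ^ 'n) 1))"
  show "?C > 0" using bergman_local_const_pos[where 'n='n] by (intro mult_pos_pos) auto
  fix h :: "complex ^ 'n \<Rightarrow> complex" and w :: "complex ^ 'n" assume h: "holomorphic_ball h" and w: "norm w < 1"
  note bergman_partial_deriv_local[OF p h w, of j a]
  also have "ennreal ?C * (\<integral>\<^sup>+\<zeta>. ennreal (norm (h \<zeta>) powr p * (1 - norm \<zeta>) powr a) * indicator (ball 0 1) \<zeta>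
       * indicator (ball w ((1 - norm w) / 2)) \<zeta> \<partial>lborel) \<le> ennreal ?C * bergman_integral p a h"
    unfolding bergman_integral_def by (intro mult_left_mono nn_integral_mono) (auto simp: indicator_def)
  finally show "ennreal (norm (partial_deriv j h w) powr p * (1 - norm w) powr (p + a + DIM(complex ^ 'n)))
      \<le> ennreal ?C * bergman_integral p a h" .
qed

text \<open>
  The kernel left over when the local estimates are integrated over \<open>w\<close> and the order of integration is
  exchanged.  It is supported where the distances of \<open>w\<close> and \<open>\<zeta>\<close> to the sphere are comparable and
  \<open>\<bar>w - \<zeta>\<bar>\<close> is at most the distance of \<open>\<zeta>\<close>; the volume of this set compensates the singular factor.
\<close>

lemma nn_integral_whitney_ball_le:
  fixes \<zeta> :: "complex ^ 'n"
  assumes "norm \<zeta> < 1"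
  shows "(\<integral>\<^sup>+w. ennreal ((1 - norm w) powr - real DIM(complex ^ 'n)) * indicator (ball 0 1) w
      * indicator (ball w ((1 - norm w) / 2)) \<zeta> \<partial>lborel)
    \<le> ennreal (2 ^ DIM(complex ^ 'n) * measure lborel (ball (0 :: complex ^ 'n) 1))"
proof -
  let ?N = "DIM(complex ^ 'n)"
  define e where "e = 1 - norm \<zeta>"
  have e: "e > 0" using assms by (simp add: e_def)
  have "(\<integral>\<^sup>+w. ennreal ((1 - norm w) powr - real ?N) * indicator (ball 0 1) w
      * indicator (ball w ((1 - norm w) / 2)) \<zeta> \<partial>lborel)
    \<le> (\<integral>\<^sup>+w. ennreal (2 ^ ?N * e powr - real ?N) * indicator (ball \<zeta> e) w \<partial>lborel)"
  proof (rule nn_integral_mono)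
    fix w
    show "ennreal ((1 - norm w) powr - real ?N) * indicator (ball 0 1) w * indicator (ball w ((1 - norm w) / 2)) \<zeta>
        \<le> ennreal (2 ^ ?N * e powr - real ?N) * indicator (ball \<zeta> e) w"
    proof (cases "w \<in> ball 0 1 \<and> \<zeta> \<in> ball w ((1 - norm w) / 2)")
      case True
      then have near: "1 - norm w \<le> 2 * e" "e \<le> 2 * (1 - norm w)" "norm (w - \<zeta>) < e"
        using norm_triangle_ineq2[of \<zeta> w] norm_triangle_ineq2[of w \<zeta>]
        by (auto simp: dist_norm norm_minus_commute e_def field_simps)
      have "(1 - norm w) powr - real ?N \<le> 2 powr \<bar>- real ?N\<bar> * e powr - real ?N"
        using True near e by (intro powr_comparable) auto
      also have "2 powr \<bar>- real ?N\<bar> = (2 :: real) ^ ?N"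
        by (simp add: powr_realpow del: DIM_cart)
      finally show ?thesis
        using True near by (simp add: ennreal_leI dist_norm norm_minus_commute del: DIM_cart)
    qed auto
  qed
  also have "\<dots> = ennreal (2 ^ ?N * e powr - real ?N) * emeasure lborel (ball \<zeta> e)"
    by (rule nn_integral_cmult_indicator) simp
  also have "\<dots> = ennreal (2 ^ ?N * e powr - real ?N) * (ennreal (e ^ ?N) * ennreal (measure lborel (ball (0 :: complex ^ 'n) 1)))"
    using emeasure_lborel_ball_scale[OF e, of \<zeta>] emeasure_lborel_ball_finite[of "0 :: complex ^ 'n" 1]
    by (simp add: emeasure_eq_ennreal_measure del: DIM_cart)
  also have "\<dots> = ennreal (2 ^ ?N * measure lborel (ball (0 :: complex ^ 'n) 1))"
    using e by (simp add: ennreal_mult[symmetric] powr_minus powr_realpow del: DIM_cart)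
  finally show ?thesis .
qed

text \<open>
  Differentiation costs one power of the distance to the sphere.  The local estimates are integrated over
  \<open>w\<close>, and exchanging the order of integration leaves the kernel of the preceding lemma.
\<close>

lemma bergman_partial_deriv_le:
  fixes p a :: real
  assumes p: "p > 1"
  shows "\<exists>C>0. \<forall>h. holomorphic_ball h \<longrightarrow>
    bergman_integral p (p + a) (partial_deriv j h) \<le> ennreal C * bergman_integral p a (h :: complex ^ 'n \<Rightarrow> complex)"
proof -
  let ?N = "DIM(complex ^ 'n)" and ?V = "measure lborel (ball (0 :: complex ^ 'n) 1)"
  define C where "C = 4 powr p * (2 powr \<bar>a\<bar> * 4 ^ ?N / ?V)"
  have C: "C > 0" unfolding C_def using bergman_local_const_pos[where 'n='n] by (intro mult_pos_pos) auto
  have V: "?V > 0" using content_ball_pos[of 1 "0 :: complex ^ 'n"] by (simp add: measure_def)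
  have "bergman_integral p (p + a) (partial_deriv j h) \<le> ennreal (C * (2 ^ ?N * ?V)) * bergman_integral p a h"
    if h: "holomorphic_ball h" for h :: "complex ^ 'n \<Rightarrow> complex"
  proof -
    define H where "H \<zeta> = ennreal (norm (h \<zeta>) powr p * (1 - norm \<zeta>) powr a) * indicator (ball 0 1) \<zeta>" for \<zeta>
    have [measurable]: "H \<in> borel_measurable borel"
      unfolding H_def by (rule borel_measurable_norm_powr_ball[OF holomorphic_ball_continuous_on[OF h]])
    define k where "k w \<zeta> = ennreal ((1 - norm w) powr - real ?N) * indicator (ball 0 1) w
        * indicator (ball w ((1 - norm w) / 2)) \<zeta>" for w \<zeta> :: "complex ^ 'n"
    have k_alt: "k w \<zeta> = ennreal ((1 - norm w) powr - real ?N) * indicator {..<1} (norm w)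
        * indicator {0<..} ((1 - norm w) / 2 - norm (w - \<zeta>))" for w \<zeta>
      by (auto simp: k_def indicator_def dist_norm)
    have [measurable]: "(\<lambda>(w, \<zeta>). k w \<zeta>) \<in> borel_measurable (lborel \<Otimes>\<^sub>M lborel)"
      unfolding k_alt by measurable
    have "bergman_integral p (p + a) (partial_deriv j h)
        \<le> (\<integral>\<^sup>+w. (\<integral>\<^sup>+\<zeta>. ennreal C * (H \<zeta> * k w \<zeta>) \<partial>lborel) \<partial>lborel)"
      unfolding bergman_integral_def
    proof (rule nn_integral_mono)
      fix w :: "complex ^ 'n"
      show "ennreal (norm (partial_deriv j h w) powr p * (1 - norm w) powr (p + a)) * indicator (ball 0 1) w
          \<le> (\<integral>\<^sup>+\<zeta>. ennreal C * (H \<zeta> * k w \<zeta>) \<partial>lborel)"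
      proof (cases "w \<in> ball 0 1")
        case True
        then have w: "norm w < 1" by simp
        have [measurable]: "ball w ((1 - norm w) / 2) \<in> sets borel" by simp
        define X where "X = (1 - norm w) powr - real ?N"
        have "ennreal (norm (partial_deriv j h w) powr p * (1 - norm w) powr (p + a))
            = ennreal X * ennreal (norm (partial_deriv j h w) powr p * (1 - norm w) powr (p + a + ?N))"
          using w by (simp add: X_def ennreal_mult[symmetric] powr_add powr_minus mult_ac del: DIM_cart)
        also have "\<dots> \<le> ennreal X * (ennreal C * (\<integral>\<^sup>+\<zeta>. H \<zeta> * indicator (ball w ((1 - norm w) / 2)) \<zeta> \<partial>lborel))"
          unfolding C_def H_def by (intro mult_left_mono bergman_partial_deriv_local p h w) simp
        also have "\<dots> = (\<integral>\<^sup>+\<zeta>. ennreal X * (ennreal C * (H \<zeta> * indicator (ball w ((1 - norm w) / 2)) \<zeta>)) \<partial>lborel)"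
          by (simp add: nn_integral_cmult)
        also have "\<dots> = (\<integral>\<^sup>+\<zeta>. ennreal C * (H \<zeta> * k w \<zeta>) \<partial>lborel)"
          using True by (intro nn_integral_cong) (simp add: k_def X_def mult_ac del: DIM_cart)
        finally show ?thesis using True by simp
      qed simp
    qed
    also have "\<dots> = (\<integral>\<^sup>+\<zeta>. (\<integral>\<^sup>+w. ennreal C * (H \<zeta> * k w \<zeta>) \<partial>lborel) \<partial>lborel)"
      by (rule lborel_pair.Fubini'[symmetric]) measurable
    also have "\<dots> \<le> (\<integral>\<^sup>+\<zeta>. ennreal (C * (2 ^ ?N * ?V)) * H \<zeta> \<partial>lborel)"
    proof (rule nn_integral_mono)
      fix \<zeta> :: "complex ^ 'n"
      have [measurable]: "(\<lambda>w. k w \<zeta>) \<in> borel_measurable lborel"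
        unfolding k_alt by measurable
      have "(\<integral>\<^sup>+w. ennreal C * (H \<zeta> * k w \<zeta>) \<partial>lborel) = ennreal C * (H \<zeta> * (\<integral>\<^sup>+w. k w \<zeta> \<partial>lborel))"
        by (simp add: nn_integral_cmult)
      also have "\<dots> \<le> ennreal C * (H \<zeta> * ennreal (2 ^ ?N * ?V))"
        using nn_integral_whitney_ball_le[of \<zeta>]
        by (cases "norm \<zeta> < 1") (auto simp: H_def k_def intro!: mult_left_mono simp del: DIM_cart)
      also have "\<dots> = ennreal (C * (2 ^ ?N * ?V)) * H \<zeta>"
        using C V by (simp add: ennreal_mult mult_ac del: DIM_cart)
      finally show "(\<integral>\<^sup>+w. ennreal C * (H \<zeta> * k w \<zeta>) \<partial>lborel) \<le> ennreal (C * (2 ^ ?N * ?V)) * H \<zeta>" .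
    qed
    also have "\<dots> = ennreal (C * (2 ^ ?N * ?V)) * bergman_integral p a h"
      unfolding bergman_integral_def H_def[symmetric] by (rule nn_integral_cmult) simp
    finally show ?thesis .
  qed
  moreover have "C * (2 ^ ?N * ?V) > 0" using C V by simp
  ultimately show ?thesis by blast
qed

section \<open>Integration along radii\<close>

text \<open>
  The substitution \<open>t \<mapsto> t - r\<close> shows the gain of one power: \<open>1 - r/t\<close> is comparable to \<open>t - r\<close>, whose
  \<open>b\<close>-th power is integrable up to \<open>t = r\<close> because \<open>b > -1\<close>.
\<close>

lemma nn_integral_radial_kernel_le:
  fixes b r :: real
  assumes b: "b > -1" and r: "0 \<le> r" "r < 1"
  shows "(\<integral>\<^sup>+t. ennreal ((1 - r / t) powr b) * indicator {1/2..1} t * indicator {r<..} t \<partial>lborel)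
    \<le> ennreal (2 powr \<bar>b\<bar> / (b + 1) * (1 - r) powr (b + 1))"
proof -
  have "(\<integral>\<^sup>+t. ennreal ((1 - r / t) powr b) * indicator {1/2..1} t * indicator {r<..} t \<partial>lborel)
      \<le> (\<integral>\<^sup>+t. ennreal (2 powr \<bar>b\<bar>) * (ennreal ((- r + t) powr b) * indicator {0..1 - r} (- r + t)) \<partial>lborel)"
  proof (rule nn_integral_mono)
    fix t :: real
    show "ennreal ((1 - r / t) powr b) * indicator {1/2..1} t * indicator {r<..} t
        \<le> ennreal (2 powr \<bar>b\<bar>) * (ennreal ((- r + t) powr b) * indicator {0..1 - r} (- r + t))"
    proof (cases "t \<in> {1/2..1} \<and> t > r")
      case True
      have "(1 - r / t) powr b \<le> 2 powr \<bar>b\<bar> * (t - r) powr b"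
      proof (rule powr_comparable)
        have "1 - r / t = (t - r) / t" using True by (simp add: field_simps)
        moreover have "(t - r) / t \<le> (t - r) / (1 / 2)" "(t - r) / t \<ge> (t - r) / 1"
          using True by (intro divide_left_mono; simp)+
        ultimately show "1 - r / t \<le> 2 * (t - r)" "t - r \<le> 2 * (1 - r / t)" "1 - r / t > 0"
          using True by (auto simp: field_simps)
      qed (use True in auto)
      then have "ennreal ((1 - r / t) powr b) \<le> ennreal (2 powr \<bar>b\<bar>) * ennreal ((- r + t) powr b)"
        by (simp add: ennreal_mult[symmetric] ennreal_leI)
      then show ?thesis using True by simp
    qed auto
  qed
  also have "\<dots> = ennreal (2 powr \<bar>b\<bar>) * (\<integral>\<^sup>+t. ennreal ((- r + t) powr b) * indicator {0..1 - r} (- r + t) \<partial>lborel)"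
    by (rule nn_integral_cmult) measurable
  also have "(\<integral>\<^sup>+t. ennreal ((- r + t) powr b) * indicator {0..1 - r} (- r + t) \<partial>lborel)
      = (\<integral>\<^sup>+t. ennreal (t powr b) * indicator {0..1 - r} t \<partial>lborel)"
    by (rule nn_integral_lborel_translate[of "\<lambda>t. ennreal (t powr b) * indicator {0..1 - r} t"]) measurable
  also have "\<dots> = ennreal ((1 - r) powr (b + 1) / (b + 1))"
    using r b by (intro nn_integral_has_integral_lebesgue' has_integral_powr_from_0) auto
  also have "ennreal (2 powr \<bar>b\<bar>) * \<dots> = ennreal (2 powr \<bar>b\<bar> / (b + 1) * (1 - r) powr (b + 1))"
    using b by (simp add: ennreal_mult[symmetric])
  finally show ?thesis .
qed

text \<open>
  Averaging a function over dilations by \<open>t \<in> [1/2, 1]\<close> gains one power of the distance to the sphere.  The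
  substitution \<open>w = t z\<close> moves the dilation into the weight, which is then integrated over \<open>t\<close> for fixed \<open>w\<close>.
  Restricting to \<open>t \<ge> 1/2\<close> keeps the Jacobian bounded.
\<close>

lemma nn_integral_dilation_le:
  fixes F :: "complex ^ 'n \<Rightarrow> ennreal" and b :: real
  assumes b: "b > -1" and [measurable]: "F \<in> borel_measurable borel"
  shows "(\<integral>\<^sup>+z. (\<integral>\<^sup>+t. F (t *\<^sub>R z) * ennreal ((1 - norm z) powr b) * indicator {1/2..1} t * indicator (ball 0 1) z \<partial>lborel) \<partial>lborel)
    \<le> ennreal (2 ^ DIM(complex ^ 'n) * (2 powr \<bar>b\<bar> / (b + 1)))
      * (\<integral>\<^sup>+w. F w * ennreal ((1 - norm w) powr (b + 1)) * indicator (ball 0 1) w \<partial>lborel)"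
proof -
  have ind: "indicator (ball 0 1) z = (indicator {..<1} (norm z) :: ennreal)" for z :: "complex ^ 'n"
    by (auto simp: indicator_def)
  let ?N = "DIM(complex ^ 'n)"
  define c where "c = 2 powr \<bar>b\<bar> / (b + 1)"
  have c: "c > 0" using b by (simp add: c_def)
  define P where "P w t = F w * ennreal ((1 - norm w / t) powr b) * indicator {1/2..1} t * indicator {norm w<..} t" for w t
  have P_alt: "P w t = F w * ennreal ((1 - norm w / t) powr b) * indicator {1/2..1} t * indicator {0<..} (t - norm w)" for w t
    by (simp add: P_def indicator_def)
  have [measurable]: "(\<lambda>(w, t). P w t) \<in> borel_measurable (lborel \<Otimes>\<^sub>M lborel)"
    unfolding P_alt by measurable
  have [measurable]: "(\<lambda>w. P w t) \<in> borel_measurable borel" for t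
    unfolding P_alt by measurable
  have "(\<integral>\<^sup>+z. (\<integral>\<^sup>+t. F (t *\<^sub>R z) * ennreal ((1 - norm z) powr b) * indicator {1/2..1} t * indicator (ball 0 1) z \<partial>lborel) \<partial>lborel)
      = (\<integral>\<^sup>+z. (\<integral>\<^sup>+t. P (t *\<^sub>R z) t \<partial>lborel) \<partial>lborel)"
  proof (intro nn_integral_cong)
    fix z :: "complex ^ 'n" and t :: real
    show "F (t *\<^sub>R z) * ennreal ((1 - norm z) powr b) * indicator {1/2..1} t * indicator (ball 0 1) z = P (t *\<^sub>R z) t"
    proof (cases "t \<in> {1/2..1}")
      case True
      then have "norm (t *\<^sub>R z) / t = norm z" "norm (t *\<^sub>R z) < t \<longleftrightarrow> norm z < 1" by auto
      then show ?thesis by (simp add: P_def indicator_def)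
    qed (simp add: P_def)
  qed
  also have "\<dots> = (\<integral>\<^sup>+t. (\<integral>\<^sup>+z. P (t *\<^sub>R z) t \<partial>lborel) \<partial>lborel)"
    unfolding P_alt by (rule lborel_pair.Fubini'[symmetric]) measurable
  also have "\<dots> \<le> (\<integral>\<^sup>+t. (\<integral>\<^sup>+w. ennreal (2 ^ ?N) * P w t \<partial>lborel) \<partial>lborel)"
  proof (rule nn_integral_mono)
    fix t :: real
    show "(\<integral>\<^sup>+z. P (t *\<^sub>R z) t \<partial>lborel) \<le> (\<integral>\<^sup>+w. ennreal (2 ^ ?N) * P w t \<partial>lborel)"
    proof (cases "t \<in> {1/2..1}")
      case True
      have "1 \<le> (2 * t) ^ ?N" using True by (intro one_le_power) auto
      then have "1 \<le> ennreal (2 ^ ?N) * ennreal (t ^ ?N)"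
        using True by (simp add: ennreal_mult[symmetric] power_mult_distrib del: DIM_cart)
      then have "1 * (\<integral>\<^sup>+z. P (t *\<^sub>R z) t \<partial>lborel) \<le> ennreal (2 ^ ?N) * ennreal (t ^ ?N) * (\<integral>\<^sup>+z. P (t *\<^sub>R z) t \<partial>lborel)"
        by (rule mult_right_mono) simp
      also have "\<dots> = ennreal (2 ^ ?N) * (\<integral>\<^sup>+w. P w t \<partial>lborel)"
        using True by (subst nn_integral_lborel_scale[of "\<lambda>w. P w t" t]) (auto simp: mult.assoc simp del: DIM_cart)
      also have "\<dots> = (\<integral>\<^sup>+w. ennreal (2 ^ ?N) * P w t \<partial>lborel)"
        by (rule nn_integral_cmult[symmetric]) simp
      finally show ?thesis by simp
    qed (simp add: P_def)
  qed
  also have "\<dots> = (\<integral>\<^sup>+w. (\<integral>\<^sup>+t. ennreal (2 ^ ?N) * P w t \<partial>lborel) \<partial>lborel)"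
    by (rule lborel_pair.Fubini') measurable
  also have "\<dots> \<le> (\<integral>\<^sup>+w. ennreal (2 ^ ?N * c) * (F w * ennreal ((1 - norm w) powr (b + 1)) * indicator (ball 0 1) w) \<partial>lborel)"
  proof (rule nn_integral_mono)
    fix w :: "complex ^ 'n"
    show "(\<integral>\<^sup>+t. ennreal (2 ^ ?N) * P w t \<partial>lborel)
        \<le> ennreal (2 ^ ?N * c) * (F w * ennreal ((1 - norm w) powr (b + 1)) * indicator (ball 0 1) w)"
    proof (cases "norm w < 1")
      case True
      have "(\<integral>\<^sup>+t. ennreal (2 ^ ?N) * P w t \<partial>lborel)
          = (\<integral>\<^sup>+t. (ennreal (2 ^ ?N) * F w) * (ennreal ((1 - norm w / t) powr b) * indicator {1/2..1} t * indicator {norm w<..} t) \<partial>lborel)"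
        by (simp add: P_def mult.assoc del: DIM_cart)
      also have "\<dots> = (ennreal (2 ^ ?N) * F w) * (\<integral>\<^sup>+t. ennreal ((1 - norm w / t) powr b) * indicator {1/2..1} t * indicator {norm w<..} t \<partial>lborel)"
        by (rule nn_integral_cmult) measurable
      also have "\<dots> \<le> (ennreal (2 ^ ?N) * F w) * ennreal (c * (1 - norm w) powr (b + 1))"
        unfolding c_def by (intro mult_left_mono nn_integral_radial_kernel_le b True) auto
      also have "\<dots> = ennreal (2 ^ ?N * c) * (F w * ennreal ((1 - norm w) powr (b + 1)) * indicator (ball 0 1) w)"
        using True c by (simp add: ennreal_mult mult_ac del: DIM_cart)
      finally show ?thesis .
    next
      case False
      have "P w t = 0" for t using False by (auto simp: P_def indicator_def)
      then show ?thesis by simp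
    qed
  qed
  also have "\<dots> = ennreal (2 ^ ?N * c) * (\<integral>\<^sup>+w. F w * ennreal ((1 - norm w) powr (b + 1)) * indicator (ball 0 1) w \<partial>lborel)"
    unfolding ind by (rule nn_integral_cmult) measurable
  finally show ?thesis unfolding c_def .
qed

text \<open>
  The preceding lemma for the constant function 1: it raises the exponent to \<open>b + 1 > 0\<close>, and then the
  weight is bounded.
\<close>

lemma ball_weight_finite:
  fixes b :: real
  assumes b: "b > -1"
  shows "(\<integral>\<^sup>+(z :: complex ^ 'n). ennreal ((1 - norm z) powr b) * indicator (ball 0 1) z \<partial>lborel) < \<infinity>"
proof -
  have ind: "indicator (ball 0 1) z = (indicator {..<1} (norm z) :: ennreal)" for z :: "complex ^ 'n"
    by (auto simp: indicator_def)
  let ?w = "\<lambda>z :: complex ^ 'n. ennreal ((1 - norm z) powr b) * indicator (ball 0 1) z"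
  have [measurable]: "?w \<in> borel_measurable lborel" unfolding ind by measurable
  have "ennreal (1 / 2) * (\<integral>\<^sup>+z. ?w z \<partial>lborel) = (\<integral>\<^sup>+z. ennreal (1 / 2) * ?w z \<partial>lborel)"
    by (rule nn_integral_cmult[symmetric]) measurable
  also have "\<dots> = (\<integral>\<^sup>+(z :: complex ^ 'n). (\<integral>\<^sup>+t. 1 * ennreal ((1 - norm z) powr b) * indicator {1/2..1 :: real} t * indicator (ball 0 1) z \<partial>lborel) \<partial>lborel)"
    by (intro nn_integral_cong) (simp add: nn_integral_multc nn_integral_cmult mult_ac)
  also have "\<dots> \<le> ennreal (2 ^ DIM(complex ^ 'n) * (2 powr \<bar>b\<bar> / (b + 1)))
      * (\<integral>\<^sup>+(w :: complex ^ 'n). 1 * ennreal ((1 - norm w) powr (b + 1)) * indicator (ball 0 1) w \<partial>lborel)"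
    by (rule nn_integral_dilation_le[OF b]) simp
  also have "(\<integral>\<^sup>+(w :: complex ^ 'n). 1 * ennreal ((1 - norm w) powr (b + 1)) * indicator (ball 0 1) w \<partial>lborel)
      \<le> (\<integral>\<^sup>+(w :: complex ^ 'n). indicator (ball 0 1) w \<partial>lborel)"
    using b by (intro nn_integral_mono) (auto simp: indicator_def intro!: powr_le1)
  also have "\<dots> = emeasure lborel (ball (0 :: complex ^ 'n) 1)"
    by (intro nn_integral_indicator) simp
  finally have "ennreal (1 / 2) * (\<integral>\<^sup>+z. ?w z \<partial>lborel) \<le> ennreal (2 ^ DIM(complex ^ 'n) * (2 powr \<bar>b\<bar> / (b + 1)))
      * emeasure lborel (ball (0 :: complex ^ 'n) 1)"
    by (simp add: mult_left_mono)
  also have "\<dots> < \<infinity>"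
    using emeasure_lborel_ball_finite[of "0 :: complex ^ 'n" 1] by (simp add: ennreal_mult_less_top del: DIM_cart)
  finally show ?thesis by (auto simp: ennreal_mult_less_top)
qed

text \<open>
  The total mass of the kernel in the Hardy inequality.  The bound \<open>2 (1 - t r) \<ge> (1 - t) + (1 - r)\<close> makes
  the integrand explicit, with constants that do not degenerate as \<open>r\<close> tends to 0.
\<close>

lemma integral_radial_power_le:
  fixes q r :: real
  assumes q: "q > 1" and r: "0 \<le> r" "r < 1"
  shows "integral {1/2..1} (\<lambda>t. (1 - t * r) powr - q) \<le> 2 powr q / (q - 1) * (1 - r) powr (1 - q)"
proof -
  have pos: "1 - t * r > 0" if "t \<le> 1" for t
  proof -
    have "t * r \<le> 1 * r" using that r by (intro mult_right_mono) auto
    then show ?thesis using r by simp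
  qed
  have ftc: "((\<lambda>t. (2 - t - r) powr - q) has_integral
      ((2 - 1 - r) powr (1 - q) / (q - 1) - (2 - 1/2 - r) powr (1 - q) / (q - 1))) {1/2..1}"
  proof (rule fundamental_theorem_of_calculus)
    fix t :: real assume "t \<in> {1/2..1}"
    then have "2 - t - r > 0" using r by auto
    then have "((\<lambda>t. (2 - t - r) powr (1 - q)) has_real_derivative (q - 1) * (2 - t - r) powr - q) (at t within {1/2..1})"
      by (auto intro!: derivative_eq_intros simp: algebra_simps)
    from DERIV_cdivide[OF this, of "q - 1"]
    show "((\<lambda>t. (2 - t - r) powr (1 - q) / (q - 1)) has_vector_derivative (2 - t - r) powr - q) (at t within {1/2..1})"
      unfolding has_real_derivative_iff_has_vector_derivative[symmetric]
      using q by simp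
  qed simp
  have "integral {1/2..1} (\<lambda>t. (1 - t * r) powr - q) \<le> integral {1/2..1} (\<lambda>t. 2 powr q * (2 - t - r) powr - q)"
  proof (rule integral_le)
    show "(\<lambda>t. (1 - t * r) powr - q) integrable_on {1/2..1}"
      using pos by (intro integrable_continuous_interval continuous_intros) (force simp: less_le)+
    show "(\<lambda>t. 2 powr q * (2 - t - r) powr - q) integrable_on {1/2..1}"
      using ftc by (intro integrable_on_mult_right) (auto simp: integrable_on_def)
    fix t :: real assume t: "t \<in> {1/2..1}"
    have "t * r \<le> 1 * r" "t * r \<le> t * 1" using t r by (intro mult_right_mono mult_left_mono; simp)+
    then have "(2 - t - r) / 2 \<le> 1 - t * r" by simp
    then have "(1 - t * r) powr - q \<le> ((2 - t - r) / 2) powr - q"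
      using t r q by (intro powr_mono2') auto
    also have "\<dots> = 2 powr q * (2 - t - r) powr - q"
      using t r by (simp add: powr_divide powr_minus_divide)
    finally show "(1 - t * r) powr - q \<le> 2 powr q * (2 - t - r) powr - q" .
  qed
  also have "\<dots> = 2 powr q * ((1 - r) powr (1 - q) / (q - 1) - (2 - 1/2 - r) powr (1 - q) / (q - 1))"
    using ftc by (simp only: integral_mult_right) (simp add: integral_unique)
  also have "\<dots> \<le> 2 powr q * ((1 - r) powr (1 - q) / (q - 1))"
    using q by (intro mult_left_mono) auto
  finally show ?thesis by simp
qed

section \<open>The radial derivative controls the gradient\<close>

text \<open>
  The fundamental theorem of calculus for \<open>t \<partial>\<^sub>j g(tz)\<close>, whose derivative is \<open>\<partial>\<^sub>j(Rg)(tz)\<close> because second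
  derivatives commute.
\<close>

lemma partial_deriv_radial_representation:
  fixes g :: "complex ^ 'n \<Rightarrow> complex"
  assumes g: "holomorphic_ball g" and z: "norm z < 1"
  shows "((\<lambda>t. partial_deriv j (radial_deriv g) (t *\<^sub>R z)) has_integral partial_deriv j g z) {0..1}"
proof -
  have der: "((\<lambda>t. of_real t * partial_deriv j g (t *\<^sub>R z)) has_vector_derivative partial_deriv j (radial_deriv g) (t *\<^sub>R z)) (at t within {0..1})"
    if t: "t \<in> {0..1}" for t :: real
  proof -
    have tz: "t *\<^sub>R z \<in> ball 0 1"
      using t z mult_left_le_one_le[of "norm z" t] by simp
    have "((\<lambda>t. partial_deriv j g (t *\<^sub>R z)) has_derivative
        (\<lambda>s. \<Sum>k\<in>UNIV. (s *\<^sub>R z) $ k * partial_deriv k (partial_deriv j g) (t *\<^sub>R z))) (at t within {0..1})"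
      by (rule has_derivative_compose[where f="\<lambda>t. t *\<^sub>R z" and g="partial_deriv j g", OF _ holomorphic_ball_has_derivative[OF holomorphic_ball_partial_deriv[OF g] tz]])
        (auto intro!: derivative_eq_intros)
    then have "((\<lambda>t. partial_deriv j g (t *\<^sub>R z)) has_vector_derivative
        (\<Sum>k\<in>UNIV. z $ k * partial_deriv k (partial_deriv j g) (t *\<^sub>R z))) (at t within {0..1})"
      by (simp add: has_vector_derivative_def scaleR_sum_right)
    from has_vector_derivative_scaleR[OF DERIV_ident this]
    have "((\<lambda>t. t *\<^sub>R partial_deriv j g (t *\<^sub>R z)) has_vector_derivative
        t *\<^sub>R (\<Sum>k\<in>UNIV. z $ k * partial_deriv k (partial_deriv j g) (t *\<^sub>R z)) + partial_deriv j g (t *\<^sub>R z)) (at t within {0..1})"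
      by simp
    also have "t *\<^sub>R (\<Sum>k\<in>UNIV. z $ k * partial_deriv k (partial_deriv j g) (t *\<^sub>R z)) + partial_deriv j g (t *\<^sub>R z)
        = partial_deriv j (radial_deriv g) (t *\<^sub>R z)"
      by (simp add: partial_deriv_radial_deriv[OF g tz] scaleR_sum_right)
    finally show ?thesis by (simp add: scaleR_conv_of_real)
  qed
  have "((\<lambda>t. partial_deriv j (radial_deriv g) (t *\<^sub>R z)) has_integral
      (of_real 1 * partial_deriv j g (1 *\<^sub>R z) - of_real 0 * partial_deriv j g (0 *\<^sub>R z))) {0..1}"
    by (rule fundamental_theorem_of_calculus) (use der in auto)
  then show ?thesis by simp
qed

text \<open>
  The integral representation is split at \<open>t = 1/2\<close>.  The first half stays in a compact part of the ball, where
  \<open>\<partial>\<^sub>j(Rg)\<close> is bounded by \<open>S\<close>; the second half is estimated by Hoelder's inequality with the kernel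
  \<open>(1 - t\<bar>z\<bar>)^(-q)\<close>.
\<close>

lemma partial_deriv_pointwise_radial_bound:
  fixes g :: "complex ^ 'n \<Rightarrow> complex" and p q S :: real
  assumes g: "holomorphic_ball g" and p: "p > 1" and q: "q > 1" and z: "norm z < 1"
    and S: "\<And>w. norm w \<le> 1/2 \<Longrightarrow> norm (partial_deriv j (radial_deriv g) w) \<le> S"
  shows "norm (partial_deriv j g z) powr p \<le> 2 powr p * (S powr p
    + (2 powr q / (q - 1)) powr (p - 1) * (1 - norm z) powr ((1 - q) * (p - 1))
      * integral {1/2..1} (\<lambda>t. norm (partial_deriv j (radial_deriv g) (t *\<^sub>R z)) powr p * (1 - norm (t *\<^sub>R z)) powr (q * (p - 1))))"
    (is "_ \<le> 2 powr p * (S powr p + ?c * ?J)")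
  and "continuous_on {1/2..1} (\<lambda>t. norm (partial_deriv j (radial_deriv g) (t *\<^sub>R z)) powr p * (1 - norm (t *\<^sub>R z)) powr (q * (p - 1)))"
proof -
  define u where "u t = partial_deriv j (radial_deriv g) (t *\<^sub>R z)" for t
  have tz: "norm (t *\<^sub>R z) < 1" if "t \<in> {0..1}" for t
    using that z mult_left_le_one_le[of "norm z" t] by simp
  have tz': "1 - t * norm z > 0" if "t \<in> {1/2..1}" for t
    using tz[of t] that by simp
  have u: "continuous_on {0..1} u"
    unfolding u_def using tz
    by (intro continuous_on_compose2[OF partial_deriv_continuous_on[OF holomorphic_ball_radial_deriv[OF g]]] continuous_intros) auto
  have u1: "continuous_on {1/2..1} u" by (rule continuous_on_subset[OF u]) auto
  have S0: "S \<ge> 0" by (rule order_trans[OF norm_ge_zero S[of 0]]) simp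
  define K where "K = 2 powr q / (q - 1) * (1 - norm z) powr (1 - q)"
  have K: "K > 0" using q z by (simp add: K_def)
  define k where "k t = (1 - t * norm z) powr - q" for t
  have kc: "continuous_on {1/2..1} k"
    unfolding k_def by (intro continuous_intros) (use tz'[THEN less_imp_neq] in auto)
  show "continuous_on {1/2..1} (\<lambda>t. norm (partial_deriv j (radial_deriv g) (t *\<^sub>R z)) powr p * (1 - norm (t *\<^sub>R z)) powr (q * (p - 1)))"
    using u1 p q tz[unfolded norm_scaleR]
    by (intro continuous_intros continuous_on_powr') (auto simp: u_def[symmetric] less_imp_le)
  have "partial_deriv j g z = integral {0..1} u"
    using partial_deriv_radial_representation[OF g z, of j] by (simp add: u_def[abs_def] integral_unique)
  also have "\<dots> = integral {0..1/2} u + integral {1/2..1} u"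
    using u by (intro Henstock_Kurzweil_Integration.integral_combine[symmetric] integrable_continuous_interval) auto
  finally have "norm (partial_deriv j g z) \<le> norm (integral {0..1/2} u) + norm (integral {1/2..1} u)"
    by (simp add: norm_triangle_ineq)
  moreover have "norm (integral {0..1/2} u) \<le> S * (1/2 - 0)"
  proof (rule integral_bound)
    show "norm (u t) \<le> S" if "t \<in> {0..1/2}" for t
    proof -
      have "norm (t *\<^sub>R z) \<le> 1/2 * 1" using that z unfolding norm_scaleR by (intro mult_mono) auto
      then show ?thesis unfolding u_def by (intro S) simp
    qed
  qed (auto intro: continuous_on_subset[OF u])
  moreover have "norm (integral {1/2..1} u) \<le> integral {1/2..1} (\<lambda>t. norm (u t))"
    using u1 by (intro integral_norm_bound_integral integrable_continuous_interval continuous_intros) auto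
  ultimately have le: "norm (partial_deriv j g z) \<le> S + integral {1/2..1} (\<lambda>t. norm (u t))"
    using S0 by simp
  have int0: "integral {1/2..1} (\<lambda>t. norm (u t)) \<ge> 0"
    by (intro integral_nonneg integrable_continuous_interval continuous_intros u1) auto
  have "integral {1/2..1} (\<lambda>t. norm (u t)) powr p
      \<le> K powr (p - 1) * integral {1/2..1} (\<lambda>t. norm (u t) powr p * k t powr (1 - p))"
  proof (rule weighted_hoelder[OF p _ _ kc _ K])
    show "integral {1/2..1} k \<le> K"
      unfolding K_def k_def by (rule integral_radial_power_le[OF q]) (use z in auto)
    show "k t > 0" if "t \<in> {1/2..1}" for t using tz'[OF that] by (simp add: k_def)
  qed (auto intro!: continuous_intros u1)
  also have "integral {1/2..1} (\<lambda>t. norm (u t) powr p * k t powr (1 - p)) = ?J"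
    by (intro Henstock_Kurzweil_Integration.integral_cong)
      (use tz in \<open>auto simp: u_def k_def powr_powr algebra_simps\<close>)
  also have "K powr (p - 1) = ?c"
    unfolding K_def by (subst powr_mult) (use q z in \<open>simp_all add: powr_powr\<close>)
  finally have J: "integral {1/2..1} (\<lambda>t. norm (u t)) powr p \<le> ?c * ?J" .
  have "norm (partial_deriv j g z) powr p \<le> (S + integral {1/2..1} (\<lambda>t. norm (u t))) powr p"
    using le p by (intro powr_mono2) auto
  also have "\<dots> \<le> 2 powr p * (S powr p + integral {1/2..1} (\<lambda>t. norm (u t)) powr p)"
    by (rule sum_two_powr_le[OF p S0 int0])
  also have "\<dots> \<le> 2 powr p * (S powr p + ?c * ?J)"
    using J by (intro mult_left_mono) auto
  finally show "norm (partial_deriv j g z) powr p \<le> 2 powr p * (S powr p + ?c * ?J)" .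
qed

text \<open>
  Integrating the pointwise bound and averaging over dilations leaves the Bergman integral of \<open>\<partial>\<^sub>j(Rg)\<close> with
  exponent \<open>p + a\<close>; the Cauchy estimate for \<open>Rg\<close> brings the exponent back to \<open>a\<close>.  The same integral
  bounds the values of \<open>\<partial>\<^sub>j(Rg)\<close> near the origin.
\<close>

lemma bergman_partial_deriv_le_radial_deriv:
  fixes p a :: real
  assumes p: "p > 1" and a: "a > -1"
  shows "\<exists>C>0. \<forall>g. holomorphic_ball g \<longrightarrow>
    bergman_integral p a (partial_deriv j g) \<le> ennreal C * bergman_integral p a (radial_deriv (g :: complex ^ 'n \<Rightarrow> complex))"
proof -
  \<comment> \<open>The exponent q must exceed 1 for the kernel to have mass of order \<open>(1 - \<bar>z\<bar>)^(1 - q)\<close>, and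
     (q - 1) (p - 1) must stay below a + 1, so that the exponent b left to the weight exceeds -1.
     The choice q - 1 = r / (p - 1) is halfway.\<close>
  define r where "r = (a + 1) / 2"
  define q where "q = 1 + r / (p - 1)"
  define b where "b = (a - 1) / 2"
  have q: "q > 1" using p a by (simp add: q_def r_def)
  have b: "b > -1" using a by (simp add: b_def)
  have "(q - 1) * (p - 1) = r" using p by (simp add: q_def)
  then have qp: "(q - 1) * (p - 1) = (a + 1) / 2" by (simp add: r_def)
  have exp1: "a + (1 - q) * (p - 1) = b"
    using qp by (simp add: b_def algebra_simps)
  \<comment> \<open>The powers lost to Hoelder's inequality and gained by the dilations add up to p.\<close>
  have exp2: "q * (p - 1) + (b + 1) = p + a"
  proof -
    have "q * (p - 1) = (q - 1) * (p - 1) + (p - 1)" by (simp add: algebra_simps)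
    then show ?thesis unfolding qp by (simp add: b_def field_simps)
  qed
  let ?M = "p + a + DIM(complex ^ 'n)"
  obtain C1 where C1: "C1 > 0" "\<And>h w. holomorphic_ball h \<Longrightarrow> norm w < 1 \<Longrightarrow>
      ennreal (norm (partial_deriv j h w) powr p * (1 - norm w) powr ?M) \<le> ennreal C1 * bergman_integral p a (h :: complex ^ 'n \<Rightarrow> complex)"
    using bergman_partial_deriv_point_bound[OF p, where 'n='n and j=j and a=a] by blast
  obtain C3 where C3: "C3 > 0" "\<And>h. holomorphic_ball h \<Longrightarrow>
      bergman_integral p (p + a) (partial_deriv j h) \<le> ennreal C3 * bergman_integral p a (h :: complex ^ 'n \<Rightarrow> complex)"
    using bergman_partial_deriv_le[OF p, where 'n='n and j=j and a=a] by blast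
  define C2 where "C2 = 2 ^ DIM(complex ^ 'n) * (2 powr \<bar>b\<bar> / (b + 1))"
  have C2: "C2 > 0" using b by (simp add: C2_def)
  define \<kappa> where "\<kappa> = (2 powr q / (q - 1)) powr (p - 1)"
  have \<kappa>: "\<kappa> > 0" using q by (simp add: \<kappa>_def)
  obtain W where W: "W \<ge> 0" "(\<integral>\<^sup>+(z :: complex ^ 'n). ennreal ((1 - norm z) powr a) * indicator (ball 0 1) z \<partial>lborel) = ennreal W"
    using ball_weight_finite[OF a, where 'n='n]
    by (cases "\<integral>\<^sup>+(z :: complex ^ 'n). ennreal ((1 - norm z) powr a) * indicator (ball 0 1) z \<partial>lborel") auto
  \<comment> \<open>C1 and W bound the contribution of \<open>t \<le> 1/2\<close>; \<kappa>, C2 and C3 stem from Hoelder's inequality,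
     the dilations and the Cauchy estimate.\<close>
  define C where "C = 2 powr p * (2 powr ?M * C1) * W + 2 powr p * \<kappa> * (C2 * C3)"
  have "2 powr p * \<kappa> * (C2 * C3) > 0" using \<kappa> C2 C3(1) by simp
  moreover have "2 powr p * (2 powr ?M * C1) * W \<ge> 0" using C1(1) W(1) by simp
  ultimately have C: "C > 0" unfolding C_def by linarith
  have "bergman_integral p a (partial_deriv j g) \<le> ennreal C * bergman_integral p a (radial_deriv g)"
    if g: "holomorphic_ball g" for g :: "complex ^ 'n \<Rightarrow> complex"
  proof (cases "bergman_integral p a (radial_deriv g)")
    case top
    then show ?thesis using C by (simp add: ennreal_mult_top)
  next
    case (real i)
    define h where "h = radial_deriv g"
    have h: "holomorphic_ball h" unfolding h_def by (rule holomorphic_ball_radial_deriv[OF g])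
    define F where "F w = ennreal (norm (partial_deriv j h w) powr p * (1 - norm w) powr (q * (p - 1))) * indicator (ball 0 1) w" for w
    have [measurable]: "F \<in> borel_measurable borel"
      unfolding F_def by (rule borel_measurable_norm_powr_ball[OF partial_deriv_continuous_on[OF h]])
    have ind: "indicator (ball 0 1) z = (indicator {..<1} (norm z) :: ennreal)" for z :: "complex ^ 'n"
      by (auto simp: indicator_def)
    \<comment> \<open>For \<open>\<bar>w\<bar> \<le> 1/2\<close> the weight in the point bound is at least \<open>2 powr (- ?M)\<close>.\<close>
    define S where "S = (2 powr ?M * C1 * i) powr (1 / p)"
    have Sp: "S powr p = 2 powr ?M * C1 * i"
      using p C1(1) real(1) by (simp add: S_def powr_powr)
    have S: "norm (partial_deriv j h w) \<le> S" if w: "norm w \<le> 1/2" for w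
    proof -
      have "ennreal (norm (partial_deriv j h w) powr p * (1 - norm w) powr ?M) \<le> ennreal (C1 * i)"
        using C1(2)[OF h, of w] w real C1(1) by (simp add: h_def ennreal_mult del: DIM_cart)
      then have *: "norm (partial_deriv j h w) powr p * (1 - norm w) powr ?M \<le> C1 * i"
        using C1(1) real(1) by (simp del: DIM_cart)
      have "(1/2) powr ?M \<le> (1 - norm w) powr ?M"
        using w a p by (intro powr_mono2) auto
      then have "norm (partial_deriv j h w) powr p * (1/2) powr ?M \<le> norm (partial_deriv j h w) powr p * (1 - norm w) powr ?M"
        by (intro mult_left_mono) auto
      with * have "norm (partial_deriv j h w) powr p * (1/2) powr ?M \<le> C1 * i" by linarith
      then have "2 powr ?M * (norm (partial_deriv j h w) powr p * (1/2) powr ?M) \<le> 2 powr ?M * (C1 * i)"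
        by (intro mult_left_mono) auto
      then have "norm (partial_deriv j h w) powr p \<le> 2 powr ?M * C1 * i"
        by (simp add: powr_divide mult_ac del: DIM_cart)
      then have "(norm (partial_deriv j h w) powr p) powr (1 / p) \<le> S"
        unfolding S_def using p by (intro powr_mono2) auto
      then show ?thesis using p by (simp add: powr_powr)
    qed
    define T where "T z = (\<integral>\<^sup>+t. F (t *\<^sub>R z) * ennreal ((1 - norm z) powr b) * indicator {1/2..1} t * indicator (ball 0 1) z \<partial>lborel)" for z
    have [measurable]: "T \<in> borel_measurable borel"
      unfolding T_def ind by measurable
    have "bergman_integral p a (partial_deriv j g) \<le>
        (\<integral>\<^sup>+z. ennreal (2 powr p * (2 powr ?M * C1 * i)) * (ennreal ((1 - norm z) powr a) * indicator (ball 0 1) z)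
          + ennreal (2 powr p * \<kappa>) * T z \<partial>lborel)"
      unfolding bergman_integral_def
    proof (rule nn_integral_mono)
      fix z :: "complex ^ 'n"
      show "ennreal (norm (partial_deriv j g z) powr p * (1 - norm z) powr a) * indicator (ball 0 1) z
          \<le> ennreal (2 powr p * (2 powr ?M * C1 * i)) * (ennreal ((1 - norm z) powr a) * indicator (ball 0 1) z)
          + ennreal (2 powr p * \<kappa>) * T z"
      proof (cases "norm z < 1")
        case True
        define J where "J = integral {1/2..1} (\<lambda>t. norm (partial_deriv j h (t *\<^sub>R z)) powr p * (1 - norm (t *\<^sub>R z)) powr (q * (p - 1)))"
        have tz: "norm (t *\<^sub>R z) < 1" if "t \<in> {1/2..1}" for t
          using that True mult_left_le_one_le[of "norm z" t] by simp
        have cont: "continuous_on {1/2..1} (\<lambda>t. norm (partial_deriv j h (t *\<^sub>R z)) powr p * (1 - norm (t *\<^sub>R z)) powr (q * (p - 1)))"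
          unfolding h_def by (rule partial_deriv_pointwise_radial_bound(2)[OF g p q True]) (use S in \<open>simp add: h_def\<close>)
        have J0: "J \<ge> 0"
          unfolding J_def by (intro integral_nonneg integrable_continuous_interval cont) auto
        have "T z = (\<integral>\<^sup>+t. ennreal ((1 - norm z) powr b) * (ennreal (norm (partial_deriv j h (t *\<^sub>R z)) powr p * (1 - norm (t *\<^sub>R z)) powr (q * (p - 1))) * indicator {1/2..1} t) \<partial>lborel)"
          unfolding T_def
        proof (rule nn_integral_cong)
          fix t :: real
          show "F (t *\<^sub>R z) * ennreal ((1 - norm z) powr b) * indicator {1/2..1} t * indicator (ball 0 1) z
            = ennreal ((1 - norm z) powr b) * (ennreal (norm (partial_deriv j h (t *\<^sub>R z)) powr p * (1 - norm (t *\<^sub>R z)) powr (q * (p - 1))) * indicator {1/2..1} t)"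
            using True tz[of t] by (cases "t \<in> {1/2..1}") (simp_all add: F_def mult_ac)
        qed
        also have "\<dots> = ennreal ((1 - norm z) powr b) * (\<integral>\<^sup>+t. ennreal (norm (partial_deriv j h (t *\<^sub>R z)) powr p * (1 - norm (t *\<^sub>R z)) powr (q * (p - 1))) * indicator {1/2..1} t \<partial>lborel)"
        proof (rule nn_integral_cmult)
          have "(\<lambda>t. F (t *\<^sub>R z) * indicator {1/2..1} t) \<in> borel_measurable lborel" by measurable
          also have "(\<lambda>t. F (t *\<^sub>R z) * indicator {1/2..1} t) = (\<lambda>t. ennreal (norm (partial_deriv j h (t *\<^sub>R z)) powr p * (1 - norm (t *\<^sub>R z)) powr (q * (p - 1))) * indicator {1/2..1} t)"
            using tz by (auto simp: F_def indicator_def fun_eq_iff)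
          finally show "(\<lambda>t. ennreal (norm (partial_deriv j h (t *\<^sub>R z)) powr p * (1 - norm (t *\<^sub>R z)) powr (q * (p - 1))) * indicator {1/2..1} t) \<in> borel_measurable lborel" .
        qed
        also have "(\<integral>\<^sup>+t. ennreal (norm (partial_deriv j h (t *\<^sub>R z)) powr p * (1 - norm (t *\<^sub>R z)) powr (q * (p - 1))) * indicator {1/2..1} t \<partial>lborel) = ennreal J"
          unfolding J_def
          by (intro nn_integral_has_integral_lebesgue' integrable_integral integrable_continuous_interval cont) auto
        finally have T: "T z = ennreal ((1 - norm z) powr b * J)"
          using J0 by (simp add: ennreal_mult)
        have db: "(1 - norm z) powr b = (1 - norm z) powr a * (1 - norm z) powr ((1 - q) * (p - 1))"
          unfolding exp1[symmetric] by (rule powr_add)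
        have "norm (partial_deriv j g z) powr p \<le> 2 powr p * (S powr p + \<kappa> * (1 - norm z) powr ((1 - q) * (p - 1)) * J)"
          unfolding \<kappa>_def J_def h_def
          by (rule partial_deriv_pointwise_radial_bound(1)[OF g p q True]) (use S in \<open>simp add: h_def\<close>)
        then have "norm (partial_deriv j g z) powr p * (1 - norm z) powr a
            \<le> 2 powr p * (S powr p + \<kappa> * (1 - norm z) powr ((1 - q) * (p - 1)) * J) * (1 - norm z) powr a"
          by (rule mult_right_mono) simp
        also have "\<dots> = 2 powr p * (2 powr ?M * C1 * i) * (1 - norm z) powr a + 2 powr p * \<kappa> * ((1 - norm z) powr b * J)"
          unfolding Sp db by (simp add: distrib_left distrib_right mult_ac del: DIM_cart)
        finally have "ennreal (norm (partial_deriv j g z) powr p * (1 - norm z) powr a)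
            \<le> ennreal (2 powr p * (2 powr ?M * C1 * i) * (1 - norm z) powr a + 2 powr p * \<kappa> * ((1 - norm z) powr b * J))"
          by (rule ennreal_leI)
        also have "\<dots> = ennreal (2 powr p * (2 powr ?M * C1 * i)) * ennreal ((1 - norm z) powr a) + ennreal (2 powr p * \<kappa>) * T z"
          using C1(1) real(1) \<kappa> J0 unfolding T by (subst ennreal_plus) (simp_all add: ennreal_mult del: DIM_cart)
        finally show ?thesis using True by simp
      qed simp
    qed
    also have "\<dots> = ennreal (2 powr p * (2 powr ?M * C1 * i)) * (\<integral>\<^sup>+(z :: complex ^ 'n). ennreal ((1 - norm z) powr a) * indicator (ball 0 1) z \<partial>lborel)
        + ennreal (2 powr p * \<kappa>) * (\<integral>\<^sup>+z. T z \<partial>lborel)"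
      unfolding ind by (subst nn_integral_add) (simp_all add: nn_integral_cmult del: DIM_cart)
    also have "\<dots> \<le> ennreal (2 powr p * (2 powr ?M * C1 * i)) * ennreal W + ennreal (2 powr p * \<kappa>) * ennreal (C2 * C3 * i)"
    proof (intro add_mono mult_left_mono)
      have "(\<integral>\<^sup>+z. T z \<partial>lborel) \<le> ennreal C2 * (\<integral>\<^sup>+w. F w * ennreal ((1 - norm w) powr (b + 1)) * indicator (ball 0 1) w \<partial>lborel)"
        unfolding T_def C2_def by (rule nn_integral_dilation_le[OF b]) simp
      also have "(\<integral>\<^sup>+w. F w * ennreal ((1 - norm w) powr (b + 1)) * indicator (ball 0 1) w \<partial>lborel) = bergman_integral p (p + a) (partial_deriv j h)"
        unfolding bergman_integral_def F_def exp2[symmetric]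
        by (intro nn_integral_cong) (auto simp: indicator_def ennreal_mult[symmetric] powr_add mult.assoc)
      also have "ennreal C2 * bergman_integral p (p + a) (partial_deriv j h) \<le> ennreal C2 * (ennreal C3 * ennreal i)"
        using C3(2)[OF h] real(2) by (intro mult_left_mono) (auto simp: h_def)
      also have "\<dots> = ennreal (C2 * C3 * i)"
        using C2 C3(1) real(1) by (simp add: ennreal_mult[symmetric] mult.assoc)
      finally show "(\<integral>\<^sup>+z. T z \<partial>lborel) \<le> ennreal (C2 * C3 * i)" .
    qed (auto simp: W)
    also have "\<dots> = ennreal C * ennreal i"
      using C1(1) W(1) \<kappa> C2 C3(1) real(1) C unfolding C_def
      by (simp add: ennreal_mult[symmetric] ennreal_plus[symmetric] algebra_simps del: DIM_cart ennreal_plus)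
    finally show ?thesis using real by simp
  qed
  then show ?thesis using C by blast
qed

lemma bergman_partial_derivs_le_radial_deriv:
  fixes p a :: real
  assumes "p > 1" "a > -1"
  obtains C where "C > 0" "\<And>j g. holomorphic_ball (g :: complex ^ 'n \<Rightarrow> complex) \<Longrightarrow>
    bergman_integral p a (partial_deriv j g) \<le> ennreal C * bergman_integral p a (radial_deriv g)"
proof -
  have "\<forall>j. \<exists>C>0. \<forall>g. holomorphic_ball g \<longrightarrow>
      bergman_integral p a (partial_deriv j g) \<le> ennreal C * bergman_integral p a (radial_deriv (g :: complex ^ 'n \<Rightarrow> complex))"
    using bergman_partial_deriv_le_radial_deriv[OF assms] by blast
  then obtain c where c: "\<And>j. c j > 0" "\<And>j g. holomorphic_ball g \<Longrightarrow>
      bergman_integral p a (partial_deriv j g) \<le> ennreal (c j) * bergman_integral p a (radial_deriv (g :: complex ^ 'n \<Rightarrow> complex))"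
    by metis
  have le: "c j \<le> sum c UNIV" for j
    using c(1) by (intro member_le_sum) (auto intro: less_imp_le)
  show thesis
  proof
    show "sum c UNIV > 0" using c(1) le less_le_trans by blast
    show "bergman_integral p a (partial_deriv j g) \<le> ennreal (sum c UNIV) * bergman_integral p a (radial_deriv g)"
      if "holomorphic_ball g" for j and g :: "complex ^ 'n \<Rightarrow> complex"
      using c(2)[OF that, of j] mult_right_mono[OF ennreal_leI[OF le[of j]], of "bergman_integral p a (radial_deriv g)"]
      by (meson order_trans zero_le)
  qed
qed

section \<open>The Besov-Sobolev energy through the radial derivative\<close>

lemma nn_integral_density_ball_volume:
  fixes k u :: "complex ^ 'n \<Rightarrow> ennreal"
  assumes k: "(\<lambda>z. k z * indicator (ball 0 1) z) \<in> borel_measurable borel"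
    and u: "(\<lambda>z. u z * indicator (ball 0 1) z) \<in> borel_measurable borel"
  shows "(\<integral>\<^sup>+z. u z \<partial>density ball_volume_measure k)
    = ennreal (1 / measure lborel (ball (0 :: complex ^ 'n) 1)) * (\<integral>\<^sup>+z. k z * u z * indicator (ball 0 1) z \<partial>lborel)"
proof -
  let ?B = "ball (0 :: complex ^ 'n) 1" and ?M = "uniform_measure lborel (ball (0 :: complex ^ 'n) 1)"
  have V: "emeasure lborel ?B = ennreal (measure lborel ?B)"
    using emeasure_lborel_ball_finite[of "0 :: complex ^ 'n" 1] by (intro emeasure_eq_ennreal_measure) auto
  have V0: "measure lborel ?B > 0"
    using content_ball_pos[of 1 "0 :: complex ^ 'n"] by (simp add: measure_def)
  have meas: "f \<in> borel_measurable ball_volume_measure"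
    if "(\<lambda>z. f z * indicator ?B z) \<in> borel_measurable borel" for f :: "complex ^ 'n \<Rightarrow> ennreal"
    unfolding ball_volume_measure_def using that
    by (subst borel_measurable_restrict_space_iff_ennreal) (auto simp: measurable_def)
  have prod: "(\<lambda>z. k z * u z * indicator ?B z) \<in> borel_measurable borel"
  proof -
    have "(\<lambda>z. (k z * indicator ?B z) * (u z * indicator ?B z)) \<in> borel_measurable borel"
      using k u by (rule borel_measurable_times_ennreal)
    also have "(\<lambda>z. (k z * indicator ?B z) * (u z * indicator ?B z)) = (\<lambda>z. k z * u z * indicator ?B z)"
      by (auto simp: fun_eq_iff indicator_def)
    finally show ?thesis .
  qed
  have "(\<integral>\<^sup>+z. u z \<partial>density ball_volume_measure k) = (\<integral>\<^sup>+z. k z * u z \<partial>ball_volume_measure)"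
    by (rule nn_integral_density[OF meas[OF k] meas[OF u]])
  also have "\<dots> = (\<integral>\<^sup>+z. k z * u z * indicator ?B z \<partial>?M)"
    unfolding ball_volume_measure_def by (rule nn_integral_restrict_space) simp
  also have "\<dots> = (\<integral>\<^sup>+z. k z * u z * indicator ?B z * indicator ?B z \<partial>lborel) / emeasure lborel ?B"
    by (rule nn_integral_uniform_measure) (use prod in auto)
  also have "(\<integral>\<^sup>+z. k z * u z * indicator ?B z * indicator ?B z \<partial>lborel) = (\<integral>\<^sup>+z. k z * u z * indicator ?B z \<partial>lborel)"
    by (intro nn_integral_cong) (simp add: indicator_def)
  finally show ?thesis
    unfolding V using V0 by (simp add: divide_ennreal_def inverse_ennreal mult.commute divide_inverse)
qed

lemma defining_weight_comparable:
  fixes z :: "'a::real_normed_vector" and a :: real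
  assumes "norm z < 1"
  shows "(1 - (norm z)\<^sup>2) powr a \<le> 2 powr \<bar>a\<bar> * (1 - norm z) powr a"
    and "(1 - norm z) powr a \<le> 2 powr \<bar>a\<bar> * (1 - (norm z)\<^sup>2) powr a"
proof -
  have eq: "1 - (norm z)\<^sup>2 = (1 - norm z) * (1 + norm z)" by (simp add: power2_eq_square algebra_simps)
  have "(1 - norm z) * (1 + norm z) \<le> (1 - norm z) * 2" "(1 - norm z) * 1 \<le> (1 - norm z) * (1 + norm z)"
    using assms by (intro mult_left_mono; simp)+
  then have le: "1 - (norm z)\<^sup>2 \<le> 2 * (1 - norm z)" "1 - norm z \<le> 1 - (norm z)\<^sup>2" unfolding eq by auto
  have pos: "0 < 1 - norm z" using assms by simp
  have pos': "0 < 1 - (norm z)\<^sup>2" by (rule less_le_trans[OF pos le(2)])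
  have le': "1 - norm z \<le> 2 * (1 - (norm z)\<^sup>2)"
    using le(2) pos' by (simp add: field_simps)
  from le(1) le' pos pos' show "(1 - (norm z)\<^sup>2) powr a \<le> 2 powr \<bar>a\<bar> * (1 - norm z) powr a"
    and "(1 - norm z) powr a \<le> 2 powr \<bar>a\<bar> * (1 - (norm z)\<^sup>2) powr a"
    by (auto intro: powr_comparable)
qed

lemma bergman_defining_weight_le:
  fixes u :: "complex ^ 'n \<Rightarrow> 'b :: euclidean_space" and v :: "complex ^ 'n \<Rightarrow> complex"
  assumes u: "continuous_on (ball 0 1) u" and p: "p > 0"
    and le: "\<And>z. norm z < 1 \<Longrightarrow> norm (v z) \<le> norm (u z)"
  shows "bergman_integral p a v \<le> ennreal (2 powr \<bar>a\<bar>) *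
    (\<integral>\<^sup>+z. ennreal (norm (u z) powr p * (1 - (norm z)\<^sup>2) powr a) * indicator (ball 0 1) z \<partial>lborel)"
proof -
  have "bergman_integral p a v \<le> (\<integral>\<^sup>+z. ennreal (2 powr \<bar>a\<bar>) * (ennreal (norm (u z) powr p * (1 - (norm z)\<^sup>2) powr a) * indicator (ball 0 1) z) \<partial>lborel)"
    unfolding bergman_integral_def
  proof (rule nn_integral_mono)
    fix z :: "complex ^ 'n"
    show "ennreal (norm (v z) powr p * (1 - norm z) powr a) * indicator (ball 0 1) z
        \<le> ennreal (2 powr \<bar>a\<bar>) * (ennreal (norm (u z) powr p * (1 - (norm z)\<^sup>2) powr a) * indicator (ball 0 1) z)"
    proof (cases "norm z < 1")
      case True
      have "norm (v z) powr p * (1 - norm z) powr a \<le> norm (u z) powr p * (2 powr \<bar>a\<bar> * (1 - (norm z)\<^sup>2) powr a)"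
        using le[OF True] p defining_weight_comparable(2)[OF True, of a] by (intro mult_mono powr_mono2) auto
      then have "ennreal (norm (v z) powr p * (1 - norm z) powr a) \<le> ennreal (2 powr \<bar>a\<bar> * (norm (u z) powr p * (1 - (norm z)\<^sup>2) powr a))"
        by (intro ennreal_leI) (simp add: mult_ac)
      then show ?thesis using True by (simp add: ennreal_mult)
    qed simp
  qed
  also have "\<dots> = ennreal (2 powr \<bar>a\<bar>) * (\<integral>\<^sup>+z. ennreal (norm (u z) powr p * (1 - (norm z)\<^sup>2) powr a) * indicator (ball 0 1) z \<partial>lborel)"
    by (rule nn_integral_cmult) (use borel_measurable_norm_powr_sq_ball[OF u] in simp)
  finally show ?thesis .
qed

lemma sum_powr_le:
  fixes x :: "'a \<Rightarrow> real" and p :: real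
  assumes A: "finite A" and x: "\<And>i. i \<in> A \<Longrightarrow> x i \<ge> 0" and p: "p > 1"
  shows "sum x A powr p \<le> real (card A) powr p * (\<Sum>i\<in>A. x i powr p)"
proof -
  define T where "T = (\<Sum>i\<in>A. x i powr p)"
  have T: "T \<ge> 0" unfolding T_def by (intro sum_nonneg) auto
  have "x i \<le> T powr (1 / p)" if i: "i \<in> A" for i
  proof -
    have "x i powr p \<le> T" unfolding T_def using A i by (intro member_le_sum) auto
    then have "(x i powr p) powr (1 / p) \<le> T powr (1 / p)" using p by (intro powr_mono2) auto
    then show ?thesis using p x[OF i] by (simp add: powr_powr)
  qed
  then have "sum x A \<le> real (card A) * T powr (1 / p)" by (rule sum_bounded_above)
  then have "sum x A powr p \<le> (real (card A) * T powr (1 / p)) powr p"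
    using p x by (intro powr_mono2 sum_nonneg) auto
  also have "\<dots> = real (card A) powr p * T" using p T by (simp add: powr_mult powr_powr)
  finally show ?thesis by (simp add: T_def)
qed

lemma complex_gradient_continuous_on:
  assumes "holomorphic_ball f"
  shows "continuous_on (ball 0 1) (complex_gradient f)"
  unfolding complex_gradient_def[abs_def]
  by (intro continuous_on_vec_lambda partial_deriv_continuous_on assms)

text \<open>
  The exponent of \<open>1 - \<bar>z\<bar>\<^sup>2\<close> in the energy once it is written as an integral over Lebesgue measure:
  \<open>p (1 + \<sigma>)\<close> comes from the norm and \<open>- n - 1\<close> from the invariant measure.  The type argument
  carries the dimension \<open>n\<close>.
\<close>

definition besov_exponent :: "'n itself \<Rightarrow> real \<Rightarrow> real \<Rightarrow> real" where
  "besov_exponent (_ :: 'n itself) p \<sigma> = p + \<sigma> * p - real CARD('n) - 1"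

lemma besov_energy_eq:
  fixes f :: "complex ^ 'n \<Rightarrow> complex"
  assumes f: "holomorphic_ball f" and p: "p > 1"
  shows "besov_energy p \<sigma> f = ennreal (norm (f 0) powr p)
    + ennreal (1 / measure lborel (ball (0 :: complex ^ 'n) 1)) *
      (\<integral>\<^sup>+z. ennreal (norm (complex_gradient f z) powr p * (1 - (norm z)\<^sup>2) powr besov_exponent TYPE('n) p \<sigma>) * indicator (ball 0 1) z \<partial>lborel)"
proof -
  let ?k = "\<lambda>z :: complex ^ 'n. ennreal ((1 - (norm z)\<^sup>2) powr (- real CARD('n) - 1))"
  let ?u = "\<lambda>z. ennreal (((1 - (norm z)\<^sup>2) powr (1 + \<sigma>) * norm (complex_gradient f z)) powr p)"
  have sq: "(norm z)\<^sup>2 < 1" if "z \<in> ball 0 1" for z :: "complex ^ 'n"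
    using that by (simp add: power_less_one_iff)
  have u_eq: "?u z * indicator (ball 0 1) z = ennreal (norm (complex_gradient f z) powr p * (1 - (norm z)\<^sup>2) powr ((1 + \<sigma>) * p)) * indicator (ball 0 1) z" for z
    using sq[of z] by (cases "z \<in> ball 0 1") (auto simp: powr_mult powr_powr mult_ac)
  have "(\<integral>\<^sup>+z. ?u z \<partial>ball_invariant_measure) = ennreal (1 / measure lborel (ball (0 :: complex ^ 'n) 1)) *
      (\<integral>\<^sup>+z. ?k z * ?u z * indicator (ball 0 1) z \<partial>lborel)"
    unfolding ball_invariant_measure_def
  proof (rule nn_integral_density_ball_volume)
    show "(\<lambda>z. ?u z * indicator (ball 0 1) z) \<in> borel_measurable borel"
      unfolding u_eq by (rule borel_measurable_norm_powr_sq_ball[OF complex_gradient_continuous_on[OF f]])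
    have "(\<lambda>z :: complex ^ 'n. ennreal (norm (1 :: complex) powr 1 * (1 - (norm z)\<^sup>2) powr (- real CARD('n) - 1)) * indicator (ball 0 1) z) \<in> borel_measurable borel"
      by (rule borel_measurable_norm_powr_sq_ball) auto
    then show "(\<lambda>z. ?k z * indicator (ball 0 1) z) \<in> borel_measurable borel" by simp
  qed
  also have "(\<integral>\<^sup>+z. ?k z * ?u z * indicator (ball 0 1) z \<partial>lborel)
      = (\<integral>\<^sup>+z. ennreal (norm (complex_gradient f z) powr p * (1 - (norm z)\<^sup>2) powr besov_exponent TYPE('n) p \<sigma>) * indicator (ball 0 1) z \<partial>lborel)"
  proof (rule nn_integral_cong)
    fix z :: "complex ^ 'n"
    have e: "besov_exponent TYPE('n) p \<sigma> = (- real CARD('n) - 1) + (1 + \<sigma>) * p"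
      by (simp add: besov_exponent_def algebra_simps)
    have "?k z * ?u z * indicator (ball 0 1) z = ?k z * (ennreal (norm (complex_gradient f z) powr p * (1 - (norm z)\<^sup>2) powr ((1 + \<sigma>) * p)) * indicator (ball 0 1) z)"
      by (simp only: mult.assoc u_eq)
    also have "\<dots> = ennreal (norm (complex_gradient f z) powr p * (1 - (norm z)\<^sup>2) powr besov_exponent TYPE('n) p \<sigma>) * indicator (ball 0 1) z"
      unfolding e powr_add by (cases "z \<in> ball 0 1") (simp_all add: ennreal_mult[symmetric] mult_ac)
    finally show "?k z * ?u z * indicator (ball 0 1) z = ennreal (norm (complex_gradient f z) powr p * (1 - (norm z)\<^sup>2) powr besov_exponent TYPE('n) p \<sigma>) * indicator (ball 0 1) z" .
  qed
  finally show ?thesis by (simp add: besov_energy_def)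
qed

definition radial_energy :: "real \<Rightarrow> real \<Rightarrow> (complex ^ 'n \<Rightarrow> complex) \<Rightarrow> ennreal" where
  "radial_energy p a f = ennreal (norm (f 0) powr p) + bergman_integral p a (radial_deriv f)"

lemma ennreal_inverse_mult_cancel:
  assumes "V > 0" shows "x = ennreal V * (ennreal (1 / V) * x)"
  using assms by (simp add: mult.assoc[symmetric] ennreal_mult[symmetric])

lemma norm_radial_deriv_le_gradient:
  fixes f :: "complex ^ 'n \<Rightarrow> complex"
  assumes "norm z \<le> 1"
  shows "norm (radial_deriv f z) \<le> norm (complex_gradient f z)"
proof -
  have "norm (radial_deriv f z) \<le> (\<Sum>j\<in>UNIV. \<bar>norm (z $ j)\<bar> * \<bar>norm (complex_gradient f z $ j)\<bar>)"
    unfolding radial_deriv_def by (rule order_trans[OF norm_sum]) (simp add: norm_mult complex_gradient_def)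
  also have "\<dots> \<le> norm z * norm (complex_gradient f z)"
    unfolding norm_vec_def by (rule L2_set_mult_ineq)
  also have "\<dots> \<le> norm (complex_gradient f z)"
    using assms by (simp add: mult_left_le_one_le)
  finally show ?thesis .
qed

lemma radial_energy_le_besov_energy:
  assumes p: "p > 1"
  obtains C where "C > 0" "\<And>f :: complex ^ 'n \<Rightarrow> complex. holomorphic_ball f \<Longrightarrow>
    radial_energy p (besov_exponent TYPE('n) p \<sigma>) f \<le> ennreal C * besov_energy p \<sigma> f"
proof -
  let ?a = "besov_exponent TYPE('n) p \<sigma>" and ?V = "measure lborel (ball (0 :: complex ^ 'n) 1)"
  define C where "C = 1 + 2 powr \<bar>?a\<bar> * ?V"
  have V: "?V > 0" by (rule unit_ball_measure_pos)
  have C: "C \<ge> 1" "C \<ge> 2 powr \<bar>?a\<bar> * ?V" using V by (auto simp: C_def)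
  have "radial_energy p ?a f \<le> ennreal C * besov_energy p \<sigma> f" if f: "holomorphic_ball f" for f :: "complex ^ 'n \<Rightarrow> complex"
  proof -
    define J where "J = (\<integral>\<^sup>+z. ennreal (norm (complex_gradient f z) powr p * (1 - (norm z)\<^sup>2) powr ?a) * indicator (ball 0 1) z \<partial>lborel)"
    have "bergman_integral p ?a (radial_deriv f) \<le> ennreal (2 powr \<bar>?a\<bar>) * J"
      unfolding J_def by (rule bergman_defining_weight_le[OF complex_gradient_continuous_on[OF f]])
        (use p norm_radial_deriv_le_gradient[of _ f] in auto)
    also have "\<dots> = ennreal (2 powr \<bar>?a\<bar>) * (ennreal ?V * (ennreal (1 / ?V) * J))"
      using ennreal_inverse_mult_cancel[OF V, of J] by simp
    also have "\<dots> = ennreal (2 powr \<bar>?a\<bar> * ?V) * (ennreal (1 / ?V) * J)"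
      using V by (simp add: ennreal_mult mult.assoc)
    also have "\<dots> \<le> ennreal C * (ennreal (1 / ?V) * J)"
      by (intro mult_right_mono ennreal_leI C) simp
    finally have 1: "bergman_integral p ?a (radial_deriv f) \<le> ennreal C * (ennreal (1 / ?V) * J)" .
    have "1 * ennreal (norm (f 0) powr p) \<le> ennreal C * ennreal (norm (f 0) powr p)"
      using C(1) by (intro mult_right_mono) auto
    with 1 have "radial_energy p ?a f \<le> ennreal C * ennreal (norm (f 0) powr p) + ennreal C * (ennreal (1 / ?V) * J)"
      unfolding radial_energy_def by (intro add_mono) auto
    then show ?thesis
      by (simp add: besov_energy_eq[OF f p] J_def[symmetric] distrib_left)
  qed
  then show thesis using C(1) that[of C] by simp
qed

lemma besov_energy_le_radial_energy:
  assumes p: "p > 1" and a: "besov_exponent TYPE('n) p \<sigma> > -1"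
  obtains C where "C > 0" "\<And>f :: complex ^ 'n \<Rightarrow> complex. holomorphic_ball f \<Longrightarrow>
    besov_energy p \<sigma> f \<le> ennreal C * radial_energy p (besov_exponent TYPE('n) p \<sigma>) f"
proof -
  let ?a = "besov_exponent TYPE('n) p \<sigma>" and ?V = "measure lborel (ball (0 :: complex ^ 'n) 1)"
  let ?n = "real CARD('n)"
  have V: "?V > 0" by (rule unit_ball_measure_pos)
  obtain C1 where C1: "C1 > 0" "\<And>j g. holomorphic_ball (g :: complex ^ 'n \<Rightarrow> complex) \<Longrightarrow>
      bergman_integral p ?a (partial_deriv j g) \<le> ennreal C1 * bergman_integral p ?a (radial_deriv g)"
    using bergman_partial_derivs_le_radial_deriv[OF p a] by blast
  define c where "c = ?n powr p * 2 powr \<bar>?a\<bar>"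
  have c: "c \<ge> 0" by (simp add: c_def)
  define C where "C = 1 + 1 / ?V * (c * (?n * C1))"
  have C: "C \<ge> 1" "C \<ge> 1 / ?V * (c * (?n * C1))" using V C1(1) c by (auto simp: C_def)
  have "besov_energy p \<sigma> f \<le> ennreal C * radial_energy p ?a f" if f: "holomorphic_ball f" for f :: "complex ^ 'n \<Rightarrow> complex"
  proof -
    define H where "H j z = ennreal (norm (partial_deriv j f z) powr p * (1 - norm z) powr ?a) * indicator (ball 0 1) z" for j z
    have [measurable]: "H j \<in> borel_measurable borel" for j
      unfolding H_def by (rule borel_measurable_norm_powr_ball[OF partial_deriv_continuous_on[OF f]])
    have "(\<integral>\<^sup>+z. ennreal (norm (complex_gradient f z) powr p * (1 - (norm z)\<^sup>2) powr ?a) * indicator (ball 0 1) z \<partial>lborel)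
        \<le> (\<integral>\<^sup>+z. ennreal c * (\<Sum>j\<in>UNIV. H j z) \<partial>lborel)"
    proof (rule nn_integral_mono)
      fix z :: "complex ^ 'n"
      show "ennreal (norm (complex_gradient f z) powr p * (1 - (norm z)\<^sup>2) powr ?a) * indicator (ball 0 1) z
          \<le> ennreal c * (\<Sum>j\<in>UNIV. H j z)"
      proof (cases "norm z < 1")
        case True
        have "norm (complex_gradient f z) \<le> (\<Sum>j\<in>UNIV. norm (partial_deriv j f z))"
          unfolding norm_vec_def complex_gradient_def using L2_set_le_sum[of UNIV "\<lambda>j. norm (partial_deriv j f z)"] by simp
        then have "norm (complex_gradient f z) powr p \<le> (\<Sum>j\<in>UNIV. norm (partial_deriv j f z)) powr p"
          using p by (intro powr_mono2) auto
        also have "\<dots> \<le> ?n powr p * (\<Sum>j\<in>UNIV. norm (partial_deriv j f z) powr p)"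
          by (rule sum_powr_le[OF _ _ p]) auto
        finally have "norm (complex_gradient f z) powr p * (1 - (norm z)\<^sup>2) powr ?a
            \<le> ?n powr p * (\<Sum>j\<in>UNIV. norm (partial_deriv j f z) powr p) * (2 powr \<bar>?a\<bar> * (1 - norm z) powr ?a)"
          using defining_weight_comparable(1)[OF True, of ?a] by (intro mult_mono) (auto intro!: mult_nonneg_nonneg sum_nonneg)
        also have "\<dots> = c * (\<Sum>j\<in>UNIV. norm (partial_deriv j f z) powr p * (1 - norm z) powr ?a)"
          by (simp add: c_def sum_distrib_right sum_distrib_left mult_ac)
        finally have "ennreal (norm (complex_gradient f z) powr p * (1 - (norm z)\<^sup>2) powr ?a)
            \<le> ennreal (c * (\<Sum>j\<in>UNIV. norm (partial_deriv j f z) powr p * (1 - norm z) powr ?a))"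
          by (rule ennreal_leI)
        also have "\<dots> = ennreal c * (\<Sum>j\<in>UNIV. H j z)"
        proof -
          have H: "(\<Sum>j\<in>UNIV. H j z) = ennreal (\<Sum>j\<in>UNIV. norm (partial_deriv j f z) powr p * (1 - norm z) powr ?a)"
            using True by (simp add: H_def sum_ennreal)
          show ?thesis unfolding H using c by (intro ennreal_mult sum_nonneg) auto
        qed
        finally show ?thesis using True by simp
      qed (simp add: H_def)
    qed
    also have "\<dots> = ennreal c * (\<Sum>j\<in>UNIV. bergman_integral p ?a (partial_deriv j f))"
      by (subst nn_integral_cmult) (simp_all add: nn_integral_sum bergman_integral_def H_def[symmetric, abs_def])
    also have "\<dots> \<le> ennreal c * (\<Sum>j\<in>(UNIV :: 'n set). ennreal C1 * bergman_integral p ?a (radial_deriv f))"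
      by (intro mult_left_mono sum_mono C1(2) f) simp
    also have "\<dots> = ennreal (c * (?n * C1)) * bergman_integral p ?a (radial_deriv f)"
      using c C1(1) by (simp add: ennreal_mult ennreal_of_nat_eq_real_of_nat mult.assoc)
    finally have "ennreal (1 / ?V) * (\<integral>\<^sup>+z. ennreal (norm (complex_gradient f z) powr p * (1 - (norm z)\<^sup>2) powr ?a) * indicator (ball 0 1) z \<partial>lborel)
        \<le> ennreal (1 / ?V) * (ennreal (c * (?n * C1)) * bergman_integral p ?a (radial_deriv f))"
      by (rule mult_left_mono) simp
    also have "\<dots> = ennreal (1 / ?V * (c * (?n * C1))) * bergman_integral p ?a (radial_deriv f)"
      using V c C1(1) by (subst ennreal_mult) (auto simp: mult.assoc)
    also have "\<dots> \<le> ennreal C * bergman_integral p ?a (radial_deriv f)"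
      by (intro mult_right_mono ennreal_leI C) simp
    finally have 1: "ennreal (1 / ?V) * (\<integral>\<^sup>+z. ennreal (norm (complex_gradient f z) powr p * (1 - (norm z)\<^sup>2) powr ?a) * indicator (ball 0 1) z \<partial>lborel)
        \<le> ennreal C * bergman_integral p ?a (radial_deriv f)" .
    have "1 * ennreal (norm (f 0) powr p) \<le> ennreal C * ennreal (norm (f 0) powr p)"
      using C(1) by (intro mult_right_mono) auto
    with 1 show ?thesis
      unfolding besov_energy_eq[OF f p] radial_energy_def distrib_left by (intro add_mono) auto
  qed
  then show thesis using C(1) that[of C] by simp
qed

section \<open>Bounded point evaluations\<close>

lemma norm_diff_le_of_partial_deriv_bound:
  fixes f :: "complex ^ 'n \<Rightarrow> complex"
  assumes f: "holomorphic_ball f" and z: "norm z < 1" and S: "\<And>j w. norm w \<le> norm z \<Longrightarrow> norm (partial_deriv j f w) \<le> S"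
  shows "norm (f z - f 0) \<le> real CARD('n) * S"
proof -
  have S0: "S \<ge> 0" by (rule order_trans[OF norm_ge_zero S[of 0]]) simp
  have "norm (f z - f 0) \<le> (real CARD('n) * S) * norm (z - 0)"
  proof (rule differentiable_bound)
    fix w assume w: "w \<in> cball (0 :: complex ^ 'n) (norm z)"
    show "(f has_derivative (\<lambda>v. \<Sum>j\<in>UNIV. v $ j * partial_deriv j f w)) (at w within cball 0 (norm z))"
      by (rule has_derivative_at_withinI[OF holomorphic_ball_has_derivative[OF f]]) (use w z in simp)
    show "onorm (\<lambda>v. \<Sum>j\<in>UNIV. v $ j * partial_deriv j f w) \<le> real CARD('n) * S"
    proof (rule onorm_le)
      fix v :: "complex ^ 'n"
      have "norm (\<Sum>j\<in>UNIV. v $ j * partial_deriv j f w) \<le> (\<Sum>j\<in>(UNIV :: 'n set). norm v * S)"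
        using w S Finite_Cartesian_Product.norm_nth_le[of v] by (intro sum_norm_le) (auto simp: norm_mult intro!: mult_mono)
      then show "norm (\<Sum>j\<in>UNIV. v $ j * partial_deriv j f w) \<le> real CARD('n) * S * norm v"
        by (simp add: mult_ac)
    qed
  qed auto
  also have "\<dots> \<le> (real CARD('n) * S) * 1"
    using z S0 by (intro mult_left_mono) auto
  finally show ?thesis by simp
qed

text \<open>
  The gradient is bounded on the ball of radius \<open>\<bar>z\<bar>\<close> by its Bergman integral, which the radial derivative
  controls; the mean value theorem on the segment from 0 to \<open>z\<close> then bounds \<open>f(z)\<close>.
\<close>

lemma point_evaluation_bounded:
  fixes z :: "complex ^ 'n"
  assumes p: "p > 1" and a: "a > -1" and z: "norm z < 1"
  obtains C where "C \<ge> 0" "\<And>f :: complex ^ 'n \<Rightarrow> complex. holomorphic_ball f \<Longrightarrow>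
    ennreal (norm (f z) powr p) \<le> ennreal C * radial_energy p a f"
proof -
  let ?n = "real CARD('n)" and ?M = "a + DIM(complex ^ 'n)"
  have "DIM(complex ^ 'n) \<ge> 1" by (rule DIM_ge_Suc0[unfolded One_nat_def[symmetric]])
  then have "real DIM(complex ^ 'n) \<ge> 1" by linarith
  then have M: "?M \<ge> 0" using a by linarith
  obtain C1 where C1: "C1 > 0" "\<And>j g. holomorphic_ball (g :: complex ^ 'n \<Rightarrow> complex) \<Longrightarrow>
      bergman_integral p a (partial_deriv j g) \<le> ennreal C1 * bergman_integral p a (radial_deriv g)"
    using bergman_partial_derivs_le_radial_deriv[OF p a] by blast
  obtain C2 where C2: "C2 > 0" "\<And>h w. holomorphic_ball h \<Longrightarrow> norm w < 1 \<Longrightarrow>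
      ennreal (norm (h w) powr p * (1 - norm w) powr ?M) \<le> ennreal C2 * bergman_integral p a (h :: complex ^ 'n \<Rightarrow> complex)"
    using bergman_point_bound[OF p, where 'n='n and a=a] by blast
  define d where "d = (1 - norm z) powr ?M"
  have d: "d > 0" using z by (simp add: d_def)
  define c where "c = C2 * C1 / d"
  have c: "c > 0" using C1(1) C2(1) d by (simp add: c_def)
  define C where "C = 2 powr p * (1 + ?n powr p * c)"
  have C: "C > 0" using c unfolding C_def by (intro mult_pos_pos add_pos_nonneg) auto
  have "ennreal (norm (f z) powr p) \<le> ennreal C * radial_energy p a f" if f: "holomorphic_ball f" for f :: "complex ^ 'n \<Rightarrow> complex"
  proof (cases "bergman_integral p a (radial_deriv f)")
    case top
    then show ?thesis using C by (simp add: radial_energy_def ennreal_mult_top)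
  next
    case (real i)
    define S where "S = (c * i) powr (1 / p)"
    have Sp: "S powr p = c * i" using p c real(1) by (simp add: S_def powr_powr)
    have S: "norm (partial_deriv j f w) \<le> S" if w: "norm w \<le> norm z" for j w
    proof -
      have "ennreal (norm (partial_deriv j f w) powr p * (1 - norm w) powr ?M) \<le> ennreal C2 * bergman_integral p a (partial_deriv j f)"
        using w z by (intro C2(2) holomorphic_ball_partial_deriv f) auto
      also have "\<dots> \<le> ennreal C2 * (ennreal C1 * ennreal i)"
        using C1(2)[OF f, of j] real by (intro mult_left_mono) auto
      also have "\<dots> = ennreal (C2 * C1 * i)"
        using C1(1) C2(1) real(1) by (simp add: ennreal_mult mult.assoc)
      finally have *: "norm (partial_deriv j f w) powr p * (1 - norm w) powr ?M \<le> C2 * C1 * i"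
        using C1(1) C2(1) real(1) by (simp del: DIM_cart)
      have "d \<le> (1 - norm w) powr ?M"
        unfolding d_def using w z M by (intro powr_mono2) auto
      then have "norm (partial_deriv j f w) powr p * d \<le> norm (partial_deriv j f w) powr p * (1 - norm w) powr ?M"
        by (intro mult_left_mono) auto
      with * have "norm (partial_deriv j f w) powr p * d \<le> C2 * C1 * i" by linarith
      then have "norm (partial_deriv j f w) powr p \<le> c * i"
        using d by (simp add: c_def field_simps)
      then have "(norm (partial_deriv j f w) powr p) powr (1 / p) \<le> S"
        unfolding S_def using p by (intro powr_mono2) auto
      then show ?thesis using p by (simp add: powr_powr)
    qed
    have S0: "S \<ge> 0" by (simp add: S_def)
    have "norm (f z) \<le> norm (f 0) + norm (f z - f 0)" by (rule norm_triangle_sub)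
    then have "norm (f z) \<le> norm (f 0) + ?n * S"
      using norm_diff_le_of_partial_deriv_bound[OF f z S] by linarith
    then have "norm (f z) powr p \<le> (norm (f 0) + ?n * S) powr p"
      using p by (intro powr_mono2) auto
    also have "\<dots> \<le> 2 powr p * (norm (f 0) powr p + (?n * S) powr p)"
      by (rule sum_two_powr_le[OF p]) (use S0 in auto)
    also have "(?n * S) powr p = ?n powr p * c * i"
      using S0 by (simp add: powr_mult Sp)
    also have "2 powr p * (norm (f 0) powr p + ?n powr p * c * i) \<le> C * (norm (f 0) powr p + i)"
    proof -
      have "0 \<le> ?n powr p * c * norm (f 0) powr p" "0 \<le> i" using c real(1) by auto
      then have "norm (f 0) powr p + ?n powr p * c * i \<le> (1 + ?n powr p * c) * (norm (f 0) powr p + i)"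
        by (simp add: algebra_simps)
      then have "2 powr p * (norm (f 0) powr p + ?n powr p * c * i) \<le> 2 powr p * ((1 + ?n powr p * c) * (norm (f 0) powr p + i))"
        by (intro mult_left_mono) auto
      then show ?thesis by (simp add: C_def mult.assoc)
    qed
    finally have "ennreal (norm (f z) powr p) \<le> ennreal (C * (norm (f 0) powr p + i))"
      by (rule ennreal_leI)
    also have "\<dots> = ennreal C * radial_energy p a f"
      using C real by (simp add: radial_energy_def ennreal_mult)
    finally show ?thesis .
  qed
  then show thesis using C that[of C] by simp
qed

section \<open>Multipliers and Carleson measures\<close>

lemma multiplier_measure_integral_eq:
  fixes \<phi> f :: "complex ^ 'n \<Rightarrow> complex"
  assumes \<phi>: "holomorphic_ball \<phi>" and f: "holomorphic_ball f"
  shows "(\<integral>\<^sup>+z. ennreal (norm (f z) powr p) \<partial>multiplier_measure p \<sigma> \<phi>)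
    = ennreal (1 / measure lborel (ball (0 :: complex ^ 'n) 1)) *
      (\<integral>\<^sup>+z. ennreal (norm (radial_deriv \<phi> z * f z) powr p * (1 - (norm z)\<^sup>2) powr besov_exponent TYPE('n) p \<sigma>) * indicator (ball 0 1) z \<partial>lborel)"
proof -
  let ?k = "\<lambda>z :: complex ^ 'n. ennreal (norm (radial_deriv \<phi> z) powr p * (1 - (norm z)\<^sup>2) powr (p + \<sigma> * p - real CARD('n) - 1))"
  let ?u = "\<lambda>z. ennreal (norm (f z) powr p)"
  have "(\<lambda>z. ennreal (norm (f z) powr p * (1 - (norm z)\<^sup>2) powr 0) * indicator (ball 0 1) z) \<in> borel_measurable borel"
    by (rule borel_measurable_norm_powr_sq_ball[OF holomorphic_ball_continuous_on[OF f]])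
  moreover have "ennreal (norm (f z) powr p * (1 - (norm z)\<^sup>2) powr 0) * indicator (ball 0 1) z = ?u z * indicator (ball 0 1) z" for z
    using norm_ge_zero[of z] by (cases "z \<in> ball 0 1") (auto simp: power2_eq_1_iff simp del: norm_ge_zero)
  ultimately have "(\<lambda>z. ?u z * indicator (ball 0 1) z) \<in> borel_measurable borel" by simp
  then have "(\<integral>\<^sup>+z. ?u z \<partial>multiplier_measure p \<sigma> \<phi>) = ennreal (1 / measure lborel (ball (0 :: complex ^ 'n) 1)) *
      (\<integral>\<^sup>+z. ?k z * ?u z * indicator (ball 0 1) z \<partial>lborel)"
    unfolding multiplier_measure_def
    by (intro nn_integral_density_ball_volume borel_measurable_norm_powr_sq_ball
        holomorphic_ball_continuous_on holomorphic_ball_radial_deriv \<phi>)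
  also have "(\<integral>\<^sup>+z. ?k z * ?u z * indicator (ball 0 1) z \<partial>lborel)
      = (\<integral>\<^sup>+z. ennreal (norm (radial_deriv \<phi> z * f z) powr p * (1 - (norm z)\<^sup>2) powr besov_exponent TYPE('n) p \<sigma>) * indicator (ball 0 1) z \<partial>lborel)"
    by (intro nn_integral_cong) (simp add: ennreal_mult[symmetric] norm_mult powr_mult besov_exponent_def mult_ac)
  finally show ?thesis .
qed

lemma multiplier_measure_integral_comparable:
  fixes \<phi> :: "complex ^ 'n \<Rightarrow> complex"
  assumes \<phi>: "holomorphic_ball \<phi>" and p: "p > 1"
  obtains A B where "A > 0" "B > 0"
    "\<And>f. holomorphic_ball f \<Longrightarrow> bergman_integral p (besov_exponent TYPE('n) p \<sigma>) (\<lambda>z. radial_deriv \<phi> z * f z)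
      \<le> ennreal A * (\<integral>\<^sup>+z. ennreal (norm (f z) powr p) \<partial>multiplier_measure p \<sigma> \<phi>)"
    "\<And>f. holomorphic_ball f \<Longrightarrow> (\<integral>\<^sup>+z. ennreal (norm (f z) powr p) \<partial>multiplier_measure p \<sigma> \<phi>)
      \<le> ennreal B * bergman_integral p (besov_exponent TYPE('n) p \<sigma>) (\<lambda>z. radial_deriv \<phi> z * f z)"
proof
  let ?a = "besov_exponent TYPE('n) p \<sigma>" and ?V = "measure lborel (ball (0 :: complex ^ 'n) 1)"
  have V: "?V > 0" by (rule unit_ball_measure_pos)
  show "2 powr \<bar>?a\<bar> * ?V > 0" "1 / ?V * 2 powr \<bar>?a\<bar> > 0" using V by auto
  fix f :: "complex ^ 'n \<Rightarrow> complex" assume f: "holomorphic_ball f"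
  have cont: "continuous_on (ball 0 1) (\<lambda>z. radial_deriv \<phi> z * f z)"
    by (intro continuous_intros holomorphic_ball_continuous_on holomorphic_ball_radial_deriv \<phi> f)
  define J where "J = (\<integral>\<^sup>+z. ennreal (norm (radial_deriv \<phi> z * f z) powr p * (1 - (norm z)\<^sup>2) powr ?a) * indicator (ball 0 1) z \<partial>lborel)"
  have eq: "(\<integral>\<^sup>+z. ennreal (norm (f z) powr p) \<partial>multiplier_measure p \<sigma> \<phi>) = ennreal (1 / ?V) * J"
    unfolding J_def by (rule multiplier_measure_integral_eq[OF \<phi> f])
  have "bergman_integral p ?a (\<lambda>z. radial_deriv \<phi> z * f z) \<le> ennreal (2 powr \<bar>?a\<bar>) * J"
    unfolding J_def by (rule bergman_defining_weight_le[OF cont]) (use p in auto)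
  also have "\<dots> = ennreal (2 powr \<bar>?a\<bar>) * (ennreal ?V * (ennreal (1 / ?V) * J))"
    using ennreal_inverse_mult_cancel[OF V, of J] by simp
  also have "\<dots> = ennreal (2 powr \<bar>?a\<bar> * ?V) * (ennreal (1 / ?V) * J)"
    using V by (simp add: ennreal_mult mult.assoc)
  finally show "bergman_integral p ?a (\<lambda>z. radial_deriv \<phi> z * f z)
      \<le> ennreal (2 powr \<bar>?a\<bar> * ?V) * (\<integral>\<^sup>+z. ennreal (norm (f z) powr p) \<partial>multiplier_measure p \<sigma> \<phi>)"
    unfolding eq .
  have "J \<le> (\<integral>\<^sup>+z. ennreal (2 powr \<bar>?a\<bar>) * (ennreal (norm (radial_deriv \<phi> z * f z) powr p * (1 - norm z) powr ?a) * indicator (ball 0 1) z) \<partial>lborel)"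
    unfolding J_def
  proof (rule nn_integral_mono)
    fix z :: "complex ^ 'n"
    show "ennreal (norm (radial_deriv \<phi> z * f z) powr p * (1 - (norm z)\<^sup>2) powr ?a) * indicator (ball 0 1) z
        \<le> ennreal (2 powr \<bar>?a\<bar>) * (ennreal (norm (radial_deriv \<phi> z * f z) powr p * (1 - norm z) powr ?a) * indicator (ball 0 1) z)"
    proof (cases "norm z < 1")
      case True
      have "norm (radial_deriv \<phi> z * f z) powr p * (1 - (norm z)\<^sup>2) powr ?a
          \<le> norm (radial_deriv \<phi> z * f z) powr p * (2 powr \<bar>?a\<bar> * (1 - norm z) powr ?a)"
        by (intro mult_left_mono defining_weight_comparable(1)[OF True]) auto
      then have "ennreal (norm (radial_deriv \<phi> z * f z) powr p * (1 - (norm z)\<^sup>2) powr ?a)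
          \<le> ennreal (2 powr \<bar>?a\<bar> * (norm (radial_deriv \<phi> z * f z) powr p * (1 - norm z) powr ?a))"
        by (intro ennreal_leI) (simp only: mult_ac)
      also have "\<dots> = ennreal (2 powr \<bar>?a\<bar>) * ennreal (norm (radial_deriv \<phi> z * f z) powr p * (1 - norm z) powr ?a)"
        by (rule ennreal_mult) auto
      finally show ?thesis using True by simp
    qed simp
  qed
  also have "\<dots> = ennreal (2 powr \<bar>?a\<bar>) * bergman_integral p ?a (\<lambda>z. radial_deriv \<phi> z * f z)"
    unfolding bergman_integral_def
    by (rule nn_integral_cmult) (use borel_measurable_norm_powr_ball[OF cont] in simp)
  finally have "ennreal (1 / ?V) * J \<le> ennreal (1 / ?V) * (ennreal (2 powr \<bar>?a\<bar>) * bergman_integral p ?a (\<lambda>z. radial_deriv \<phi> z * f z))"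
    by (rule mult_left_mono) simp
  also have "\<dots> = ennreal (1 / ?V * 2 powr \<bar>?a\<bar>) * bergman_integral p ?a (\<lambda>z. radial_deriv \<phi> z * f z)"
    using V by (subst ennreal_mult) (auto simp: mult.assoc)
  finally show "(\<integral>\<^sup>+z. ennreal (norm (f z) powr p) \<partial>multiplier_measure p \<sigma> \<phi>)
      \<le> ennreal (1 / ?V * 2 powr \<bar>?a\<bar>) * bergman_integral p ?a (\<lambda>z. radial_deriv \<phi> z * f z)"
    unfolding eq .
qed

lemma besov_energy_eq_ennreal:
  assumes "f \<in> besov_space p \<sigma>"
  shows "besov_energy p \<sigma> f = ennreal (enn2real (besov_energy p \<sigma> f))"
  using assms by (simp add: besov_space_def)

lemma besov_norm_powr:
  assumes "p > 1" "f \<in> besov_space p \<sigma>"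
  shows "besov_energy p \<sigma> f = ennreal (besov_norm p \<sigma> f powr p)"
  using besov_energy_eq_ennreal[OF assms(2)] assms(1) by (simp add: besov_norm_def powr_powr)

text \<open>
  Working with energies, which may be infinite, avoids separate proofs that \<open>T f\<close> belongs to the space.
\<close>

lemma besov_bounded_op_iff_energy:
  assumes p: "p > 1"
  shows "besov_bounded_op p \<sigma> T \<longleftrightarrow>
    (\<exists>C>0. \<forall>f\<in>besov_space p \<sigma>. holomorphic_ball (T f) \<and> besov_energy p \<sigma> (T f) \<le> ennreal C * besov_energy p \<sigma> f)"
proof
  assume T: "besov_bounded_op p \<sigma> T"
  then obtain C where C: "\<And>f. f \<in> besov_space p \<sigma> \<Longrightarrow> T f \<in> besov_space p \<sigma>"
      "\<And>f. f \<in> besov_space p \<sigma> \<Longrightarrow> besov_norm p \<sigma> (T f) \<le> C * besov_norm p \<sigma> f"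
    unfolding besov_bounded_op_def by blast
  \<comment> \<open>The constant of a bounded operator is an arbitrary real number; \<open>\<bar>C\<bar> + 1\<close> is a positive substitute.\<close>
  have "besov_energy p \<sigma> (T f) \<le> ennreal ((\<bar>C\<bar> + 1) powr p) * besov_energy p \<sigma> f" if f: "f \<in> besov_space p \<sigma>" for f
  proof -
    have n: "besov_norm p \<sigma> g \<ge> 0" for g by (simp add: besov_norm_def)
    have "besov_norm p \<sigma> (T f) \<le> (\<bar>C\<bar> + 1) * besov_norm p \<sigma> f"
      using C(2)[OF f] mult_right_mono[of C "\<bar>C\<bar> + 1" "besov_norm p \<sigma> f"] n[of f] by linarith
    then have "besov_norm p \<sigma> (T f) powr p \<le> ((\<bar>C\<bar> + 1) * besov_norm p \<sigma> f) powr p"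
      using p n by (intro powr_mono2) auto
    then show ?thesis
      using n by (simp add: besov_norm_powr[OF p] f C(1) powr_mult ennreal_mult[symmetric] ennreal_leI)
  qed
  moreover have "holomorphic_ball (T f)" if "f \<in> besov_space p \<sigma>" for f
    using C(1)[OF that] by (simp add: besov_space_def)
  moreover have "(\<bar>C\<bar> + 1) powr p > 0" by simp
  ultimately show "\<exists>C>0. \<forall>f\<in>besov_space p \<sigma>. holomorphic_ball (T f) \<and> besov_energy p \<sigma> (T f) \<le> ennreal C * besov_energy p \<sigma> f"
    by blast
next
  assume "\<exists>C>0. \<forall>f\<in>besov_space p \<sigma>. holomorphic_ball (T f) \<and> besov_energy p \<sigma> (T f) \<le> ennreal C * besov_energy p \<sigma> f"
  then obtain C where C: "C > 0" "\<And>f. f \<in> besov_space p \<sigma> \<Longrightarrow> holomorphic_ball (T f)"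
      "\<And>f. f \<in> besov_space p \<sigma> \<Longrightarrow> besov_energy p \<sigma> (T f) \<le> ennreal C * besov_energy p \<sigma> f"
    by blast
  have mem: "T f \<in> besov_space p \<sigma>" if f: "f \<in> besov_space p \<sigma>" for f
  proof -
    have "ennreal C * besov_energy p \<sigma> f < \<infinity>" using f by (simp add: besov_space_def ennreal_mult_less_top)
    with C(3)[OF f] C(2)[OF f] show ?thesis unfolding besov_space_def using le_less_trans by blast
  qed
  have "besov_norm p \<sigma> (T f) \<le> C powr (1 / p) * besov_norm p \<sigma> f" if f: "f \<in> besov_space p \<sigma>" for f
  proof -
    have "ennreal (enn2real (besov_energy p \<sigma> (T f))) \<le> ennreal (C * enn2real (besov_energy p \<sigma> f))"
      using C(3)[OF f] C(1) besov_energy_eq_ennreal[OF f] besov_energy_eq_ennreal[OF mem[OF f]]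
      by (metis ennreal_mult enn2real_nonneg less_imp_le)
    then have "enn2real (besov_energy p \<sigma> (T f)) \<le> C * enn2real (besov_energy p \<sigma> f)"
      using C(1) by simp
    then have "enn2real (besov_energy p \<sigma> (T f)) powr (1 / p) \<le> (C * enn2real (besov_energy p \<sigma> f)) powr (1 / p)"
      using p by (intro powr_mono2) auto
    then show ?thesis using C(1) by (simp add: besov_norm_def powr_mult)
  qed
  with mem show "besov_bounded_op p \<sigma> T" unfolding besov_bounded_op_def by blast
qed

lemma besov_carleson_iff_energy:
  assumes p: "p > 1"
  shows "besov_carleson p \<sigma> \<mu> \<longleftrightarrow> sets \<mu> = sets (restrict_space borel (ball 0 1)) \<and>
    (\<exists>C>0. \<forall>f\<in>besov_space p \<sigma>. (\<integral>\<^sup>+z. ennreal (norm (f z) powr p) \<partial>\<mu>) \<le> ennreal C * besov_energy p \<sigma> f)"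
proof -
  have "ennreal (C * besov_norm p \<sigma> f powr p) = ennreal C * besov_energy p \<sigma> f"
    if "f \<in> besov_space p \<sigma>" "C > 0" for C and f :: "complex ^ 'a \<Rightarrow> complex"
    using that by (simp add: besov_norm_powr[OF p] ennreal_mult)
  then show ?thesis unfolding besov_carleson_def by auto
qed

lemma sets_multiplier_measure:
  "sets (multiplier_measure p \<sigma> \<phi>) = sets (restrict_space borel (ball 0 1))"
  unfolding multiplier_measure_def ball_volume_measure_def
  by (simp add: sets_restrict_space)

lemma besov_energy_one: "p > 0 \<Longrightarrow> besov_energy p \<sigma> (\<lambda>_. 1) = 1"
  by (simp add: besov_energy_def complex_gradient_def partial_deriv_def zero_vec_def[symmetric])

lemma le_of_all_powers_le:
  fixes x C D :: real
  assumes "C > 0" "\<And>k::nat. x ^ k \<le> D * C ^ k"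
  shows "x \<le> C"
proof (rule ccontr)
  assume "\<not> x \<le> C"
  then have "x / C > 1" using assms(1) by simp
  then obtain k where "D < (x / C) ^ k" using real_arch_pow by blast
  then have "D * C ^ k < x ^ k" using assms(1) by (simp add: power_divide field_simps)
  with assms(2)[of k] show False by simp
qed

text \<open>
  The \<open>k\<close>-th iterate of the multiplication operator sends 1 to \<open>\<phi>^k\<close>, so a bounded point evaluation gives
  \<open>\<bar>\<phi>(z)\<bar>^(pk) \<le> D C^k\<close> with \<open>D\<close> independent of \<open>k\<close>.
\<close>

lemma multiplier_bounded:
  fixes \<phi> :: "complex ^ 'n \<Rightarrow> complex"
  assumes p: "p > 1" and a: "besov_exponent TYPE('n) p \<sigma> > -1" and C: "C > 0"
    and bdd: "\<And>f. f \<in> besov_space p \<sigma> \<Longrightarrow> holomorphic_ball (mult_op \<phi> f) \<and>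
      besov_energy p \<sigma> (mult_op \<phi> f) \<le> ennreal C * besov_energy p \<sigma> f"
    and z: "norm z < 1"
  shows "norm (\<phi> z) powr p \<le> C"
proof -
  have pow: "(\<lambda>z. \<phi> z ^ k) \<in> besov_space p \<sigma> \<and> besov_energy p \<sigma> (\<lambda>z. \<phi> z ^ k) \<le> ennreal (C ^ k)" for k
  proof (induction k)
    case 0
    then show ?case using p by (simp add: besov_space_def besov_energy_one)
  next
    case (Suc k)
    have eq: "mult_op \<phi> (\<lambda>z. \<phi> z ^ k) = (\<lambda>z. \<phi> z ^ Suc k)" by (simp add: mult_op_def)
    have "besov_energy p \<sigma> (\<lambda>z. \<phi> z ^ Suc k) \<le> ennreal C * besov_energy p \<sigma> (\<lambda>z. \<phi> z ^ k)"
      using bdd[of "\<lambda>z. \<phi> z ^ k"] Suc eq by simp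
    also have "\<dots> \<le> ennreal C * ennreal (C ^ k)" using Suc by (intro mult_left_mono) auto
    also have "\<dots> = ennreal (C ^ Suc k)" using C by (simp add: ennreal_mult)
    finally have "besov_energy p \<sigma> (\<lambda>z. \<phi> z ^ Suc k) \<le> ennreal (C ^ Suc k)" .
    moreover from this have "besov_energy p \<sigma> (\<lambda>z. \<phi> z ^ Suc k) < \<infinity>"
      using ennreal_less_top le_less_trans by (metis infinity_ennreal_def)
    ultimately show ?case using bdd[of "\<lambda>z. \<phi> z ^ k"] Suc eq by (simp add: besov_space_def)
  qed
  obtain D where D: "D \<ge> 0" "\<And>f :: complex ^ 'n \<Rightarrow> complex. holomorphic_ball f \<Longrightarrow>
      ennreal (norm (f z) powr p) \<le> ennreal D * radial_energy p (besov_exponent TYPE('n) p \<sigma>) f"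
    using point_evaluation_bounded[OF p a z] by blast
  obtain D' where D': "D' > 0" "\<And>f :: complex ^ 'n \<Rightarrow> complex. holomorphic_ball f \<Longrightarrow>
      radial_energy p (besov_exponent TYPE('n) p \<sigma>) f \<le> ennreal D' * besov_energy p \<sigma> f"
    using radial_energy_le_besov_energy[OF p] by blast
  show ?thesis
  proof (rule le_of_all_powers_le[OF C])
    fix k
    have hol: "holomorphic_ball (\<lambda>z. \<phi> z ^ k)" using pow by (simp add: besov_space_def)
    have "ennreal (norm (\<phi> z ^ k) powr p) \<le> ennreal D * radial_energy p (besov_exponent TYPE('n) p \<sigma>) (\<lambda>z. \<phi> z ^ k)"
      by (rule D(2)[OF hol])
    also have "\<dots> \<le> ennreal D * (ennreal D' * besov_energy p \<sigma> (\<lambda>z. \<phi> z ^ k))"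
      by (intro mult_left_mono D'(2) hol) simp
    also have "\<dots> \<le> ennreal D * (ennreal D' * ennreal (C ^ k))"
      using pow[of k] by (intro mult_left_mono) auto
    also have "\<dots> = ennreal (D * D' * C ^ k)"
      using D(1) D'(1) C by (simp add: ennreal_mult[symmetric] mult.assoc)
    finally have "norm (\<phi> z ^ k) powr p \<le> D * D' * C ^ k"
      using D(1) D'(1) C by simp
    moreover have "norm (\<phi> z ^ k) powr p = (norm (\<phi> z) powr p) ^ k"
      by (induction k) (simp_all add: norm_mult powr_mult)
    ultimately show "(norm (\<phi> z) powr p) ^ k \<le> D * D' * C ^ k" by simp
  qed
qed

text \<open>
  The Carleson inequality comes from \<open>f R\<phi> = R(\<phi>f) - \<phi> Rf\<close>: the operator bound controls the first
  term and boundedness of \<open>\<phi>\<close> the second.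
\<close>

lemma bounded_multiplier_imp_carleson:
  fixes \<phi> :: "complex ^ 'n \<Rightarrow> complex"
  assumes \<phi>: "holomorphic_ball \<phi>" and p: "p > 1" and a: "besov_exponent TYPE('n) p \<sigma> > -1"
    and bdd: "besov_bounded_op p \<sigma> (mult_op \<phi>)"
  shows "\<phi> \<in> Hinfty \<and> besov_carleson p \<sigma> (multiplier_measure p \<sigma> \<phi>)"
proof -
  let ?a = "besov_exponent TYPE('n) p \<sigma>"
  obtain C where C: "C > 0" "\<And>f. f \<in> besov_space p \<sigma> \<Longrightarrow> holomorphic_ball (mult_op \<phi> f) \<and>
      besov_energy p \<sigma> (mult_op \<phi> f) \<le> ennreal C * besov_energy p \<sigma> f"
    using bdd unfolding besov_bounded_op_iff_energy[OF p] by blast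
  define m where "m = C powr (1 / p)"
  have m: "m \<ge> 0" by (simp add: m_def)
  have \<phi>_le: "norm (\<phi> z) \<le> m" if "norm z < 1" for z
  proof -
    have "(norm (\<phi> z) powr p) powr (1 / p) \<le> m"
      unfolding m_def using multiplier_bounded[OF p a C that] p by (intro powr_mono2) auto
    then show ?thesis using p by (simp add: powr_powr)
  qed
  then have "\<phi> \<in> Hinfty"
    using \<phi> unfolding Hinfty_def bounded_iff by (auto intro!: exI[of _ m])
  moreover have "besov_carleson p \<sigma> (multiplier_measure p \<sigma> \<phi>)"
  proof -
    obtain B where B: "B > 0" "\<And>f. holomorphic_ball f \<Longrightarrow> (\<integral>\<^sup>+z. ennreal (norm (f z) powr p) \<partial>multiplier_measure p \<sigma> \<phi>)
        \<le> ennreal B * bergman_integral p ?a (\<lambda>z. radial_deriv \<phi> z * f z)"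
      using multiplier_measure_integral_comparable[OF \<phi> p, of \<sigma>] by metis
    obtain D where D: "D > 0" "\<And>f :: complex ^ 'n \<Rightarrow> complex. holomorphic_ball f \<Longrightarrow>
        radial_energy p ?a f \<le> ennreal D * besov_energy p \<sigma> f"
      using radial_energy_le_besov_energy[OF p] by blast
    have R: "bergman_integral p ?a (radial_deriv f) \<le> ennreal D * besov_energy p \<sigma> f" if "holomorphic_ball f" for f :: "complex ^ 'n \<Rightarrow> complex"
      using D(2)[OF that] unfolding radial_energy_def by (rule order_trans[rotated]) simp
    define K where "K = B * (2 powr p * (D * C + m powr p * D))"
    have K: "K > 0" using B(1) D(1) C(1) by (auto simp: K_def intro!: mult_pos_pos add_pos_nonneg)
    have "(\<integral>\<^sup>+z. ennreal (norm (f z) powr p) \<partial>multiplier_measure p \<sigma> \<phi>) \<le> ennreal K * besov_energy p \<sigma> f"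
      if fs: "f \<in> besov_space p \<sigma>" for f
    proof -
      have f: "holomorphic_ball f" using fs by (simp add: besov_space_def)
      have \<phi>f: "holomorphic_ball (\<lambda>z. \<phi> z * f z)" "besov_energy p \<sigma> (\<lambda>z. \<phi> z * f z) \<le> ennreal C * besov_energy p \<sigma> f"
        using C(2)[OF fs] by (auto simp: mult_op_def)
      have Rf: "continuous_on (ball 0 1) (radial_deriv f)"
        by (intro holomorphic_ball_continuous_on holomorphic_ball_radial_deriv f)
      have "bergman_integral p ?a (\<lambda>z. radial_deriv \<phi> z * f z)
          \<le> ennreal (2 powr p) * (bergman_integral p ?a (radial_deriv (\<lambda>z. \<phi> z * f z)) + bergman_integral p ?a (\<lambda>z. \<phi> z * radial_deriv f z))"
      proof (rule bergman_integral_add_le[OF _ _ _ p])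
        show "norm (radial_deriv \<phi> z * f z) \<le> norm (radial_deriv (\<lambda>z. \<phi> z * f z) z) + norm (\<phi> z * radial_deriv f z)"
          if "norm z < 1" for z
          using norm_triangle_ineq4[of "radial_deriv (\<lambda>z. \<phi> z * f z) z" "\<phi> z * radial_deriv f z"] that
          by (simp add: radial_deriv_mult[OF \<phi> f])
      qed (intro holomorphic_ball_continuous_on holomorphic_ball_radial_deriv holomorphic_ball_mult \<phi> f)+
      also have "\<dots> \<le> ennreal (2 powr p) * (ennreal D * (ennreal C * besov_energy p \<sigma> f) + ennreal (m powr p) * (ennreal D * besov_energy p \<sigma> f))"
      proof (intro mult_left_mono add_mono)
        show "bergman_integral p ?a (radial_deriv (\<lambda>z. \<phi> z * f z)) \<le> ennreal D * (ennreal C * besov_energy p \<sigma> f)"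
          by (rule order_trans[OF R[OF \<phi>f(1)]]) (intro mult_left_mono \<phi>f(2), simp)
        have "bergman_integral p ?a (\<lambda>z. \<phi> z * radial_deriv f z) \<le> ennreal (m powr p) * bergman_integral p ?a (radial_deriv f)"
          by (rule bergman_integral_cmult_le[OF m Rf]) (use \<phi>_le p in \<open>auto simp: norm_mult intro!: mult_right_mono\<close>)
        also have "\<dots> \<le> ennreal (m powr p) * (ennreal D * besov_energy p \<sigma> f)"
          by (intro mult_left_mono R f) simp
        finally show "bergman_integral p ?a (\<lambda>z. \<phi> z * radial_deriv f z) \<le> ennreal (m powr p) * (ennreal D * besov_energy p \<sigma> f)" .
      qed simp
      also have "\<dots> = ennreal (2 powr p * (D * C + m powr p * D)) * besov_energy p \<sigma> f"
        using D(1) C(1) by (simp add: ennreal_mult ennreal_plus distrib_left distrib_right mult.assoc)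
      finally have "ennreal B * bergman_integral p ?a (\<lambda>z. radial_deriv \<phi> z * f z)
          \<le> ennreal B * (ennreal (2 powr p * (D * C + m powr p * D)) * besov_energy p \<sigma> f)"
        by (rule mult_left_mono) simp
      also have "\<dots> = ennreal K * besov_energy p \<sigma> f"
        using B(1) D(1) C(1) unfolding K_def by (subst ennreal_mult) (auto simp: mult.assoc)
      finally show ?thesis using B(2)[OF f] by (rule order_trans[rotated])
    qed
    then show ?thesis
      unfolding besov_carleson_iff_energy[OF p] using K sets_multiplier_measure by blast
  qed
  ultimately show ?thesis ..
qed

text \<open>
  In \<open>R(\<phi>f) = \<phi> Rf + f R\<phi>\<close> the first term is controlled because \<open>\<phi>\<close> is bounded, and the second by the
  Carleson inequality.
\<close>

lemma carleson_imp_bounded_multiplier: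
  fixes \<phi> :: "complex ^ 'n \<Rightarrow> complex"
  assumes \<phi>: "holomorphic_ball \<phi>" and p: "p > 1" and a: "besov_exponent TYPE('n) p \<sigma> > -1"
    and Hinf: "\<phi> \<in> Hinfty" and carl: "besov_carleson p \<sigma> (multiplier_measure p \<sigma> \<phi>)"
  shows "besov_bounded_op p \<sigma> (mult_op \<phi>)"
proof -
  let ?a = "besov_exponent TYPE('n) p \<sigma>"
  obtain m0 where m0: "\<And>z. norm z < 1 \<Longrightarrow> norm (\<phi> z) \<le> m0"
    using Hinf unfolding Hinfty_def bounded_iff by fastforce
  define m where "m = \<bar>m0\<bar>"
  have m: "m \<ge> 0" by (simp add: m_def)
  have \<phi>_le: "norm (\<phi> z) \<le> m" if "norm z < 1" for z
    using m0[OF that] by (simp add: m_def)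
  obtain K where K: "K > 0" "\<And>f. f \<in> besov_space p \<sigma> \<Longrightarrow>
      (\<integral>\<^sup>+z. ennreal (norm (f z) powr p) \<partial>multiplier_measure p \<sigma> \<phi>) \<le> ennreal K * besov_energy p \<sigma> f"
    using carl unfolding besov_carleson_iff_energy[OF p] by blast
  obtain A where A: "A > 0" "\<And>f. holomorphic_ball f \<Longrightarrow> bergman_integral p ?a (\<lambda>z. radial_deriv \<phi> z * f z)
      \<le> ennreal A * (\<integral>\<^sup>+z. ennreal (norm (f z) powr p) \<partial>multiplier_measure p \<sigma> \<phi>)"
    using multiplier_measure_integral_comparable[OF \<phi> p, of \<sigma>] by metis
  obtain D where D: "D > 0" "\<And>f :: complex ^ 'n \<Rightarrow> complex. holomorphic_ball f \<Longrightarrow>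
      radial_energy p ?a f \<le> ennreal D * besov_energy p \<sigma> f"
    using radial_energy_le_besov_energy[OF p] by blast
  obtain E where E: "E > 0" "\<And>f :: complex ^ 'n \<Rightarrow> complex. holomorphic_ball f \<Longrightarrow>
      besov_energy p \<sigma> f \<le> ennreal E * radial_energy p ?a f"
    using besov_energy_le_radial_energy[OF p a] by blast
  define L where "L = m powr p * D + 2 powr p * (m powr p * D + A * K)"
  have L: "L > 0" using A(1) K(1) D(1) by (auto simp: L_def intro!: mult_pos_pos add_nonneg_pos)
  have "holomorphic_ball (mult_op \<phi> f) \<and> besov_energy p \<sigma> (mult_op \<phi> f) \<le> ennreal (E * L) * besov_energy p \<sigma> f"
    if fs: "f \<in> besov_space p \<sigma>" for f
  proof
    have f: "holomorphic_ball f" using fs by (simp add: besov_space_def)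
    show hol: "holomorphic_ball (mult_op \<phi> f)"
      unfolding mult_op_def by (rule holomorphic_ball_mult[OF \<phi> f])
    have Rf: "continuous_on (ball 0 1) (radial_deriv f)"
      by (intro holomorphic_ball_continuous_on holomorphic_ball_radial_deriv f)
    have \<phi>R: "bergman_integral p ?a (\<lambda>z. \<phi> z * radial_deriv f z) \<le> ennreal (m powr p) * (ennreal D * besov_energy p \<sigma> f)"
    proof -
      have "bergman_integral p ?a (\<lambda>z. \<phi> z * radial_deriv f z) \<le> ennreal (m powr p) * bergman_integral p ?a (radial_deriv f)"
        by (rule bergman_integral_cmult_le[OF m Rf]) (use \<phi>_le p in \<open>auto simp: norm_mult intro!: mult_right_mono\<close>)
      also have "\<dots> \<le> ennreal (m powr p) * radial_energy p ?a f"
        unfolding radial_energy_def by (intro mult_left_mono) auto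
      also have "\<dots> \<le> ennreal (m powr p) * (ennreal D * besov_energy p \<sigma> f)"
        by (intro mult_left_mono D f) simp
      finally show ?thesis .
    qed
    have R\<phi>: "bergman_integral p ?a (\<lambda>z. radial_deriv \<phi> z * f z) \<le> ennreal A * (ennreal K * besov_energy p \<sigma> f)"
      by (rule order_trans[OF A(2)[OF f]]) (intro mult_left_mono K fs, simp)
    have "bergman_integral p ?a (radial_deriv (mult_op \<phi> f))
        \<le> ennreal (2 powr p) * (bergman_integral p ?a (\<lambda>z. \<phi> z * radial_deriv f z) + bergman_integral p ?a (\<lambda>z. radial_deriv \<phi> z * f z))"
      unfolding mult_op_def
    proof (rule bergman_integral_add_le[OF _ _ _ p])
      show "norm (radial_deriv (\<lambda>z. \<phi> z * f z) z) \<le> norm (\<phi> z * radial_deriv f z) + norm (radial_deriv \<phi> z * f z)"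
        if "norm z < 1" for z
        using that by (simp add: radial_deriv_mult[OF \<phi> f] norm_triangle_ineq)
    qed (intro holomorphic_ball_continuous_on holomorphic_ball_radial_deriv holomorphic_ball_mult \<phi> f)+
    also have "\<dots> \<le> ennreal (2 powr p) * (ennreal (m powr p) * (ennreal D * besov_energy p \<sigma> f) + ennreal A * (ennreal K * besov_energy p \<sigma> f))"
      by (intro mult_left_mono add_mono \<phi>R R\<phi>) simp
    finally have R: "bergman_integral p ?a (radial_deriv (mult_op \<phi> f)) \<le>
        ennreal (2 powr p) * (ennreal (m powr p) * (ennreal D * besov_energy p \<sigma> f) + ennreal A * (ennreal K * besov_energy p \<sigma> f))" .
    have at0: "ennreal (norm (mult_op \<phi> f 0) powr p) \<le> ennreal (m powr p) * (ennreal D * besov_energy p \<sigma> f)"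
    proof -
      have "norm (mult_op \<phi> f 0) powr p \<le> (m * norm (f 0)) powr p"
        using \<phi>_le[of 0] p by (intro powr_mono2) (auto simp: mult_op_def norm_mult intro!: mult_right_mono)
      then have "ennreal (norm (mult_op \<phi> f 0) powr p) \<le> ennreal (m powr p) * ennreal (norm (f 0) powr p)"
        using m by (simp add: powr_mult ennreal_mult[symmetric] ennreal_leI)
      also have "\<dots> \<le> ennreal (m powr p) * radial_energy p ?a f"
        unfolding radial_energy_def by (intro mult_left_mono) auto
      also have "\<dots> \<le> ennreal (m powr p) * (ennreal D * besov_energy p \<sigma> f)"
        by (intro mult_left_mono D f) simp
      finally show ?thesis .
    qed
    have "besov_energy p \<sigma> (mult_op \<phi> f) \<le> ennreal E * radial_energy p ?a (mult_op \<phi> f)"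
      by (rule E(2)[OF hol])
    also have "\<dots> \<le> ennreal E * (ennreal (m powr p) * (ennreal D * besov_energy p \<sigma> f)
        + ennreal (2 powr p) * (ennreal (m powr p) * (ennreal D * besov_energy p \<sigma> f) + ennreal A * (ennreal K * besov_energy p \<sigma> f)))"
      unfolding radial_energy_def by (intro mult_left_mono add_mono at0 R) simp
    also have "\<dots> = ennreal (E * L) * besov_energy p \<sigma> f"
      using A(1) K(1) D(1) E(1) unfolding L_def
      by (simp add: ennreal_mult ennreal_plus distrib_left distrib_right mult.assoc)
    finally show "besov_energy p \<sigma> (mult_op \<phi> f) \<le> ennreal (E * L) * besov_energy p \<sigma> f" .
  qed
  moreover have "E * L > 0" using E(1) L by simp
  ultimately show ?thesis unfolding besov_bounded_op_iff_energy[OF p] by blast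
qed

theorem corollary3p1:
  fixes \<phi> :: "complex ^ 'n \<Rightarrow> complex" and p \<sigma> :: real
  assumes "CARD('n) > 1"
    and "holomorphic_ball \<phi>"
    and "1 < p" and "0 \<le> \<sigma>" and "1 + \<sigma> > real CARD('n) / p"
  shows "besov_bounded_op p \<sigma> (mult_op \<phi>) \<longleftrightarrow>
         \<phi> \<in> Hinfty \<and> besov_carleson p \<sigma> (multiplier_measure p \<sigma> \<phi>)"
proof -
  have "besov_exponent TYPE('n) p \<sigma> > -1"
    using assms(3,5) by (simp add: besov_exponent_def field_simps)
  then show ?thesis
    using bounded_multiplier_imp_carleson[OF assms(2,3)] carleson_imp_bounded_multiplier[OF assms(2,3)] by blast
qed

end
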